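(* Let $R$ be an Artinian ring (i.e., left and right Artinian). Then $R$ is finitarily Frobenius if and only if $R$ is both left MacWilliams and right MacWilliams.
   Context: Rings are unital (not necessarily commutative). $\mathrm{rad}\,R$ is the Jacobson radical of $R$. A ring is quasi-Frobenius if it is left Artinian and left self-injective (injective as a left module over itself). The finitary left socle $\mathrm{soc}^{\ast}({}_R R)$ (resp. finitary right socle $\mathrm{soc}^{\ast}(R_R)$) is the sum of all minimal left (resp. right) ideals of $R$ that are finite as sets. A ring $R$ is finitarily Frobenius if it is quasi-Frobenius and $\mathrm{soc}^{\ast}({}_R R)$ embeds as a left module into ${}_R(R/\mathrm{rad}\,R)$; for quasi-Frobenius $R$ this embedding condition is equivalent to: $\mathrm{soc}^{\ast}(R_R)$ embeds as a right module into $(R/\mathrm{rad}\,R)_R$. The Hamming weight on $R$ is $w_{\mathrm{H}}(x)=0$ if $x=0$ and $w_{\mathrm{H}}(x)=1$ otherwise; for $x\in R^n$ put $w_{\mathrm{H}}(x)=\sum_{i=1}^n w_{\mathrm{H}}(x_i)$. Let $U(R)$ be the group of units of $R$. For $n\ge 1$, $\sigma\in S_n$, $u\in U(R)^n$ let $\Phi_{\sigma,u}(x)=(x_{\sigma 1}u_1,\dots,x_{\sigma n}u_n)$ and $\Psi_{\sigma,u}(x)=(u_1x_{\sigma 1},\dots,u_nx_{\sigma n})$ for $x\in R^n$. The ring $R$ is left (resp. right) MacWilliams if, for every $n\ge1$ and any homomorphism $\phi\colon M\to N$ of left (resp. right) $R$-modules between submodules $M,N$ of ${}_R R^n$ (resp.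 $R^n_R$) with $w_{\mathrm{H}}(\phi(x))=w_{\mathrm{H}}(x)$ for all $x\in M$, there exist $\sigma\in S_n$ and $u\in U(R)^n$ such that $\phi(x)=\Phi_{\sigma,u}(x)$ (resp. $\phi(x)=\Psi_{\sigma,u}(x)$) for all $x\in M$. *)

theory Defs
  imports "HOL-Algebra.Algebra"
begin

text \<open>
  The library locale \<^locale>\<open>module\<close> requires a commutative ring of scalars, so left modules over a
  possibly noncommutative ring get a locale of their own.  They use the library record type
  \<^type>\<open>module\<close>, whose ring-multiplication and unit fields carry no meaning here.  The library
  predicate \<^const>\<open>submodule\<close> asks only for an additive subgroup closed under the scalar action; it
  is therefore used for left and for right modules alike, a right module being encoded with
  \<open>a \<odot>\<^bsub>M\<^esub> x\<close> standing for \<open>x \<cdot> a\<close>.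
\<close>

locale left_module = R?: ring R + M?: abelian_group M
  for R :: "('a, 'r) ring_scheme" (structure) and M :: "('a, 'm, 'c) module_scheme" (structure) +
  assumes smult_closed:
      "\<lbrakk>a \<in> carrier R; x \<in> carrier M\<rbrakk> \<Longrightarrow> a \<odot>\<^bsub>M\<^esub> x \<in> carrier M"
    and smult_l_distr:
      "\<lbrakk>a \<in> carrier R; b \<in> carrier R; x \<in> carrier M\<rbrakk> \<Longrightarrow>
        (a \<oplus>\<^bsub>R\<^esub> b) \<odot>\<^bsub>M\<^esub> x = a \<odot>\<^bsub>M\<^esub> x \<oplus>\<^bsub>M\<^esub> b \<odot>\<^bsub>M\<^esub> x"
    and smult_r_distr:
      "\<lbrakk>a \<in> carrier R; x \<in> carrier M; y \<in> carrier M\<rbrakk> \<Longrightarrow>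
        a \<odot>\<^bsub>M\<^esub> (x \<oplus>\<^bsub>M\<^esub> y) = a \<odot>\<^bsub>M\<^esub> x \<oplus>\<^bsub>M\<^esub> a \<odot>\<^bsub>M\<^esub> y"
    and smult_assoc:
      "\<lbrakk>a \<in> carrier R; b \<in> carrier R; x \<in> carrier M\<rbrakk> \<Longrightarrow>
        (a \<otimes>\<^bsub>R\<^esub> b) \<odot>\<^bsub>M\<^esub> x = a \<odot>\<^bsub>M\<^esub> (b \<odot>\<^bsub>M\<^esub> x)"
    and smult_one:
      "x \<in> carrier M \<Longrightarrow> \<one>\<^bsub>R\<^esub> \<odot>\<^bsub>M\<^esub> x = x"

definition mod_homs ::
  "('a, 'r) ring_scheme \<Rightarrow> ('a, 'm, 'c) module_scheme \<Rightarrow> ('a, 'n, 'd) module_scheme \<Rightarrow> ('m \<Rightarrow> 'n) set"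
  where "mod_homs R M N =
    {f \<in> carrier M \<rightarrow> carrier N.
       (\<forall>x\<in>carrier M. \<forall>y\<in>carrier M. f (x \<oplus>\<^bsub>M\<^esub> y) = f x \<oplus>\<^bsub>N\<^esub> f y) \<and>
       (\<forall>a\<in>carrier R. \<forall>x\<in>carrier M. f (a \<odot>\<^bsub>M\<^esub> x) = a \<odot>\<^bsub>N\<^esub> f x)}"

definition embeds_in ::
  "('a, 'r) ring_scheme \<Rightarrow> ('a, 'm, 'c) module_scheme \<Rightarrow> ('a, 'n, 'd) module_scheme \<Rightarrow> bool"
  where "embeds_in R M N \<longleftrightarrow> (\<exists>f \<in> mod_homs R M N. inj_on f (carrier M))"

definition left_regular :: "('a, 'r) ring_scheme \<Rightarrow> ('a, 'a) module"
  where "left_regular R =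
    \<lparr>carrier = carrier R, monoid.mult = monoid.mult R, one = one R, ring.zero = ring.zero R, ring.add = ring.add R,
     smult = (\<lambda>a x. a \<otimes>\<^bsub>R\<^esub> x)\<rparr>"

definition right_regular :: "('a, 'r) ring_scheme \<Rightarrow> ('a, 'a) module"
  where "right_regular R =
    \<lparr>carrier = carrier R, monoid.mult = monoid.mult R, one = one R, ring.zero = ring.zero R, ring.add = ring.add R,
     smult = (\<lambda>a x. x \<otimes>\<^bsub>R\<^esub> a)\<rparr>"

definition left_ideal :: "'a set \<Rightarrow> ('a, 'r) ring_scheme \<Rightarrow> bool"
  where "left_ideal I R \<longleftrightarrow> submodule I R (left_regular R)"

definition right_ideal :: "'a set \<Rightarrow> ('a, 'r) ring_scheme \<Rightarrow> bool"
  where "right_ideal I R \<longleftrightarrow> submodule I R (right_regular R)"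

definition left_artinian :: "('a, 'r) ring_scheme \<Rightarrow> bool"
  where "left_artinian R \<longleftrightarrow>
    (\<forall>I :: nat \<Rightarrow> 'a set. (\<forall>k. left_ideal (I k) R \<and> I (Suc k) \<subseteq> I k) \<longrightarrow>
       (\<exists>m. \<forall>k\<ge>m. I k = I m))"

definition right_artinian :: "('a, 'r) ring_scheme \<Rightarrow> bool"
  where "right_artinian R \<longleftrightarrow>
    (\<forall>I :: nat \<Rightarrow> 'a set. (\<forall>k. right_ideal (I k) R \<and> I (Suc k) \<subseteq> I k) \<longrightarrow>
       (\<exists>m. \<forall>k\<ge>m. I k = I m))"

definition maximal_left_ideal :: "'a set \<Rightarrow> ('a, 'r) ring_scheme \<Rightarrow> bool"
  where "maximal_left_ideal I R \<longleftrightarrow>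
    left_ideal I R \<and> I \<noteq> carrier R \<and>
    (\<forall>J. left_ideal J R \<and> I \<subseteq> J \<longrightarrow> J = I \<or> J = carrier R)"

definition minimal_left_ideal :: "'a set \<Rightarrow> ('a, 'r) ring_scheme \<Rightarrow> bool"
  where "minimal_left_ideal I R \<longleftrightarrow>
    left_ideal I R \<and> I \<noteq> {\<zero>\<^bsub>R\<^esub>} \<and>
    (\<forall>J. left_ideal J R \<and> J \<subseteq> I \<longrightarrow> J = {\<zero>\<^bsub>R\<^esub>} \<or> J = I)"

definition jacobson_radical :: "('a, 'r) ring_scheme \<Rightarrow> 'a set"
  where "jacobson_radical R = {x \<in> carrier R. \<forall>I. maximal_left_ideal I R \<longrightarrow> x \<in> I}"

definition finitary_left_socle :: "('a, 'r) ring_scheme \<Rightarrow> 'a set"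
  where "finitary_left_socle R =
    {\<Oplus>\<^bsub>R\<^esub> I\<in>F. s I | F s.
       finite F \<and> (\<forall>I\<in>F. minimal_left_ideal I R \<and> finite I \<and> s I \<in> I)}"

text \<open>For a two-sided ideal \<open>J\<close>, the ring \<open>R/J\<close> as a left \<open>R\<close>-module: \<open>a \<cdot> C = (J + a) C\<close>.\<close>

definition left_quotient :: "('a, 'r) ring_scheme \<Rightarrow> 'a set \<Rightarrow> ('a, 'a set) module"
  where "left_quotient R J =
    \<lparr>carrier = carrier (R Quot J), monoid.mult = monoid.mult (R Quot J), one = one (R Quot J),
     ring.zero = ring.zero (R Quot J), ring.add = ring.add (R Quot J),
     smult = (\<lambda>a C. (J +>\<^bsub>R\<^esub> a) \<otimes>\<^bsub>R Quot J\<^esub> C)\<rparr>"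

text \<open>
  Injectivity quantifies over all modules, which is possible in HOL only for modules whose elements
  come from a given type \<open>'m\<close>; the first argument names it.  By Baer's criterion the choice of
  \<open>'m\<close> does not matter as soon as the underlying type \<open>'a\<close> of the ring embeds into it.  Instances
  are of the form \<open>'a + 'x\<close> with \<open>'x\<close> a free type variable, hence cover the modules over every type.
\<close>

definition left_injective ::
  "'m itself \<Rightarrow> ('a, 'r) ring_scheme \<Rightarrow> ('a, 'e, 'c) module_scheme \<Rightarrow> bool"
  where "left_injective U R E \<longleftrightarrow>
    (\<forall>(M :: ('a, 'm) module) L f.
       left_module R M \<and> submodule L R M \<and> f \<in> mod_homs R (M\<lparr>carrier := L\<rparr>) E \<longrightarrow>
       (\<exists>g \<in> mod_homs R M E. \<forall>x\<in>L. g x = f x))"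

definition quasi_frobenius :: "'m itself \<Rightarrow> ('a, 'r) ring_scheme \<Rightarrow> bool"
  where "quasi_frobenius U R \<longleftrightarrow>
    ring R \<and> left_artinian R \<and> left_injective U R (left_regular R)"

definition finitarily_frobenius :: "'m itself \<Rightarrow> ('a, 'r) ring_scheme \<Rightarrow> bool"
  where "finitarily_frobenius U R \<longleftrightarrow>
    quasi_frobenius U R \<and>
    embeds_in R ((left_regular R)\<lparr>carrier := finitary_left_socle R\<rparr>)
      (left_quotient R (jacobson_radical R))"

text \<open>
  Elements of \<open>R\<^sup>n\<close> are extensional functions on \<open>{..<n}\<close>, so coordinates are numbered from \<open>0\<close>.
\<close>

definition left_power :: "('a, 'r) ring_scheme \<Rightarrow> nat \<Rightarrow> ('a, nat \<Rightarrow> 'a) module"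
  where "left_power R n =
    \<lparr>carrier = {..<n} \<rightarrow>\<^sub>E carrier R,
     monoid.mult = (\<lambda>x y. \<lambda>i\<in>{..<n}. x i \<otimes>\<^bsub>R\<^esub> y i), one = (\<lambda>i\<in>{..<n}. \<one>\<^bsub>R\<^esub>),
     ring.zero = (\<lambda>i\<in>{..<n}. \<zero>\<^bsub>R\<^esub>), ring.add = (\<lambda>x y. \<lambda>i\<in>{..<n}. x i \<oplus>\<^bsub>R\<^esub> y i),
     smult = (\<lambda>a x. \<lambda>i\<in>{..<n}. a \<otimes>\<^bsub>R\<^esub> x i)\<rparr>"

definition right_power :: "('a, 'r) ring_scheme \<Rightarrow> nat \<Rightarrow> ('a, nat \<Rightarrow> 'a) module"
  where "right_power R n =
    \<lparr>carrier = {..<n} \<rightarrow>\<^sub>E carrier R,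
     monoid.mult = (\<lambda>x y. \<lambda>i\<in>{..<n}. x i \<otimes>\<^bsub>R\<^esub> y i), one = (\<lambda>i\<in>{..<n}. \<one>\<^bsub>R\<^esub>),
     ring.zero = (\<lambda>i\<in>{..<n}. \<zero>\<^bsub>R\<^esub>), ring.add = (\<lambda>x y. \<lambda>i\<in>{..<n}. x i \<oplus>\<^bsub>R\<^esub> y i),
     smult = (\<lambda>a x. \<lambda>i\<in>{..<n}. x i \<otimes>\<^bsub>R\<^esub> a)\<rparr>"

definition hamming :: "('a, 'r) ring_scheme \<Rightarrow> 'a \<Rightarrow> nat"
  where "hamming R x = (if x = \<zero>\<^bsub>R\<^esub> then 0 else 1)"

definition hamming_weight :: "('a, 'r) ring_scheme \<Rightarrow> nat \<Rightarrow> (nat \<Rightarrow> 'a) \<Rightarrow> nat"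
  where "hamming_weight R n x = (\<Sum>i<n. hamming R (x i))"

definition Phi_map ::
  "('a, 'r) ring_scheme \<Rightarrow> nat \<Rightarrow> (nat \<Rightarrow> nat) \<Rightarrow> (nat \<Rightarrow> 'a) \<Rightarrow> (nat \<Rightarrow> 'a) \<Rightarrow> (nat \<Rightarrow> 'a)"
  where "Phi_map R n \<sigma> u x = (\<lambda>i\<in>{..<n}. x (\<sigma> i) \<otimes>\<^bsub>R\<^esub> u i)"

definition Psi_map ::
  "('a, 'r) ring_scheme \<Rightarrow> nat \<Rightarrow> (nat \<Rightarrow> nat) \<Rightarrow> (nat \<Rightarrow> 'a) \<Rightarrow> (nat \<Rightarrow> 'a) \<Rightarrow> (nat \<Rightarrow> 'a)"
  where "Psi_map R n \<sigma> u x = (\<lambda>i\<in>{..<n}. u i \<otimes>\<^bsub>R\<^esub> x (\<sigma> i))"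

definition left_macwilliams :: "('a, 'r) ring_scheme \<Rightarrow> bool"
  where "left_macwilliams R \<longleftrightarrow>
    (\<forall>n\<ge>1. \<forall>M N \<phi>.
       submodule M R (left_power R n) \<and> submodule N R (left_power R n) \<and>
       \<phi> \<in> mod_homs R ((left_power R n)\<lparr>carrier := M\<rparr>) ((left_power R n)\<lparr>carrier := N\<rparr>) \<and>
       (\<forall>x\<in>M. hamming_weight R n (\<phi> x) = hamming_weight R n x) \<longrightarrow>
       (\<exists>\<sigma> u. \<sigma> permutes {..<n} \<and> u \<in> {..<n} \<rightarrow> Units R \<and>
          (\<forall>x\<in>M. \<phi> x = Phi_map R n \<sigma> u x)))"

definition right_macwilliams :: "('a, 'r) ring_scheme \<Rightarrow> bool"
  where "right_macwilliams R \<longleftrightarrow>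
    (\<forall>n\<ge>1. \<forall>M N \<phi>.
       submodule M R (right_power R n) \<and> submodule N R (right_power R n) \<and>
       \<phi> \<in> mod_homs R ((right_power R n)\<lparr>carrier := M\<rparr>) ((right_power R n)\<lparr>carrier := N\<rparr>) \<and>
       (\<forall>x\<in>M. hamming_weight R n (\<phi> x) = hamming_weight R n x) \<longrightarrow>
       (\<exists>\<sigma> u. \<sigma> permutes {..<n} \<and> u \<in> {..<n} \<rightarrow> Units R \<and>
          (\<forall>x\<in>M. \<phi> x = Psi_map R n \<sigma> u x)))"

end

theory Submission
  imports Defs "HOL-Library.Equipollence" "HOL-Combinatorics.Permutations"
begin

text \<open>
  Let \<open>J\<close> be the radical and \<open>T\<close> the right annihilator of \<open>J\<close>, that is, the socle.

  If \<open>R\<close> is quasi-Frobenius, counting homomorphisms between the finite socle and \<open>R/J\<close> turns the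
  embedding condition into a symmetric one: \<open>xR\<close> and \<open>Rx\<close> have the same cardinality for every \<open>x\<close> in
  \<open>T\<close> with \<open>Rx\<close> finite.  The coordinates of a code and of its isometric image are homomorphisms
  \<open>M \<rightarrow> R\<close> whose kernels have indicator functions with equal sums.  B. H. Neumann's lemma on finite
  coset coverings reduces such a linear relation to subgroups of finite index in each other, and the
  cardinality condition excludes what remains, so every kernel occurs equally often on both sides.
  Two homomorphisms \<open>M \<rightarrow> R\<close> with the same kernel differ by a right multiplication, by
  self-injectivity, and the factor can be chosen to be a unit, because \<open>R/J\<close> is semisimple.

  Conversely, the MacWilliams property in length one says that elements with the same annihilator
  on one side generate the same principal ideal on the other.  A comparison of composition lengths
  then yields the double annihilator conditions, hence self-injectivity.  If the finite socle is not
  cyclic, Moebius-type weights on its submodules produce two codes of equal weights that are not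
  monomially equivalent.  If it is generated by \<open>x\<close>, then it is isomorphic to \<open>R/l(x)\<close>, a quotient and
  thus a direct summand of \<open>R/J\<close>.
\<close>

section \<open>One-sided ideals and annihilators\<close>

text \<open>Codes may be infinite, so character sums are out of reach. Their place is taken by the
  right multiplications on a finite part of the socle, and the cardinality condition says that there
  are as many of them as elements, as for the characters of a finite abelian group. It has its
  origin in \<open>R/J\<close>: in a semisimple ring \<open>eRf\<close> and \<open>fRe\<close> have
  the same size for idempotents \<open>e\<close>, \<open>f\<close>, because for simple summands both
  vanish or an isomorphism carries one to the other.

  The second obstacle is one-sidedness: self-injectivity and the embedding are conditions on the
  left. Arguments are carried out on the left and read again in \<open>opp R\<close>.
  Self-injectivity reaches the opposite ring through the double annihilator conditions, the
  cardinality condition through the fact that \<open>Rx\<close> is finite if \<open>xR\<close> is.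

  In the converse the two sides alternate: by one MacWilliams property a cover of left ideals
  becomes, under annihilation, a cover of right ideals or collapses, and the other property leads
  back. A double annihilator is thus never longer than the ideal it contains.\<close>

definition opp :: "('a, 'r) ring_scheme \<Rightarrow> ('a, 'r) ring_scheme"
  where "opp R = monoid.mult_update (\<lambda>_ x y. y \<otimes>\<^bsub>R\<^esub> x) R"

definition lann :: "('a, 'r) ring_scheme \<Rightarrow> 'a set \<Rightarrow> 'a set"
  where "lann R U = {a \<in> carrier R. \<forall>x\<in>U. a \<otimes>\<^bsub>R\<^esub> x = \<zero>\<^bsub>R\<^esub>}"

definition rann :: "('a, 'r) ring_scheme \<Rightarrow> 'a set \<Rightarrow> 'a set"
  where "rann R U = {a \<in> carrier R. \<forall>x\<in>U. x \<otimes>\<^bsub>R\<^esub> a = \<zero>\<^bsub>R\<^esub>}"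

definition lprin :: "('a, 'r) ring_scheme \<Rightarrow> 'a \<Rightarrow> 'a set"
  where "lprin R x = (\<lambda>a. a \<otimes>\<^bsub>R\<^esub> x) ` carrier R"

definition rprin :: "('a, 'r) ring_scheme \<Rightarrow> 'a \<Rightarrow> 'a set"
  where "rprin R x = (\<lambda>a. x \<otimes>\<^bsub>R\<^esub> a) ` carrier R"

lemma opp_sel [simp]:
  "carrier (opp R) = carrier R" "x \<otimes>\<^bsub>opp R\<^esub> y = y \<otimes>\<^bsub>R\<^esub> x" "\<one>\<^bsub>opp R\<^esub> = \<one>\<^bsub>R\<^esub>"
  "\<zero>\<^bsub>opp R\<^esub> = \<zero>\<^bsub>R\<^esub>" "x \<oplus>\<^bsub>opp R\<^esub> y = x \<oplus>\<^bsub>R\<^esub> y"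
  by (simp_all add: opp_def)

lemma minus_opp [simp]: "a_inv (opp R) = a_inv R" "a_minus (opp R) = a_minus R"
  by (simp_all add: opp_def a_inv_def a_minus_def m_inv_def fun_eq_iff)

lemma opp_opp [simp]: "opp (opp R) = R"
  by (simp add: opp_def)

lemma Units_opp [simp]: "Units (opp R) = Units R"
  by (auto simp: Units_def)

lemma set_add_opp [simp]: "A <+>\<^bsub>opp R\<^esub> B = A <+>\<^bsub>R\<^esub> B"
  by (simp add: opp_def set_add_def set_mult_def)

lemma left_ideal_opp [simp]: "left_ideal I (opp R) \<longleftrightarrow> right_ideal I R"
  and right_ideal_opp [simp]: "right_ideal I (opp R) \<longleftrightarrow> left_ideal I R"
  by (simp_all add: left_ideal_def right_ideal_def submodule_def subgroup_def submodule_axioms_def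
      left_regular_def right_regular_def opp_def m_inv_def)

lemma lann_opp [simp]: "lann (opp R) = rann R" and rann_opp [simp]: "rann (opp R) = lann R"
  and lprin_opp [simp]: "lprin (opp R) = rprin R" and rprin_opp [simp]: "rprin (opp R) = lprin R"
  by (simp_all add: lann_def rann_def lprin_def rprin_def fun_eq_iff)

lemma left_artinian_opp [simp]: "left_artinian (opp R) \<longleftrightarrow> right_artinian R"
  and right_artinian_opp [simp]: "right_artinian (opp R) \<longleftrightarrow> left_artinian R"
  by (simp_all add: left_artinian_def right_artinian_def)

lemma set_add_mem: "z \<in> A <+>\<^bsub>R\<^esub> B \<longleftrightarrow> (\<exists>a\<in>A. \<exists>b\<in>B. z = a \<oplus>\<^bsub>R\<^esub> b)"
  by (auto simp: set_add_def set_mult_def)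

context ring
begin

lemma add_minus_cancel_left: "x \<in> carrier R \<Longrightarrow> y \<in> carrier R \<Longrightarrow> (x \<oplus> y) \<ominus> x = y"
  by (simp add: minus_eq a_assoc a_lcomm[of x y] r_neg)

lemma minus_add_cancel: "x \<in> carrier R \<Longrightarrow> y \<in> carrier R \<Longrightarrow> (x \<ominus> y) \<oplus> y = x"
  by (simp add: minus_eq a_assoc l_neg)

lemma ring_opp: "ring (opp R)"
proof (rule ringI)
  show "abelian_group (opp R)"
  proof (rule abelian_groupI)
    show "\<exists>y\<in>carrier (opp R). y \<oplus>\<^bsub>opp R\<^esub> x = \<zero>\<^bsub>opp R\<^esub>" if "x \<in> carrier (opp R)" for x
      using that by (intro bexI[of _ "\<ominus> x"]) (auto simp: l_neg)
  qed (auto simp: a_ac)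
  show "monoid (opp R)"
    by (rule monoidI) (auto simp: m_assoc)
qed (auto simp: l_distr r_distr)

lemma left_ideal_iff:
  "left_ideal I R \<longleftrightarrow> I \<subseteq> carrier R \<and> \<zero> \<in> I \<and> (\<forall>x\<in>I. \<forall>y\<in>I. x \<oplus> y \<in> I) \<and>
     (\<forall>a\<in>carrier R. \<forall>x\<in>I. a \<otimes> x \<in> I)" (is "?A \<longleftrightarrow> ?B")
proof
  assume ?A
  then interpret submodule I R "left_regular R" by (simp add: left_ideal_def)
  show ?B
    using subset m_closed one_closed smult_closed by (auto simp: left_regular_def)
next
  assume B: ?B
  have inv: "m_inv (add_monoid R) x \<in> I" if "x \<in> I" for x
  proof -
    have "\<ominus> \<one> \<otimes> x \<in> I" "x \<in> carrier R" using B that by auto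
    then show ?thesis by (simp add: l_minus a_inv_def[symmetric])
  qed
  have "m_inv (add_monoid (left_regular R)) x = m_inv (add_monoid R) x" for x
    by (simp add: left_regular_def m_inv_def)
  then have "subgroup I (add_monoid (left_regular R))"
    using B inv by (auto simp: subgroup_def left_regular_def)
  then show ?A
    using B unfolding left_ideal_def submodule_def submodule_axioms_def by (auto simp: left_regular_def)
qed

lemma right_ideal_iff:
  "right_ideal I R \<longleftrightarrow> I \<subseteq> carrier R \<and> \<zero> \<in> I \<and> (\<forall>x\<in>I. \<forall>y\<in>I. x \<oplus> y \<in> I) \<and>
     (\<forall>a\<in>carrier R. \<forall>x\<in>I. x \<otimes> a \<in> I)"
  using ring.left_ideal_iff[OF ring_opp] by simp

lemma left_idealI:
  assumes "I \<subseteq> carrier R" "\<zero> \<in> I" "\<And>x y. x \<in> I \<Longrightarrow> y \<in> I \<Longrightarrow> x \<oplus> y \<in> I"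
    "\<And>a x. a \<in> carrier R \<Longrightarrow> x \<in> I \<Longrightarrow> a \<otimes> x \<in> I"
  shows "left_ideal I R"
  using assms by (auto simp: left_ideal_iff)

lemma right_idealI:
  assumes "I \<subseteq> carrier R" "\<zero> \<in> I" "\<And>x y. x \<in> I \<Longrightarrow> y \<in> I \<Longrightarrow> x \<oplus> y \<in> I"
    "\<And>a x. a \<in> carrier R \<Longrightarrow> x \<in> I \<Longrightarrow> x \<otimes> a \<in> I"
  shows "right_ideal I R"
  using assms by (auto simp: right_ideal_iff)

lemma left_idealD:
  assumes "left_ideal I R"
  shows "I \<subseteq> carrier R" "x \<in> I \<Longrightarrow> x \<in> carrier R" "\<zero> \<in> I" "x \<in> I \<Longrightarrow> y \<in> I \<Longrightarrow> x \<oplus> y \<in> I"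
    "a \<in> carrier R \<Longrightarrow> x \<in> I \<Longrightarrow> a \<otimes> x \<in> I" "x \<in> I \<Longrightarrow> \<ominus> x \<in> I"
    "x \<in> I \<Longrightarrow> y \<in> I \<Longrightarrow> x \<ominus> y \<in> I"
proof -
  show neg: "\<ominus> x \<in> I" if "x \<in> I" for x
  proof -
    have "\<ominus> \<one> \<otimes> x \<in> I" "x \<in> carrier R" using assms that by (auto simp: left_ideal_iff)
    then show ?thesis by (simp add: l_minus)
  qed
  show "x \<in> I \<Longrightarrow> y \<in> I \<Longrightarrow> x \<ominus> y \<in> I"
    using neg assms by (auto simp: left_ideal_iff minus_eq)
qed (use assms in \<open>auto simp: left_ideal_iff\<close>)

lemma right_idealD:
  assumes "right_ideal I R"
  shows "I \<subseteq> carrier R" "x \<in> I \<Longrightarrow> x \<in> carrier R" "\<zero> \<in> I" "x \<in> I \<Longrightarrow> y \<in> I \<Longrightarrow> x \<oplus> y \<in> I"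
    "a \<in> carrier R \<Longrightarrow> x \<in> I \<Longrightarrow> x \<otimes> a \<in> I" "x \<in> I \<Longrightarrow> \<ominus> x \<in> I"
    "x \<in> I \<Longrightarrow> y \<in> I \<Longrightarrow> x \<ominus> y \<in> I"
  using ring.left_idealD[OF ring_opp, of I] assms by simp_all

lemma left_ideal_eq_carrier: "left_ideal I R \<Longrightarrow> \<one> \<in> I \<Longrightarrow> I = carrier R"
  using left_idealD(1)[of I] left_idealD(5)[of I _ \<one>] by force

lemma left_ideal_carrier [simp]: "left_ideal (carrier R) R"
  and left_ideal_zero [simp]: "left_ideal {\<zero>} R"
  by (auto intro!: left_idealI)

lemma right_ideal_zero [simp]: "right_ideal {\<zero>} R"
  by (auto intro!: right_idealI)

lemma left_ideal_Int: "left_ideal I R \<Longrightarrow> left_ideal J R \<Longrightarrow> left_ideal (I \<inter> J) R"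
  by (auto simp: left_ideal_iff)

lemma right_ideal_Int: "right_ideal I R \<Longrightarrow> right_ideal J R \<Longrightarrow> right_ideal (I \<inter> J) R"
  by (auto simp: right_ideal_iff)

lemma left_ideal_sum:
  assumes "left_ideal I R" "left_ideal J R"
  shows "left_ideal (I <+>\<^bsub>R\<^esub> J) R"
proof (rule left_idealI)
  note I = left_idealD[OF assms(1)] and J = left_idealD[OF assms(2)]
  show "I <+>\<^bsub>R\<^esub> J \<subseteq> carrier R" using I J by (auto simp: set_add_mem)
  show "\<zero> \<in> I <+>\<^bsub>R\<^esub> J" using I(3) J(3) by (force simp: set_add_mem)
  show "x \<oplus> y \<in> I <+>\<^bsub>R\<^esub> J" if "x \<in> I <+>\<^bsub>R\<^esub> J" "y \<in> I <+>\<^bsub>R\<^esub> J" for x y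
  proof -
    obtain a b where 1: "a \<in> I" "b \<in> J" "x = a \<oplus> b" using \<open>x \<in> _\<close> by (auto simp: set_add_mem)
    obtain c d where 2: "c \<in> I" "d \<in> J" "y = c \<oplus> d" using \<open>y \<in> _\<close> by (auto simp: set_add_mem)
    have "x \<oplus> y = (a \<oplus> c) \<oplus> (b \<oplus> d)" using 1 2 I(2) J(2) by (simp add: a_ac)
    moreover have "a \<oplus> c \<in> I" "b \<oplus> d \<in> J" using 1 2 I(4) J(4) by auto
    ultimately show ?thesis by (auto simp: set_add_mem)
  qed
  show "a \<otimes> x \<in> I <+>\<^bsub>R\<^esub> J" if "a \<in> carrier R" "x \<in> I <+>\<^bsub>R\<^esub> J" for a x
  proof -
    obtain c b where 1: "c \<in> I" "b \<in> J" "x = c \<oplus> b" using \<open>x \<in> _\<close> by (auto simp: set_add_mem)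
    have "a \<otimes> x = a \<otimes> c \<oplus> a \<otimes> b" using 1 I(2) J(2) that by (simp add: r_distr)
    moreover have "a \<otimes> c \<in> I" "a \<otimes> b \<in> J" using 1 I(5) J(5) that by auto
    ultimately show ?thesis by (auto simp: set_add_mem)
  qed
qed

lemma right_ideal_sum: "right_ideal I R \<Longrightarrow> right_ideal J R \<Longrightarrow> right_ideal (I <+>\<^bsub>R\<^esub> J) R"
  using ring.left_ideal_sum[OF ring_opp] by simp

lemma set_add_upper:
  assumes "left_ideal I R" "left_ideal J R"
  shows "I \<subseteq> I <+>\<^bsub>R\<^esub> J" "J \<subseteq> I <+>\<^bsub>R\<^esub> J"
proof -
  note I = left_idealD[OF assms(1)] and J = left_idealD[OF assms(2)]
  show "I \<subseteq> I <+>\<^bsub>R\<^esub> J"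
  proof
    fix x assume "x \<in> I"
    then have "x = x \<oplus> \<zero>" using I(2) by simp
    then show "x \<in> I <+>\<^bsub>R\<^esub> J" using \<open>x \<in> I\<close> J(3) unfolding set_add_mem by blast
  qed
  show "J \<subseteq> I <+>\<^bsub>R\<^esub> J"
  proof
    fix x assume "x \<in> J"
    then have "x = \<zero> \<oplus> x" using J(2) by simp
    then show "x \<in> I <+>\<^bsub>R\<^esub> J" using \<open>x \<in> J\<close> I(3) unfolding set_add_mem by blast
  qed
qed

lemma set_add_least:
  assumes "left_ideal L R" "I \<subseteq> L" "J \<subseteq> L"
  shows "I <+>\<^bsub>R\<^esub> J \<subseteq> L"
  using assms left_idealD(4)[OF assms(1)] unfolding set_add_mem subset_iff by blast

lemma left_ideal_lprin [simp]: "x \<in> carrier R \<Longrightarrow> left_ideal (lprin R x) R"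
proof (rule left_idealI)
  assume x: "x \<in> carrier R"
  show "\<zero> \<in> lprin R x" using x unfolding lprin_def by (intro image_eqI[of _ _ \<zero>]) auto
  show "y \<oplus> z \<in> lprin R x" if "y \<in> lprin R x" "z \<in> lprin R x" for y z
    using that x unfolding lprin_def by (auto simp: l_distr[symmetric])
  show "a \<otimes> y \<in> lprin R x" if "a \<in> carrier R" "y \<in> lprin R x" for a y
    using that x unfolding lprin_def by (auto simp: m_assoc[symmetric])
qed (auto simp: lprin_def)

lemma right_ideal_rprin [simp]: "x \<in> carrier R \<Longrightarrow> right_ideal (rprin R x) R"
  using ring.left_ideal_lprin[OF ring_opp] by simp

lemma lprin_self: "x \<in> carrier R \<Longrightarrow> x \<in> lprin R x"
  unfolding lprin_def by (intro image_eqI[of _ _ \<one>]) auto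

lemma rprin_self: "x \<in> carrier R \<Longrightarrow> x \<in> rprin R x"
  unfolding rprin_def by (intro image_eqI[of _ _ \<one>]) auto

lemma lprin_least: "left_ideal L R \<Longrightarrow> x \<in> L \<Longrightarrow> lprin R x \<subseteq> L"
  unfolding lprin_def using left_idealD(5) by auto

lemma rprin_least: "right_ideal L R \<Longrightarrow> x \<in> L \<Longrightarrow> rprin R x \<subseteq> L"
  unfolding rprin_def using right_idealD(5) by auto

lemma left_ideal_lann [simp]: "U \<subseteq> carrier R \<Longrightarrow> left_ideal (lann R U) R"
  by (rule left_idealI) (auto simp: lann_def l_distr m_assoc subset_iff)

lemma right_ideal_rann [simp]: "U \<subseteq> carrier R \<Longrightarrow> right_ideal (rann R U) R"
  using ring.left_ideal_lann[OF ring_opp] by simp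

lemma right_ideal_lann: "left_ideal U R \<Longrightarrow> right_ideal (lann R U) R"
  by (rule right_idealI) (auto simp: lann_def l_distr m_assoc left_ideal_iff subset_iff)

lemma left_ideal_rann: "right_ideal U R \<Longrightarrow> left_ideal (rann R U) R"
  using ring.right_ideal_lann[OF ring_opp] by simp

lemma lann_antimono: "U \<subseteq> Y \<Longrightarrow> lann R Y \<subseteq> lann R U"
  and rann_antimono: "U \<subseteq> Y \<Longrightarrow> rann R Y \<subseteq> rann R U"
  by (auto simp: lann_def rann_def)

lemma lann_rann_subset: "U \<subseteq> carrier R \<Longrightarrow> U \<subseteq> lann R (rann R U)"
  and rann_lann_subset: "U \<subseteq> carrier R \<Longrightarrow> U \<subseteq> rann R (lann R U)"
  by (auto simp: lann_def rann_def)

lemma rann_lprin: "x \<in> carrier R \<Longrightarrow> rann R (lprin R x) = rann R {x}"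
proof -
  assume x: "x \<in> carrier R"
  have "rann R (lprin R x) \<subseteq> rann R {x}" by (rule rann_antimono) (simp add: lprin_self x)
  then show ?thesis using x by (auto simp: rann_def lprin_def m_assoc)
qed

lemma lann_rprin: "x \<in> carrier R \<Longrightarrow> lann R (rprin R x) = lann R {x}"
  using ring.rann_lprin[OF ring_opp] by simp

lemma rann_set_add:
  assumes "left_ideal I R" "left_ideal J R"
  shows "rann R (I <+>\<^bsub>R\<^esub> J) = rann R I \<inter> rann R J"
proof
  show "rann R (I <+>\<^bsub>R\<^esub> J) \<subseteq> rann R I \<inter> rann R J"
    using rann_antimono[OF set_add_upper(1)[OF assms]] rann_antimono[OF set_add_upper(2)[OF assms]] by auto
  show "rann R I \<inter> rann R J \<subseteq> rann R (I <+>\<^bsub>R\<^esub> J)"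
    using left_idealD(2)[OF assms(1)] left_idealD(2)[OF assms(2)]
    by (auto simp: rann_def set_add_mem l_distr)
qed

lemma lann_set_add:
  "right_ideal I R \<Longrightarrow> right_ideal J R \<Longrightarrow> lann R (I <+>\<^bsub>R\<^esub> J) = lann R I \<inter> lann R J"
  using ring.rann_set_add[OF ring_opp] by simp

lemma left_ideal_colon:
  assumes "left_ideal L R" "x \<in> carrier R"
  shows "left_ideal {r \<in> carrier R. r \<otimes> x \<in> L} R"
  using assms left_idealD[OF assms(1)] by (intro left_idealI) (auto simp: l_distr m_assoc)

lemma left_artinian_minimal:
  assumes "left_artinian R" "\<D> \<noteq> {}" "\<And>I. I \<in> \<D> \<Longrightarrow> left_ideal I R"
  obtains I where "I \<in> \<D>" "\<And>J. J \<in> \<D> \<Longrightarrow> J \<subseteq> I \<Longrightarrow> J = I"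
proof (rule ccontr)
  assume "\<not> thesis"
  then have step: "\<forall>I\<in>\<D>. \<exists>J\<in>\<D>. J \<subset> I" using that by blast
  then obtain f where f: "\<And>I. I \<in> \<D> \<Longrightarrow> f I \<in> \<D> \<and> f I \<subset> I" by metis
  obtain I0 where "I0 \<in> \<D>" using assms(2) by auto
  define g where "g = (\<lambda>n. (f ^^ n) I0)"
  have g: "g n \<in> \<D>" for n by (induction n) (use f \<open>I0 \<in> \<D>\<close> in \<open>auto simp: g_def\<close>)
  have s: "g (Suc n) \<subset> g n" for n using f[OF g[of n]] by (simp add: g_def)
  have "left_ideal (g k) R \<and> g (Suc k) \<subseteq> g k" for k using g s assms(3) by blast
  then obtain m where m: "\<forall>k\<ge>m. g k = g m"
    using assms(1)[unfolded left_artinian_def, rule_format, of g] by blast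
  have "g (Suc m) = g m" using m by (meson le_SucI le_refl)
  then show False using s[of m] by simp
qed

lemma left_artinian_wf:
  assumes "left_artinian R"
  shows "wf {(I, J). left_ideal I R \<and> left_ideal J R \<and> I \<subset> J}"
proof (rule wfI_min)
  fix x :: "'a set" and Q assume x: "x \<in> Q"
  show "\<exists>z\<in>Q. \<forall>y. (y, z) \<in> {(I, J). left_ideal I R \<and> left_ideal J R \<and> I \<subset> J} \<longrightarrow> y \<notin> Q"
  proof (cases "left_ideal x R")
    case True
    then have "{I \<in> Q. left_ideal I R} \<noteq> {}" using x by auto
    then obtain I where "I \<in> {I \<in> Q. left_ideal I R}"
      "\<And>J. J \<in> {I \<in> Q. left_ideal I R} \<Longrightarrow> J \<subseteq> I \<Longrightarrow> J = I"
      using left_artinian_minimal[OF assms, of "{I \<in> Q. left_ideal I R}"] by blast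
    then show ?thesis by (intro bexI[of _ I]) auto
  qed (use x in auto)
qed

lemma minimal_left_ideal_exists:
  assumes "left_artinian R" "left_ideal I R" "I \<noteq> {\<zero>}"
  obtains S where "minimal_left_ideal S R" "S \<subseteq> I"
proof -
  let ?S = "{S. left_ideal S R \<and> S \<noteq> {\<zero>} \<and> S \<subseteq> I}"
  have "?S \<noteq> {}" using assms by auto
  then obtain S where "S \<in> ?S" "\<And>J. J \<in> ?S \<Longrightarrow> J \<subseteq> S \<Longrightarrow> J = S"
    using left_artinian_minimal[OF assms(1), of ?S] by blast
  then show thesis by (intro that[of S]) (auto simp: minimal_left_ideal_def)
qed

text \<open>The descending chain of the left ideals generated by the powers of \<open>x\<close>
  becomes stationary, so x^m = d x^(m+1) for some \<open>d\<close>. Powers of \<open>x\<close> can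
  be cancelled on the right, which leaves 1 = d x.\<close>

lemma left_inverse_of_lann_zero:
  assumes "left_artinian R" "x \<in> carrier R" "lann R {x} = {\<zero>}"
  obtains d where "d \<in> carrier R" "d \<otimes> x = \<one>"
proof -
  let ?I = "\<lambda>k. lprin R (x [^] (k::nat))"
  have "?I (Suc k) \<subseteq> ?I k" for k
  proof (rule lprin_least)
    show "x [^] Suc k \<in> lprin R (x [^] k)"
      unfolding lprin_def nat_pow_Suc2[OF assms(2)] using assms(2) by blast
  qed (use assms(2) in simp)
  moreover have "left_ideal (?I k) R" for k using assms(2) by simp
  ultimately obtain m where "\<forall>k\<ge>m. ?I k = ?I m"
    using assms(1)[unfolded left_artinian_def, rule_format, of ?I] by blast
  then have "?I (Suc m) = ?I m" by (meson le_SucI le_refl)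
  then have "x [^] m \<in> ?I (Suc m)" using lprin_self[of "x [^] m"] assms(2) by simp
  then obtain d where d: "d \<in> carrier R" "x [^] m = d \<otimes> (x [^] Suc m)"
    by (auto simp: lprin_def)
  have inj: "y = \<zero>" if "y \<in> carrier R" "y \<otimes> x [^] k = \<zero>" for y and k :: nat
    using that
  proof (induction k)
    case (Suc k)
    have "y \<otimes> x [^] k \<in> lann R {x}" using Suc.prems assms(2) by (simp add: lann_def m_assoc)
    then have "y \<otimes> x [^] k = \<zero>" using assms(3) by auto
    then show ?case using Suc by simp
  qed auto
  have "(\<one> \<ominus> d \<otimes> x) \<otimes> x [^] m = x [^] m \<ominus> d \<otimes> (x [^] Suc m)"
    using assms(2) d(1)
    by (simp add: minus_eq l_distr l_minus m_assoc nat_pow_Suc2[symmetric] del: nat_pow_Suc)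
  also have "\<dots> = \<zero>" using d assms(2) by (metis nat_pow_closed r_right_minus_eq)
  finally have "\<one> \<ominus> d \<otimes> x = \<zero>" using inj d(1) assms(2) by simp
  then have "d \<otimes> x = \<one>" using d(1) assms(2) by simp
  then show thesis using that d(1) by blast
qed

lemma maximal_left_ideal_exists:
  assumes "left_ideal I R" "\<one> \<notin> I"
  obtains M where "maximal_left_ideal M R" "I \<subseteq> M"
proof -
  let ?A = "{J. left_ideal J R \<and> I \<subseteq> J \<and> \<one> \<notin> J}"
  have "\<exists>M\<in>?A. \<forall>U\<in>?A. M \<subseteq> U \<longrightarrow> U = M"
  proof (rule subset_Zorn_nonempty)
    show "?A \<noteq> {}" using assms by auto
    fix C assume C: "C \<noteq> {}" "subset.chain ?A C"
    have sub: "C \<subseteq> ?A" and lin: "\<And>U Y. U \<in> C \<Longrightarrow> Y \<in> C \<Longrightarrow> U \<subseteq> Y \<or> Y \<subseteq> U"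
      using C(2) by (auto simp: subset_chain_def)
    have "left_ideal (\<Union>C) R"
    proof (rule left_idealI)
      show "\<Union>C \<subseteq> carrier R" using sub left_idealD(1) by blast
      show "\<zero> \<in> \<Union>C" using sub C(1) left_idealD(3) by blast
      show "x \<oplus> y \<in> \<Union>C" if xy: "x \<in> \<Union>C" "y \<in> \<Union>C" for x y
      proof -
        obtain U Y where "U \<in> C" "Y \<in> C" "x \<in> U" "y \<in> Y" using xy by blast
        moreover then obtain Z where "Z \<in> C" "x \<in> Z" "y \<in> Z" using lin[of U Y] by blast
        ultimately show ?thesis using sub left_idealD(4)[of Z x y] by blast
      qed
      show "a \<otimes> x \<in> \<Union>C" if "a \<in> carrier R" "x \<in> \<Union>C" for a x
        using that sub left_idealD(5) by blast
    qed
    then show "\<Union>C \<in> ?A" using sub C(1) by blast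
  qed
  then obtain M where M: "M \<in> ?A" "\<forall>U\<in>?A. M \<subseteq> U \<longrightarrow> U = M" by (rule bexE)
  have "maximal_left_ideal M R"
    unfolding maximal_left_ideal_def
  proof (intro conjI allI impI)
    show "left_ideal M R" "M \<noteq> carrier R" using M(1) by auto
    fix K assume K: "left_ideal K R \<and> M \<subseteq> K"
    show "K = M \<or> K = carrier R"
    proof (cases "\<one> \<in> K")
      case True
      then show ?thesis using K left_ideal_eq_carrier by blast
    next
      case False
      then have "K \<in> ?A" using K M(1) by auto
      then show ?thesis using M(2) K by auto
    qed
  qed
  then show thesis using that M(1) by blast
qed

lemma maximal_left_idealD:
  assumes "maximal_left_ideal M R"
  shows "left_ideal M R" "\<one> \<notin> M"
    "x \<in> carrier R \<Longrightarrow> x \<notin> M \<Longrightarrow> \<exists>a\<in>carrier R. \<exists>m\<in>M. \<one> = a \<otimes> x \<oplus> m"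
proof -
  show M: "left_ideal M R" and "\<one> \<notin> M"
    using assms left_ideal_eq_carrier by (auto simp: maximal_left_ideal_def)
  assume x: "x \<in> carrier R" "x \<notin> M"
  have L: "left_ideal (lprin R x <+>\<^bsub>R\<^esub> M) R" using M x by (intro left_ideal_sum) auto
  have "M \<subseteq> lprin R x <+>\<^bsub>R\<^esub> M" "x \<in> lprin R x <+>\<^bsub>R\<^esub> M"
    using set_add_upper[of "lprin R x" M] M x lprin_self by auto
  then have "lprin R x <+>\<^bsub>R\<^esub> M = carrier R"
    using assms L x unfolding maximal_left_ideal_def by blast
  then have "\<one> \<in> lprin R x <+>\<^bsub>R\<^esub> M" by simp
  then show "\<exists>a\<in>carrier R. \<exists>m\<in>M. \<one> = a \<otimes> x \<oplus> m" by (auto simp: set_add_mem lprin_def)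
qed

section \<open>The Jacobson radical\<close>

abbreviation "J \<equiv> jacobson_radical R"

lemma jac_subset: "J \<subseteq> carrier R"
  by (auto simp: jacobson_radical_def)

lemma left_ideal_jac [simp]: "left_ideal J R"
  by (rule left_idealI)
     (auto simp: jacobson_radical_def dest: maximal_left_idealD(1) intro: left_idealD)

text \<open>If \<open>x \<otimes> a\<close> avoided a maximal left ideal \<open>M\<close>, then the
  left ideal of all \<open>r\<close> with \<open>r \<otimes> a \<in> M\<close> would again be
  maximal, since \<open>a\<close> generates the simple module R/M. As \<open>x\<close> lies in every
  maximal left ideal, it lies in this one.\<close>

lemma jac_right_closed:
  assumes "x \<in> J" "a \<in> carrier R"
  shows "x \<otimes> a \<in> J"
proof -
  have x: "x \<in> carrier R" using assms jac_subset by auto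
  have "x \<otimes> a \<in> M" if M: "maximal_left_ideal M R" for M
  proof (rule ccontr)
    assume nin: "x \<otimes> a \<notin> M"
    note lM = maximal_left_idealD(1)[OF M]
    let ?M = "{r \<in> carrier R. r \<otimes> a \<in> M}"
    have a: "a \<notin> M" using nin left_idealD(5)[OF lM] x by auto
    have "maximal_left_ideal ?M R"
      unfolding maximal_left_ideal_def
    proof (intro conjI allI impI)
      show L: "left_ideal ?M R" using left_ideal_colon lM assms(2) by blast
      have "\<one> \<notin> ?M" using a assms(2) by simp
      then show "?M \<noteq> carrier R" using one_closed by blast
      fix K assume K: "left_ideal K R \<and> ?M \<subseteq> K"
      show "K = ?M \<or> K = carrier R"
      proof (cases "K = ?M")
        case False
        then obtain r where r: "r \<in> K" "r \<notin> ?M" using K by blast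
        then have rc: "r \<in> carrier R" using K left_idealD by blast
        then have "r \<otimes> a \<notin> M" using r by simp
        then obtain b m where b: "b \<in> carrier R" "m \<in> M" "\<one> = b \<otimes> (r \<otimes> a) \<oplus> m"
          using maximal_left_idealD(3)[OF M, of "r \<otimes> a"] rc assms(2) by auto
        have mc: "m \<in> carrier R" using b lM left_idealD by blast
        have "a \<otimes> (b \<otimes> (r \<otimes> a)) \<oplus> a \<otimes> m = a"
          using b mc rc assms(2) by (metis m_closed r_distr r_one)
        moreover have "(\<one> \<ominus> a \<otimes> b \<otimes> r) \<otimes> a = a \<ominus> a \<otimes> (b \<otimes> (r \<otimes> a))"
          using b(1) rc assms(2) by (simp add: minus_eq l_distr l_minus m_assoc)
        ultimately have "(\<one> \<ominus> a \<otimes> b \<otimes> r) \<otimes> a = a \<otimes> m"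
          using add_minus_cancel_left[of "a \<otimes> (b \<otimes> (r \<otimes> a))" "a \<otimes> m"] b(1) mc rc assms(2) by simp
        moreover have "a \<otimes> m \<in> M" using b lM assms(2) left_idealD(5) by blast
        ultimately have "\<one> \<ominus> a \<otimes> b \<otimes> r \<in> K" using K b(1) rc assms(2) by auto
        moreover have "a \<otimes> b \<otimes> r \<in> K" using K r b(1) assms(2) left_idealD(5) by auto
        ultimately have "(\<one> \<ominus> a \<otimes> b \<otimes> r) \<oplus> a \<otimes> b \<otimes> r \<in> K" using K left_idealD(4) by blast
        then have "\<one> \<in> K" using minus_add_cancel[of \<one> "a \<otimes> b \<otimes> r"] b(1) rc assms(2) by simp
        then show ?thesis using K left_ideal_eq_carrier by blast
      qed auto
    qed
    then have "x \<in> ?M" using assms(1) unfolding jacobson_radical_def by blast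
    then show False using nin by simp
  qed
  then show ?thesis using x assms(2) by (auto simp: jacobson_radical_def)
qed

lemma right_ideal_jac [simp]: "right_ideal J R"
  using left_idealD[OF left_ideal_jac] jac_right_closed by (intro right_idealI) auto

lemma jac_left_inverse:
  assumes "x \<in> J"
  obtains d where "d \<in> carrier R" "d \<otimes> (\<one> \<ominus> x) = \<one>"
proof -
  have x: "x \<in> carrier R" using assms jac_subset by auto
  have "\<one> \<in> lprin R (\<one> \<ominus> x)"
  proof (rule ccontr)
    assume "\<one> \<notin> lprin R (\<one> \<ominus> x)"
    then obtain M where M: "maximal_left_ideal M R" "lprin R (\<one> \<ominus> x) \<subseteq> M"
      using maximal_left_ideal_exists[of "lprin R (\<one> \<ominus> x)"] x by auto
    have "\<one> \<ominus> x \<in> M" using M(2) lprin_self x by auto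
    moreover have "x \<in> M" using assms M(1) by (auto simp: jacobson_radical_def)
    ultimately have "(\<one> \<ominus> x) \<oplus> x \<in> M" using maximal_left_idealD(1)[OF M(1)] left_idealD(4) by blast
    then show False using maximal_left_idealD(2)[OF M(1)] x by (simp add: minus_eq a_assoc l_neg)
  qed
  then show thesis using that by (auto simp: lprin_def)
qed

text \<open>The left inverse \<open>d\<close> of \<open>\<one> \<ominus> x\<close> is itself
  \<open>\<one>\<close> minus a radical element, so it has a left inverse too, and that one must be
  \<open>\<one> \<ominus> x\<close>.\<close>

lemma jac_unit:
  assumes "x \<in> J"
  shows "\<one> \<ominus> x \<in> Units R"
proof -
  have x: "x \<in> carrier R" using assms jac_subset by auto
  obtain d where d: "d \<in> carrier R" "d \<otimes> (\<one> \<ominus> x) = \<one>" using jac_left_inverse[OF assms] .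
  have "\<ominus> (d \<otimes> x) \<in> J"
    by (intro left_idealD(6)[OF left_ideal_jac] left_idealD(5)[OF left_ideal_jac] d(1) assms)
  then obtain e where e: "e \<in> carrier R" "e \<otimes> (\<one> \<ominus> (\<ominus> (d \<otimes> x))) = \<one>" using jac_left_inverse by blast
  have "d = \<one> \<ominus> (\<ominus> (d \<otimes> x))"
    using d x by (metis (no_types, lifting) a_minus_def l_one m_closed minus_equality minus_minus
        one_closed r_distr r_minus r_one a_inv_closed add.m_comm r_neg2 minus_eq add.inv_solve_right add.m_closed)
  then have ed: "e \<otimes> d = \<one>" using e by simp
  have "e = e \<otimes> (d \<otimes> (\<one> \<ominus> x))" using d e by simp
  also have "\<dots> = e \<otimes> d \<otimes> (\<one> \<ominus> x)" using d(1) e(1) x by (simp add: m_assoc)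
  also have "\<dots> = \<one> \<ominus> x" using ed x by simp
  finally have "(\<one> \<ominus> x) \<otimes> d = \<one>" using ed by simp
  then show ?thesis using d x unfolding Units_def by auto
qed

end

lemma (in ring_hom_ring) left_ideal_vimage:
  assumes "left_ideal L S"
  shows "left_ideal {r \<in> carrier R. h r \<in> L} R"
  using S.left_idealD[OF assms] by (intro R.left_idealI) auto

section \<open>Left-right symmetry of the radical, and complements modulo it\<close>

context ring
begin

lemma r_minus_distr: "\<lbrakk>x \<in> carrier R; y \<in> carrier R; z \<in> carrier R\<rbrakk> \<Longrightarrow> x \<otimes> (y \<ominus> z) = x \<otimes> y \<ominus> x \<otimes> z"
  and l_minus_distr: "\<lbrakk>x \<in> carrier R; y \<in> carrier R; z \<in> carrier R\<rbrakk> \<Longrightarrow> (y \<ominus> z) \<otimes> x = y \<otimes> x \<ominus> z \<otimes> x"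
  by (simp_all add: minus_eq r_distr l_distr r_minus l_minus)

text \<open>A maximal right ideal that misses \<open>x\<close> contains some
  \<open>\<one> \<ominus> x \<otimes> a\<close>, which is a unit because
  \<open>x \<otimes> a\<close> is again in the radical.\<close>

lemma jac_subset_jac_opp: "J \<subseteq> jacobson_radical (opp R)"
proof
  fix x assume x: "x \<in> J"
  then have xc: "x \<in> carrier R" using jac_subset by auto
  have "x \<in> M" if M: "maximal_left_ideal M (opp R)" for M
  proof (rule ccontr)
    assume "x \<notin> M"
    note Mid = ring.maximal_left_idealD[OF ring_opp M, simplified]
    obtain a m where am: "a \<in> carrier R" "m \<in> M" "\<one> = x \<otimes> a \<oplus> m"
      using Mid(3)[of x] xc \<open>x \<notin> M\<close> by auto
    have mc: "m \<in> carrier R" using am right_idealD(2)[OF Mid(1)] by blast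
    have "x \<otimes> a \<in> J" using x am(1) by (rule jac_right_closed)
    then have "\<one> \<ominus> x \<otimes> a \<in> Units R" by (rule jac_unit)
    moreover have "\<one> \<ominus> x \<otimes> a = m"
      using add_minus_cancel_left[of "x \<otimes> a" m] am xc mc by simp
    ultimately obtain d where "d \<in> carrier R" "m \<otimes> d = \<one>" by (auto simp: Units_def)
    then have "\<one> \<in> M" using right_idealD(5)[OF Mid(1)] am(2) by metis
    then show False using Mid(2) by simp
  qed
  then show "x \<in> jacobson_radical (opp R)" using xc by (simp add: jacobson_radical_def)
qed

lemma jac_opp [simp]: "jacobson_radical (opp R) = J"
  using jac_subset_jac_opp ring.jac_subset_jac_opp[OF ring_opp] by auto

text \<open>A left ideal containing \<open>J\<close> is a direct summand modulo \<open>J\<close>: the complement is a minimal left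
  ideal among those that contain \<open>J\<close> and span \<open>R\<close> together with it.\<close>

lemma complement_mod_jac:
  assumes "left_artinian R" "left_ideal L R" "J \<subseteq> L"
  obtains l k where "l \<in> L" "k \<in> carrier R" "\<one> = l \<oplus> k" "\<And>x. x \<in> L \<Longrightarrow> x \<otimes> k \<in> J"
    "\<And>r. r \<in> carrier R \<Longrightarrow> r \<otimes> k \<in> L \<Longrightarrow> r \<otimes> k \<in> J"
proof -
  let ?D = "{K. left_ideal K R \<and> J \<subseteq> K \<and> \<one> \<in> L <+>\<^bsub>R\<^esub> K}"
  note L = left_idealD[OF assms(2)]
  have "\<one> \<in> L <+>\<^bsub>R\<^esub> carrier R" using set_add_upper(2)[OF assms(2) left_ideal_carrier] by auto
  then have "carrier R \<in> ?D" using jac_subset by auto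
  then obtain K where K: "K \<in> ?D" and min: "\<And>K'. K' \<in> ?D \<Longrightarrow> K' \<subseteq> K \<Longrightarrow> K' = K"
    using left_artinian_minimal[OF assms(1), of ?D] by blast
  then have Kl: "left_ideal K R" by simp
  note Kd = left_idealD[OF Kl]
  \<comment> \<open>If some \<open>x\<close> in both ideals missed a maximal left ideal
    \<open>M\<close>, then \<open>K \<inter> M\<close> would still span the ring together with
    \<open>L\<close>: the missing multiples of \<open>x\<close> are supplied by \<open>L\<close>.
    This contradicts the minimality of \<open>K\<close>.\<close>
  have LK: "x \<in> J" if x: "x \<in> L" "x \<in> K" for x
  proof (rule ccontr)
    assume "x \<notin> J"
    then obtain M where M: "maximal_left_ideal M R" "x \<notin> M"
      using x L(2) by (auto simp: jacobson_radical_def)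
    note Ml = maximal_left_idealD[OF M(1)] and Md = left_idealD[OF maximal_left_idealD(1)[OF M(1)]]
    obtain a m where am: "a \<in> carrier R" "m \<in> M" "\<one> = a \<otimes> x \<oplus> m"
      using Ml(3)[of x] M(2) x L(2) by auto
    obtain l k where lk: "l \<in> L" "k \<in> K" "\<one> = l \<oplus> k" using K by (auto simp: set_add_mem)
    have c: "x \<in> carrier R" "l \<in> carrier R" "k \<in> carrier R" "m \<in> carrier R"
      using x lk am L(2) Kd(2) Md(2) by auto
    have k: "k = k \<otimes> a \<otimes> x \<oplus> k \<otimes> m"
      using am(1,3) c by (metis m_assoc m_closed r_distr r_one)
    have kax: "k \<otimes> a \<otimes> x \<in> L" "k \<otimes> a \<otimes> x \<in> K" using L(5) Kd(5) x c am by auto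
    have km: "k \<otimes> m = k \<ominus> k \<otimes> a \<otimes> x" using k c am add_minus_cancel_left by (metis m_closed)
    have "k \<otimes> m \<in> K" unfolding km using lk kax Kd(7) by auto
    moreover have "k \<otimes> m \<in> M" using Md(5) am c by auto
    moreover have "\<one> = (l \<oplus> k \<otimes> a \<otimes> x) \<oplus> k \<otimes> m"
      using lk(3) k c am(1) by (metis a_assoc m_closed)
    moreover have "l \<oplus> k \<otimes> a \<otimes> x \<in> L" using L(4) lk kax by auto
    ultimately have "\<one> \<in> L <+>\<^bsub>R\<^esub> (K \<inter> M)" by (auto simp: set_add_mem)
    moreover have "J \<subseteq> M" using M(1) by (auto simp: jacobson_radical_def)
    ultimately have "K \<inter> M \<in> ?D" using K Ml(1) left_ideal_Int by auto
    then have "K \<inter> M = K" using min by blast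
    then show False using x M(2) by auto
  qed
  obtain l k where lk: "l \<in> L" "k \<in> K" "\<one> = l \<oplus> k" using K by (auto simp: set_add_mem)
  have c: "l \<in> carrier R" "k \<in> carrier R" using lk L(2) Kd(2) by auto
  have "x \<otimes> k \<in> J" if x: "x \<in> L" for x
  proof (rule LK)
    have xc: "x \<in> carrier R" using x L(2) by auto
    show "x \<otimes> k \<in> K" using Kd(5) lk xc by auto
    have "x = x \<otimes> l \<oplus> x \<otimes> k" using lk(3) xc c by (metis r_distr r_one)
    then have "x \<otimes> k = x \<ominus> x \<otimes> l" using add_minus_cancel_left c xc by (metis m_closed)
    then show "x \<otimes> k \<in> L" using L(5,7) x lk xc by auto
  qed
  moreover have "r \<otimes> k \<in> J" if "r \<in> carrier R" "r \<otimes> k \<in> L" for r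
    using that LK Kd(5) lk by auto
  ultimately show thesis using that lk c by blast
qed

end

section \<open>Units in cosets of right ideals\<close>

text \<open>Semisimplicity is expressed by right identities: such an \<open>e\<close> is idempotent
  and generates \<open>L\<close>, so that \<open>L\<close> is a direct summand. This is the form in
  which complements modulo the radical descend to \<open>R/J\<close>.\<close>

locale semisimple_ring = ring +
  assumes artinian: "left_artinian R"
    and idempotent_generator: "left_ideal L R \<Longrightarrow> \<exists>e\<in>L. \<forall>x\<in>L. x \<otimes> e = x"
begin

text \<open>Von Neumann regularity: y = y b y for some \<open>b\<close>, so
  \<open>\<one> \<ominus> y \<otimes> b\<close> annihilates \<open>y\<close>, hence also
  \<open>z\<close>, which gives z = y (b z).\<close>

lemma rprin_of_lann_subset:
  assumes "y \<in> carrier R" "z \<in> carrier R" "lann R {y} \<subseteq> lann R {z}"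
  shows "z \<in> rprin R y"
proof -
  obtain e where e: "e \<in> lprin R y" "\<forall>x\<in>lprin R y. x \<otimes> e = x"
    using idempotent_generator[of "lprin R y"] assms(1) by auto
  then obtain b where b: "b \<in> carrier R" "e = b \<otimes> y" by (auto simp: lprin_def)
  have "y \<otimes> e = y" using e lprin_self assms(1) by auto
  then have "(\<one> \<ominus> y \<otimes> b) \<otimes> y = \<zero>" using b assms by (simp add: l_minus_distr m_assoc)
  then have "\<one> \<ominus> y \<otimes> b \<in> lann R {y}" using assms(1) b(1) by (simp add: lann_def)
  then have "\<one> \<ominus> y \<otimes> b \<in> lann R {z}" using assms(3) by blast
  then have "z = y \<otimes> (b \<otimes> z)" using assms b by (simp add: lann_def l_minus_distr m_assoc)
  then show ?thesis using b assms by (auto simp: rprin_def)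
qed

text \<open>If every product \<open>g t\<close> with \<open>g u = 0\<close> were a left multiple of \<open>u\<close>, then \<open>u\<close> would act on a ring
  direct factor surjectively but not injectively.\<close>

lemma lann_mult_escape:
  assumes u: "u \<in> carrier R" and nz: "lann R {u} \<noteq> {\<zero>}"
  shows "\<exists>g\<in>lann R {u}. \<exists>t\<in>carrier R. g \<otimes> t \<notin> lprin R u"
proof (rule ccontr)
  assume neg: "\<not> ?thesis"
  note U = left_idealD[OF left_ideal_lprin[OF u]]
  \<comment> \<open>The largest two-sided ideal inside the left ideal generated by \<open>u\<close>.
    The negated claim says that it contains the left annihilator of \<open>u\<close>.\<close>
  define P where "P = {p \<in> carrier R. \<forall>t\<in>carrier R. p \<otimes> t \<in> lprin R u}"
  have P: "left_ideal P R"
    using U by (intro left_idealI) (auto simp: P_def l_distr m_assoc)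
  note Pd = left_idealD[OF P]
  have Pr: "p \<otimes> t \<in> P" if "p \<in> P" "t \<in> carrier R" for p t
    using that by (auto simp: P_def m_assoc)
  have PU: "p \<in> lprin R u" if "p \<in> P" for p
  proof -
    have "p \<otimes> \<one> \<in> lprin R u" "p \<in> carrier R" using that unfolding P_def by blast+
    then show ?thesis by simp
  qed
  obtain e where e: "e \<in> P" "\<And>p. p \<in> P \<Longrightarrow> p \<otimes> e = p" using idempotent_generator[OF P] by auto
  have ec: "e \<in> carrier R" using e Pd(2) by auto
  \<comment> \<open>The right identity of \<open>P\<close> is also a left identity, so
    \<open>P\<close> is a ring direct factor: the defect \<open>q\<close> is killed by
    \<open>P\<close> from the left, while q = q r q with \<open>q \<otimes> r\<close> in
    \<open>P\<close>.\<close>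
  have el: "e \<otimes> p = p" if p: "p \<in> P" for p
  proof -
    have pc: "p \<in> carrier R" using p Pd(2) by auto
    define q where "q = p \<ominus> e \<otimes> p"
    have q: "q \<in> P" using p e Pr pc Pd(7) unfolding q_def by auto
    have qc: "q \<in> carrier R" using q Pd(2) by auto
    have Pq: "p' \<otimes> q = \<zero>" if "p' \<in> P" for p'
    proof -
      have "p' \<in> carrier R" using that Pd(2) by auto
      then show ?thesis using e(2)[OF that] ec pc unfolding q_def
        by (simp add: r_minus_distr m_assoc[symmetric])
    qed
    obtain f where f: "f \<in> lprin R q" "\<forall>x\<in>lprin R q. x \<otimes> f = x"
      using idempotent_generator[of "lprin R q"] qc by auto
    then obtain r where r: "r \<in> carrier R" "f = r \<otimes> q" by (auto simp: lprin_def)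
    have "q = (q \<otimes> r) \<otimes> q" using f lprin_self qc r by (metis m_assoc)
    also have "\<dots> = \<zero>" using Pq Pr q r by auto
    finally show ?thesis using ec pc unfolding q_def by simp
  qed
  obtain r where r: "r \<in> carrier R" "e = r \<otimes> u" using PU[OF e(1)] by (auto simp: lprin_def)
  define v where "v = e \<otimes> r"
  have v: "v \<in> P" "v \<in> carrier R" using Pr e r Pd(2) unfolding v_def by auto
  have "v \<otimes> u = e \<otimes> (r \<otimes> u)" using r(1) ec u unfolding v_def by (simp add: m_assoc)
  then have vu: "v \<otimes> u = e" using r(2)[symmetric] e by simp
  \<comment> \<open>\<open>u'\<close> acts like \<open>u\<close> on the factor \<open>P\<close> and
    as the identity on the other factor, and \<open>w\<close> is its left inverse. In an Artinian
    ring \<open>w\<close> is then a two-sided inverse, yet \<open>u'\<close> is still annihilated by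
    the element \<open>g\<close> below.\<close>
  define e' where "e' = \<one> \<ominus> e"
  define w where "w = v \<oplus> e'"
  define u' where "u' = u \<otimes> e \<oplus> e'"
  have c: "e' \<in> carrier R" "w \<in> carrier R" "u' \<in> carrier R"
    using ec v u by (auto simp: e'_def w_def u'_def)
  have ue: "u \<otimes> e \<in> P" using Pd(5) e u by auto
  have ee: "e \<otimes> e = e" using e by auto
  have "e' \<otimes> (u \<otimes> e) = \<zero>"
    using el[OF ue] ec u unfolding e'_def by (simp add: l_minus_distr)
  moreover have "v \<otimes> e' = \<zero>" using e(2)[OF v(1)] ec v unfolding e'_def by (simp add: r_minus_distr)
  moreover have "e' \<otimes> e' = e'" using ee ec unfolding e'_def
    by (simp add: r_minus_distr l_minus_distr) (simp add: minus_eq r_neg)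
  moreover have "v \<otimes> (u \<otimes> e) = e" using vu ee v u ec by (simp add: m_assoc[symmetric])
  ultimately have "w \<otimes> u' = e \<oplus> e'"
    using c v u ec unfolding w_def u'_def by (simp add: l_distr r_distr)
  also have "\<dots> = \<one>" using minus_add_cancel[of \<one> e] ec c a_comm by (simp add: e'_def)
  finally have wu: "w \<otimes> u' = \<one>" .
  have "lann R {w} = {\<zero>}"
  proof -
    have "y = \<zero>" if "y \<in> carrier R" "y \<otimes> w = \<zero>" for y
      using that wu c by (metis l_null m_assoc r_one)
    then show ?thesis using c by (auto simp: lann_def)
  qed
  then obtain d where d: "d \<in> carrier R" "d \<otimes> w = \<one>"
    using left_inverse_of_lann_zero[OF artinian c(2)] by blast
  have "d = u'" using d wu c by (metis l_one m_assoc r_one)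
  then have uw: "u' \<otimes> w = \<one>" using d by simp
  obtain g where g: "g \<in> carrier R" "g \<otimes> u = \<zero>" "g \<noteq> \<zero>"
    using nz u by (auto simp: lann_def)
  have "g \<in> P" using neg g unfolding P_def lann_def by auto
  then have ge: "g \<otimes> e = g" using e by simp
  have "g \<otimes> u' = (g \<otimes> u) \<otimes> e \<oplus> (g \<ominus> g \<otimes> e)"
    using g(1) u ec unfolding u'_def e'_def by (simp add: r_distr r_minus_distr m_assoc)
  also have "\<dots> = \<zero>" using g ge ec by simp
  finally have "g = \<zero>" using uw g c by (metis l_null m_assoc r_one)
  then show False using g by simp
qed

text \<open>This is the stable range one condition. Among all elements of the coset take one whose
  left annihilator is minimal; if it were not zero, \<open>lann_mult_escape\<close> would supply a
  correction from \<open>B\<close> that shrinks it further. An element with zero left annihilator is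
  a unit.\<close>

lemma unit_in_coset:
  assumes a: "a \<in> carrier R" and B: "right_ideal B R" and v: "v \<in> carrier R" and b: "b \<in> B"
    and one: "a \<otimes> v \<oplus> b = \<one>"
  obtains c where "c \<in> B" "a \<oplus> c \<in> Units R"
proof -
  note Bd = right_idealD[OF B]
  let ?D = "(\<lambda>c. lann R {a \<oplus> c}) ` B"
  have "?D \<noteq> {}" using b by auto
  moreover have "\<And>I. I \<in> ?D \<Longrightarrow> left_ideal I R" using a Bd(2) by auto
  ultimately obtain I where "I \<in> ?D" "\<And>J. J \<in> ?D \<Longrightarrow> J \<subseteq> I \<Longrightarrow> J = I"
    using left_artinian_minimal[OF artinian, of ?D] by metis
  then obtain c where c: "c \<in> B"
    and min: "\<And>c'. c' \<in> B \<Longrightarrow> lann R {a \<oplus> c'} \<subseteq> lann R {a \<oplus> c} \<Longrightarrow> lann R {a \<oplus> c'} = lann R {a \<oplus> c}"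
    by (auto simp: image_iff)
  define u where "u = a \<oplus> c"
  have cc: "c \<in> carrier R" "b \<in> carrier R" using c b Bd(2) by auto
  have u: "u \<in> carrier R" using a cc by (simp add: u_def)
  define b0 where "b0 = b \<ominus> c \<otimes> v"
  have b0: "b0 \<in> B" using Bd(5,7) b c v by (auto simp: b0_def)
  then have b0c: "b0 \<in> carrier R" using Bd(2) by auto
  have "u \<otimes> v \<oplus> b0 = (a \<otimes> v \<oplus> b) \<oplus> (c \<otimes> v \<ominus> c \<otimes> v)"
    using a cc v unfolding u_def b0_def by (simp add: l_distr minus_eq a_ac)
  then have one': "u \<otimes> v \<oplus> b0 = \<one>" using one a cc v by simp
  have "lann R {u} = {\<zero>}"
  proof (rule ccontr)
    assume "lann R {u} \<noteq> {\<zero>}"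
    then obtain g t where g: "g \<in> lann R {u}" and t: "t \<in> carrier R" and gt: "g \<otimes> t \<notin> lprin R u"
      using lann_mult_escape[OF u] by blast
    have gc: "g \<in> carrier R" using g by (simp add: lann_def)
    obtain e where e: "e \<in> lprin R u" "\<And>x. x \<in> lprin R u \<Longrightarrow> x \<otimes> e = x"
      using idempotent_generator[OF left_ideal_lprin[OF u]] by auto
    have ec: "e \<in> carrier R" using e left_idealD(2)[OF left_ideal_lprin[OF u]] by blast
    have ue: "u \<otimes> e = u" and ee: "e \<otimes> e = e" using e lprin_self[OF u] by auto
    define e' where "e' = \<one> \<ominus> e"
    have e'c: "e' \<in> carrier R" using ec by (simp add: e'_def)
    have e'e: "e' \<otimes> e = \<zero>" using ec ee by (simp add: e'_def l_minus_distr)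
    \<comment> \<open>The factor \<open>e'\<close> makes the correction vanish under right
      multiplication by \<open>e\<close>, so whatever kills the new element also kills
      \<open>u\<close>. Such an \<open>r\<close> satisfies r b0 = r, whence r t e' = 0; for
      \<open>g\<close> this fails, because \<open>g \<otimes> t\<close> is not a multiple of
      \<open>u\<close>.\<close>
    define c' where "c' = c \<oplus> b0 \<otimes> t \<otimes> e'"
    have c': "c' \<in> B" using Bd(4,5) c b0 t e'c by (simp add: c'_def)
    have u': "a \<oplus> c' = u \<oplus> b0 \<otimes> t \<otimes> e'" using a cc b0c t e'c by (simp add: u_def c'_def a_assoc)
    have u'e: "(a \<oplus> c') \<otimes> e = u"
      unfolding u' using u b0c t e'c ec ue e'e by (simp add: l_distr m_assoc)
    have a'c: "a \<oplus> c' \<in> carrier R" unfolding u' using u b0c t e'c by simp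
    have sub: "r \<otimes> u = \<zero> \<and> r \<otimes> t \<otimes> e' = \<zero>" if r: "r \<in> lann R {a \<oplus> c'}" for r
    proof
      have rc: "r \<in> carrier R" and r0: "r \<otimes> (a \<oplus> c') = \<zero>" using r by (auto simp: lann_def)
      show ru: "r \<otimes> u = \<zero>" using r0 rc a'c ec u'e by (metis l_null m_assoc)
      have rb: "r \<otimes> b0 = r"
      proof -
        have "r = r \<otimes> u \<otimes> v \<oplus> r \<otimes> b0" using one' rc u v b0c by (metis m_assoc m_closed r_distr r_one)
        then show ?thesis using ru rc v b0c by simp
      qed
      have "\<zero> = r \<otimes> u \<oplus> r \<otimes> b0 \<otimes> t \<otimes> e'"
        using r0 u' rc u b0c t e'c by (simp add: r_distr m_assoc)
      then show "r \<otimes> t \<otimes> e' = \<zero>" using ru rb rc t e'c by simp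
    qed
    then have "lann R {a \<oplus> c'} \<subseteq> lann R {a \<oplus> c}" using u_def by (auto simp: lann_def)
    then have "g \<in> lann R {a \<oplus> c'}" using min[OF c'] g u_def by simp
    then have "g \<otimes> t \<otimes> e' = \<zero>" using sub by blast
    then have "g \<otimes> t = g \<otimes> t \<otimes> e" using gc t ec unfolding e'_def by (simp add: r_minus_distr)
    then have "g \<otimes> t \<in> lprin R u"
      using left_idealD(5)[OF left_ideal_lprin[OF u] _ e(1), of "g \<otimes> t"] gc t by simp
    then show False using gt by simp
  qed
  then obtain d where d: "d \<in> carrier R" "d \<otimes> u = \<one>"
    using left_inverse_of_lann_zero[OF artinian u] by blast
  have "(u \<otimes> d \<ominus> \<one>) \<otimes> u = \<zero>" using d u by (simp add: l_minus_distr m_assoc)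
  then have "u \<otimes> d \<ominus> \<one> \<in> lann R {u}" using u d by (simp add: lann_def)
  then have "u \<otimes> d = \<one>" using \<open>lann R {u} = {\<zero>}\<close> u d by simp
  then show thesis using that[OF c] d u unfolding u_def Units_def by auto
qed

end

section \<open>Lifting from the semisimple quotient \<open>R/J\<close>\<close>

context ring
begin

lemma ideal_jac: "ideal J R"
proof (rule idealI[OF ring_axioms])
  show "subgroup J (add_monoid R)"
    using left_idealD[OF left_ideal_jac] by (auto simp: subgroup_def a_inv_def[symmetric])
qed (auto intro: left_idealD(5)[OF left_ideal_jac] jac_right_closed)

lemma quot_hom: "ring_hom_ring R (R Quot J) ((+>) J)"
  by (rule ideal.rcos_ring_hom_ring[OF ideal_jac])

lemma quot_carrier: "carrier (R Quot J) = (+>) J ` carrier R"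
  by (auto simp: FactRing_def A_RCOSETS_def')

lemma quot_eq_iff:
  "x \<in> carrier R \<Longrightarrow> y \<in> carrier R \<Longrightarrow> J +> x = J +> y \<longleftrightarrow> x \<ominus> y \<in> J"
  using quotient_eq_iff_same_a_r_cos[OF ideal_jac] by simp

lemma quot_zero_iff: "x \<in> carrier R \<Longrightarrow> J +> x = \<zero>\<^bsub>R Quot J\<^esub> \<longleftrightarrow> x \<in> J"
  using quot_eq_iff[of x \<zero>] ring_hom_ring.homh[OF quot_hom]
  by (simp add: minus_eq ring_hom_zero[OF _ ring_axioms ideal.quotient_is_ring[OF ideal_jac]])

text \<open>The preimage of a left ideal contains \<open>J\<close> and has a complement modulo
  \<open>J\<close>; in the resulting decomposition 1 = l + k the class of \<open>l\<close> is the
  required right identity.\<close>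

lemma semisimple_quot:
  assumes "left_artinian R"
  shows "semisimple_ring (R Quot J)"
proof -
  interpret h: ring_hom_ring R "R Quot J" "(+>) J" by (rule quot_hom)
  define V where "V = (\<lambda>L. {r \<in> carrier R. J +> r \<in> L})"
  have V: "left_ideal (V L) R" if "left_ideal L (R Quot J)" for L
    unfolding V_def by (rule h.left_ideal_vimage[OF that])
  have im: "(+>) J ` V L = L" if "left_ideal L (R Quot J)" for L
    using h.S.left_idealD(1)[OF that] unfolding V_def quot_carrier by auto
  show ?thesis
  proof (unfold_locales)
    show "left_artinian (R Quot J)"
      unfolding left_artinian_def
    proof (intro allI impI)
      fix I assume I: "\<forall>k. left_ideal (I k) (R Quot J) \<and> I (Suc k) \<subseteq> I k"
      then have "\<forall>k. left_ideal (V (I k)) R \<and> V (I (Suc k)) \<subseteq> V (I k)" using V by (auto simp: V_def)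
      then obtain m where "\<forall>k\<ge>m. V (I k) = V (I m)"
        using assms[unfolded left_artinian_def, rule_format, of "\<lambda>k. V (I k)"] by blast
      then have "\<forall>k\<ge>m. I k = I m" using im I by metis
      then show "\<exists>m. \<forall>k\<ge>m. I k = I m" by blast
    qed
    fix L assume L: "left_ideal L (R Quot J)"
    have "J \<subseteq> V L"
    proof
      fix x assume x: "x \<in> J"
      then have xc: "x \<in> carrier R" using jac_subset by auto
      then show "x \<in> V L" using x quot_zero_iff[OF xc] h.S.left_idealD(3)[OF L] by (simp add: V_def)
    qed
    then obtain l k where lk: "l \<in> V L" "k \<in> carrier R" "\<one> = l \<oplus> k" "\<And>x. x \<in> V L \<Longrightarrow> x \<otimes> k \<in> J"
      using complement_mod_jac[OF assms V[OF L]] by metis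
    have lc: "l \<in> carrier R" using lk(1) by (simp add: V_def)
    show "\<exists>e\<in>L. \<forall>x\<in>L. x \<otimes>\<^bsub>R Quot J\<^esub> e = x"
    proof (intro bexI[of _ "J +> l"] ballI)
      show "J +> l \<in> L" using lk(1) by (simp add: V_def)
      fix y assume y: "y \<in> L"
      then obtain x where x: "x \<in> carrier R" "y = J +> x" using h.S.left_idealD(1)[OF L] quot_carrier by auto
      then have xk: "x \<otimes> k \<in> J" using lk(4) y by (simp add: V_def)
      have "x = x \<otimes> l \<oplus> x \<otimes> k" using lk(2,3) lc x by (metis r_distr r_one)
      then have "x \<ominus> x \<otimes> l = x \<otimes> k" using add_minus_cancel_left[of "x \<otimes> l" "x \<otimes> k"] lk(2) lc x by simp
      then have "J +> x = J +> (x \<otimes> l)" using quot_eq_iff[of x "x \<otimes> l"] xk lc x by simp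
      then show "y \<otimes>\<^bsub>R Quot J\<^esub> (J +> l) = y" using x lc h.hom_mult by simp
    qed
  qed
qed

lemma Units_of_inverses:
  assumes "u \<in> carrier R" "a \<in> carrier R" "b \<in> carrier R" "a \<otimes> u = \<one>" "u \<otimes> b = \<one>"
  shows "u \<in> Units R"
proof -
  have "a = b" using assms by (metis l_one m_assoc r_one)
  then show ?thesis using assms by (auto simp: Units_def)
qed

text \<open>An inverse modulo \<open>J\<close> makes both products congruent to 1, hence units, and
  these yield a left and a right inverse.\<close>

lemma unit_lift:
  assumes u: "u \<in> carrier R" and "J +> u \<in> Units (R Quot J)"
  shows "u \<in> Units R"
proof -
  interpret h: ring_hom_ring R "R Quot J" "(+>) J" by (rule quot_hom)
  obtain v where v: "v \<in> carrier R" "J +> (v \<otimes> u) = J +> \<one>" "J +> (u \<otimes> v) = J +> \<one>"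
    using assms unfolding Units_def quot_carrier by auto
  have unit: "x \<in> Units R" if "x \<in> carrier R" "J +> x = J +> \<one>" for x
  proof -
    have "\<one> \<ominus> x \<in> J" using quot_eq_iff[of \<one> x] that by simp
    then have "\<one> \<ominus> (\<one> \<ominus> x) \<in> Units R" by (rule jac_unit)
    moreover have "\<one> \<ominus> (\<one> \<ominus> x) = x"
      using add_minus_cancel_left[of "\<one> \<ominus> x" x] minus_add_cancel[of \<one> x] that by simp
    ultimately show ?thesis by simp
  qed
  obtain a b where ab: "a \<in> carrier R" "a \<otimes> (v \<otimes> u) = \<one>" "b \<in> carrier R" "(u \<otimes> v) \<otimes> b = \<one>"
    using unit[of "v \<otimes> u"] unit[of "u \<otimes> v"] v u by (auto simp: Units_def)
  show ?thesis
    by (rule Units_of_inverses[of u "a \<otimes> v" "v \<otimes> b"]) (use u v ab in \<open>simp_all add: m_assoc\<close>)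
qed

text \<open>Units lift from \<open>R/J\<close>, so it is enough to correct the class of
  \<open>a\<close> by a class from \<open>B\<close>.\<close>

lemma unit_in_coset:
  assumes "left_artinian R" and a: "a \<in> carrier R" and B: "right_ideal B R" and v: "v \<in> carrier R"
    and b: "b \<in> B" and one: "a \<otimes> v \<oplus> b = \<one>"
  obtains c where "c \<in> B" "a \<oplus> c \<in> Units R"
proof -
  interpret h: ring_hom_ring R "R Quot J" "(+>) J" by (rule quot_hom)
  interpret Q: semisimple_ring "R Quot J" by (rule semisimple_quot[OF assms(1)])
  note Bd = right_idealD[OF B]
  have "right_ideal ((+>) J ` B) (R Quot J)"
  proof (rule h.S.right_idealI)
    show "(+>) J ` B \<subseteq> carrier (R Quot J)" using Bd(1) by (auto simp: quot_carrier)
    show "\<zero>\<^bsub>R Quot J\<^esub> \<in> (+>) J ` B" using Bd(3) h.hom_zero by (metis imageI)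
    show "x \<oplus>\<^bsub>R Quot J\<^esub> y \<in> (+>) J ` B" if "x \<in> (+>) J ` B" "y \<in> (+>) J ` B" for x y
    proof -
      obtain x' y' where "x' \<in> B" "x = J +> x'" "y' \<in> B" "y = J +> y'" using \<open>x \<in> _\<close> \<open>y \<in> _\<close> by auto
      then show ?thesis using h.hom_add[of x' y'] Bd(2,4) by (intro image_eqI[of _ _ "x' \<oplus> y'"]) auto
    qed
    show "x \<otimes>\<^bsub>R Quot J\<^esub> a \<in> (+>) J ` B" if "a \<in> carrier (R Quot J)" "x \<in> (+>) J ` B" for x a
    proof -
      obtain x' a' where "x' \<in> B" "x = J +> x'" "a' \<in> carrier R" "a = J +> a'"
        using \<open>x \<in> _\<close> \<open>a \<in> _\<close> unfolding quot_carrier by blast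
      then show ?thesis using h.hom_mult[of x' a'] Bd(2,5) by (intro image_eqI[of _ _ "x' \<otimes> a'"]) auto
    qed
  qed
  moreover have "(J +> a) \<otimes>\<^bsub>R Quot J\<^esub> (J +> v) \<oplus>\<^bsub>R Quot J\<^esub> (J +> b) = \<one>\<^bsub>R Quot J\<^esub>"
    using one a b Bd(2) v h.hom_mult h.hom_add h.hom_one by (metis m_closed)
  ultimately obtain C where "C \<in> (+>) J ` B" "(J +> a) \<oplus>\<^bsub>R Quot J\<^esub> C \<in> Units (R Quot J)"
    using Q.unit_in_coset[of "J +> a" "(+>) J ` B" "J +> v" "J +> b"] a v b by auto
  then obtain c where c: "c \<in> B" "J +> (a \<oplus> c) \<in> Units (R Quot J)"
    using a Bd(2) h.hom_add by auto
  then show thesis using that unit_lift a Bd(2) by auto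
qed

end

lemma (in ring) minus_zero [simp]: "x \<in> carrier R \<Longrightarrow> x \<ominus> \<zero> = x"
  by (simp add: minus_eq)

section \<open>Double annihilators and self-injectivity\<close>

text \<open>Baer's test for left self-injectivity. A homomorphism from the whole ring to itself is
  right multiplication by the image of 1, so an extension is recorded by the single element
  \<open>c\<close>.\<close>

definition linj :: "('a, 'r) ring_scheme \<Rightarrow> bool"
  where "linj R \<longleftrightarrow> (\<forall>L f. left_ideal L R \<longrightarrow> f \<in> L \<rightarrow> carrier R \<longrightarrow>
    (\<forall>x\<in>L. \<forall>y\<in>L. f (x \<oplus>\<^bsub>R\<^esub> y) = f x \<oplus>\<^bsub>R\<^esub> f y) \<longrightarrow>
    (\<forall>a\<in>carrier R. \<forall>x\<in>L. f (a \<otimes>\<^bsub>R\<^esub> x) = a \<otimes>\<^bsub>R\<^esub> f x) \<longrightarrow>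
    (\<exists>c\<in>carrier R. \<forall>x\<in>L. f x = x \<otimes>\<^bsub>R\<^esub> c))"

context ring
begin

text \<open>The homomorphisms needed later are given by formulas such as ra \<mapsto> rb, where
  well-definedness is the actual content. For an additive relation closed under scalars this reduces
  to the one condition that zero is related only to zero.\<close>

lemma linj_graph:
  assumes "linj R" and G: "G \<subseteq> carrier R \<times> carrier R" and zero: "(\<zero>, \<zero>) \<in> G"
    and add: "\<And>x y x' y'. (x, y) \<in> G \<Longrightarrow> (x', y') \<in> G \<Longrightarrow> (x \<oplus> x', y \<oplus> y') \<in> G"
    and mult: "\<And>a x y. a \<in> carrier R \<Longrightarrow> (x, y) \<in> G \<Longrightarrow> (a \<otimes> x, a \<otimes> y) \<in> G"
    and single: "\<And>y. (\<zero>, y) \<in> G \<Longrightarrow> y = \<zero>"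
  obtains c where "c \<in> carrier R" "\<And>x y. (x, y) \<in> G \<Longrightarrow> y = x \<otimes> c"
proof -
  have uniq: "y = y'" if "(x, y) \<in> G" "(x, y') \<in> G" for x y y'
  proof -
    have c: "x \<in> carrier R" "y \<in> carrier R" "y' \<in> carrier R" using that G by auto
    have "(x \<oplus> \<ominus> \<one> \<otimes> x, y \<oplus> \<ominus> \<one> \<otimes> y') \<in> G" using add mult that by auto
    then have "y \<oplus> \<ominus> \<one> \<otimes> y' = \<zero>" using single c by (simp add: l_minus r_neg)
    then show ?thesis using c by (simp add: l_minus minus_eq[symmetric])
  qed
  define f where "f = (\<lambda>x. THE y. (x, y) \<in> G)"
  have f: "f x = y" if "(x, y) \<in> G" for x y
    unfolding f_def using that uniq by blast
  have "left_ideal (fst ` G) R"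
  proof (rule left_idealI)
    show "fst ` G \<subseteq> carrier R" using G by auto
    show "\<zero> \<in> fst ` G" using zero by force
    show "x \<oplus> y \<in> fst ` G" if "x \<in> fst ` G" "y \<in> fst ` G" for x y using that add by force
    show "a \<otimes> x \<in> fst ` G" if "a \<in> carrier R" "x \<in> fst ` G" for a x using that mult by force
  qed
  moreover have "f \<in> fst ` G \<rightarrow> carrier R" using f G by auto
  moreover have "\<forall>x\<in>fst ` G. \<forall>y\<in>fst ` G. f (x \<oplus> y) = f x \<oplus> f y" using f add by fastforce
  moreover have "\<forall>a\<in>carrier R. \<forall>x\<in>fst ` G. f (a \<otimes> x) = a \<otimes> f x" using f mult by fastforce
  ultimately obtain c where "c \<in> carrier R" "\<forall>x\<in>fst ` G. f x = x \<otimes> c"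
    using assms(1)[unfolded linj_def, THEN spec, THEN spec, of "fst ` G" f] by blast
  then show thesis using that f by force
qed

lemma left_artinian_minimal_image:
  assumes "left_artinian R" "P x" "\<And>x. P x \<Longrightarrow> left_ideal (F x) R"
  shows "\<exists>y. P y \<and> (\<forall>z. P z \<longrightarrow> F z \<subseteq> F y \<longrightarrow> F z = F y)"
proof -
  obtain I where I: "I \<in> F ` Collect P" "\<And>J. J \<in> F ` Collect P \<Longrightarrow> J \<subseteq> I \<Longrightarrow> J = I"
    using left_artinian_minimal[OF assms(1), of "F ` Collect P"] assms(2,3) by blast
  then obtain y where y: "P y" "I = F y" by blast
  have "F z = F y" if "P z" "F z \<subseteq> F y" for z using I(2)[of "F z"] that y by simp
  then show ?thesis using y(1) by blast
qed

lemma right_artinian_minimal_image: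
  assumes "right_artinian R" "P x" "\<And>x. P x \<Longrightarrow> right_ideal (F x) R"
  shows "\<exists>y. P y \<and> (\<forall>z. P z \<longrightarrow> F z \<subseteq> F y \<longrightarrow> F z = F y)"
proof (rule ring.left_artinian_minimal_image[OF ring_opp, of P x F])
  show "left_artinian (opp R)" "P x" using assms(1,2) by simp_all
  show "\<And>x. P x \<Longrightarrow> left_ideal (F x) (opp R)" using assms(3) by simp
qed

text \<open>The double annihilator conditions together with the descending chain condition on right ideals
  make every homomorphism from a left ideal extend one generator at a time.\<close>

lemma linj_of_double_annihilator:
  assumes "right_artinian R"
    and lr: "\<And>L. left_ideal L R \<Longrightarrow> lann R (rann R L) = L"
    and rl: "\<And>L. right_ideal L R \<Longrightarrow> rann R (lann R L) = L"
  shows "linj R"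
  unfolding linj_def
proof (intro allI impI)
  fix L f
  assume L: "left_ideal L R" and f: "f \<in> L \<rightarrow> carrier R"
    and fadd: "\<forall>x\<in>L. \<forall>y\<in>L. f (x \<oplus> y) = f x \<oplus> f y"
    and fmult: "\<forall>a\<in>carrier R. \<forall>x\<in>L. f (a \<otimes> x) = a \<otimes> f x"
  note Ld = left_idealD[OF L]
  have f0: "f \<zero> = \<zero>" using fmult Ld(3) f by (metis PiE l_null r_null zero_closed)
  define ext where "ext = (\<lambda>L'. \<exists>c\<in>carrier R. \<forall>x\<in>L'. f x = x \<otimes> c)"
  let ?P = "\<lambda>L'. left_ideal L' R \<and> L' \<subseteq> L \<and> ext L'"
  have P0: "?P {\<zero>}" using Ld(3) f0 by (auto simp: ext_def)
  have PR: "\<And>K. ?P K \<Longrightarrow> right_ideal (rann R K) R" using left_idealD(1) by simp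
  \<comment> \<open>Through the double annihilator condition, a minimal right annihilator amounts to
    a maximal domain on which \<open>f\<close> is a right multiplication.\<close>
  obtain L' where "?P L'" and min': "\<forall>K. ?P K \<longrightarrow> rann R K \<subseteq> rann R L' \<longrightarrow> rann R K = rann R L'"
    using right_artinian_minimal_image[of ?P "{\<zero>}" "rann R", OF assms(1) P0 PR] by blast
  then have L': "left_ideal L' R" "L' \<subseteq> L" "ext L'" by auto
  have min: "rann R K = rann R L'"
    if "left_ideal K R" "K \<subseteq> L" "ext K" "rann R K \<subseteq> rann R L'" for K
    using that min' by blast
  note L'd = left_idealD[OF L'(1)]
  obtain c where c: "c \<in> carrier R" "\<forall>x\<in>L'. f x = x \<otimes> c" using L'(3) by (auto simp: ext_def)
  have "L \<subseteq> L'"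
  proof
    fix z assume z: "z \<in> L"
    then have zc: "z \<in> carrier R" using Ld by blast
    have fz: "f z \<in> carrier R" using f z by auto
    have "lann R {z} \<subseteq> lann R {f z}" using fmult z f0 by (auto simp: lann_def) (metis)
    then have "f z \<in> rann R (lann R {z})" using fz by (auto simp: lann_def rann_def)
    also have "rann R (lann R {z}) = rprin R z" using rl[of "rprin R z"] lann_rprin zc by simp
    finally obtain d where d: "d \<in> carrier R" "f z = z \<otimes> d" by (auto simp: rprin_def)
    \<comment> \<open>By both double annihilator conditions this sum is the right annihilator of the
      intersection of \<open>L'\<close> with the multiples of \<open>z\<close>. There
      \<open>c\<close> and \<open>d\<close> describe the same map, so their difference splits as p +
      q with \<open>p\<close> killing \<open>L'\<close> and \<open>q\<close> killing
      \<open>z\<close>; then c - p works for both.\<close>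
    let ?S = "rann R L' <+>\<^bsub>R\<^esub> rann R {z}"
    have S: "right_ideal ?S R" using zc L'd(1) by (intro right_ideal_sum) auto
    have "lann R ?S = L' \<inter> lprin R z"
      using lann_set_add[of "rann R L'" "rann R {z}"] lr[OF L'(1)] lr[of "lprin R z"] rann_lprin zc L'd(1)
      by simp
    then have S': "rann R (L' \<inter> lprin R z) = ?S" using rl[OF S] by simp
    have "c \<ominus> d \<in> rann R (L' \<inter> lprin R z)"
    proof -
      have "x \<otimes> (c \<ominus> d) = \<zero>" if x: "x \<in> L'" "x \<in> lprin R z" for x
      proof -
        obtain r where r: "r \<in> carrier R" "x = r \<otimes> z" using x by (auto simp: lprin_def)
        have "x \<otimes> c = x \<otimes> d" using c(2) x(1) fmult r z d zc by (metis m_assoc)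
        then show ?thesis using c d x L'd(2) by (simp add: r_minus_distr)
      qed
      then show ?thesis using c d by (auto simp: rann_def)
    qed
    then obtain p q where pq: "p \<in> rann R L'" "q \<in> rann R {z}" "c \<ominus> d = p \<oplus> q"
      unfolding S' by (auto simp: set_add_mem)
    have pqc: "p \<in> carrier R" "q \<in> carrier R" using pq by (auto simp: rann_def)
    define c' where "c' = c \<ominus> p"
    have c'c: "c' \<in> carrier R" using c pqc by (simp add: c'_def)
    have "c = (p \<oplus> q) \<oplus> d" using minus_add_cancel[of c d] pq c d by simp
    then have c'2: "c' = q \<oplus> d"
      unfolding c'_def using pqc d add_minus_cancel_left[of p "q \<oplus> d"] by (simp add: a_assoc)
    have x1: "x \<otimes> c' = f x" if "x \<in> L'" for x
      using that c pq(1) L'd(2) pqc unfolding c'_def by (simp add: r_minus_distr rann_def)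
    have x2: "z \<otimes> c' = f z" unfolding c'2 using pq(2) d zc by (simp add: rann_def r_distr)
    let ?L = "L' <+>\<^bsub>R\<^esub> lprin R z"
    have sub: "?L \<subseteq> L" using set_add_least[OF L L'(2) lprin_least[OF L z]] .
    have Lid: "left_ideal ?L R" using L'(1) zc left_ideal_sum by auto
    have "f y = y \<otimes> c'" if "y \<in> ?L" for y
    proof -
      obtain x r where xr: "x \<in> L'" "r \<in> carrier R" "y = x \<oplus> r \<otimes> z"
        using \<open>y \<in> ?L\<close> by (auto simp: set_add_mem lprin_def)
      have "f y = f x \<oplus> r \<otimes> f z" using xr fadd fmult L'(2) z Ld(5) by auto
      also have "\<dots> = y \<otimes> c'" using xr x1 x2 c'c zc L'd(2)
        by (simp add: l_distr m_assoc)
      finally show ?thesis .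
    qed
    then have "ext ?L" using c'c by (auto simp: ext_def)
    moreover have up: "L' \<subseteq> ?L" "lprin R z \<subseteq> ?L" using set_add_upper[OF L'(1)] zc by auto
    ultimately have "rann R ?L = rann R L'" using min[OF Lid sub] rann_antimono by blast
    then have "?L = L'" using lr[OF Lid] lr[OF L'(1)] by simp
    then show "z \<in> L'" using up lprin_self[OF zc] by auto
  qed
  then show "\<exists>c\<in>carrier R. \<forall>x\<in>L. f x = x \<otimes> c" using c by auto
qed

text \<open>A nonzero \<open>s\<close> generates the simple module \<open>S\<close>, so its left
  annihilator is a maximal left ideal and contains \<open>J\<close>.\<close>

lemma minimal_left_ideal_annihilated:
  assumes "minimal_left_ideal S R"
  shows "S \<subseteq> rann R J"
proof
  have S: "left_ideal S R" using assms by (simp add: minimal_left_ideal_def)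
  note Sd = left_idealD[OF S]
  fix s assume s: "s \<in> S"
  then have sc: "s \<in> carrier R" using Sd by blast
  show "s \<in> rann R J"
  proof (cases "s = \<zero>")
    case False
    have "maximal_left_ideal (lann R {s}) R"
      unfolding maximal_left_ideal_def
    proof (intro conjI allI impI)
      show "left_ideal (lann R {s}) R" using sc by simp
      have "\<one> \<notin> lann R {s}" using False sc by (simp add: lann_def)
      then show "lann R {s} \<noteq> carrier R" using one_closed by blast
      fix L assume L: "left_ideal L R \<and> lann R {s} \<subseteq> L"
      show "L = lann R {s} \<or> L = carrier R"
      proof (cases "L = lann R {s}")
        case False
        then obtain r where r: "r \<in> L" "r \<notin> lann R {s}" using L by blast
        have rc: "r \<in> carrier R" using r L left_idealD(2) by blast
        have rs: "r \<otimes> s \<in> S" "r \<otimes> s \<noteq> \<zero>" using r rc Sd s by (auto simp: lann_def)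
        have "lprin R (r \<otimes> s) = S"
        proof -
          have "lprin R (r \<otimes> s) \<noteq> {\<zero>}" using rs(2) lprin_self[of "r \<otimes> s"] rc sc by auto
          then show ?thesis
            using assms lprin_least[OF S rs(1)] left_ideal_lprin[of "r \<otimes> s"] rc sc
            unfolding minimal_left_ideal_def by blast
        qed
        then obtain a where a: "a \<in> carrier R" "s = a \<otimes> (r \<otimes> s)" using s by (auto simp: lprin_def)
        then have "(\<one> \<ominus> a \<otimes> r) \<otimes> s = \<zero>" using rc sc by (simp add: l_minus_distr m_assoc)
        then have "\<one> \<ominus> a \<otimes> r \<in> L" using L a(1) rc by (auto simp: lann_def)
        moreover have "a \<otimes> r \<in> L" using L r a(1) left_idealD(5) by blast
        ultimately have "(\<one> \<ominus> a \<otimes> r) \<oplus> a \<otimes> r \<in> L" using L left_idealD(4) by blast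
        then have "\<one> \<in> L" using a(1) rc minus_add_cancel by simp
        then show ?thesis using L left_ideal_eq_carrier by blast
      qed auto
    qed
    then have "J \<subseteq> lann R {s}" by (auto simp: jacobson_radical_def)
    then show ?thesis using sc by (auto simp: rann_def lann_def)
  qed (auto simp: rann_def jacobson_radical_def)
qed

end

section \<open>Annihilators in a left Artinian, left self-injective ring\<close>

locale left_selfinjective = ring +
  assumes left_artin: "left_artinian R" and left_inj: "linj R"
begin

abbreviation "T \<equiv> rann R J"

text \<open>The hypothesis makes ra \<mapsto> rb well defined; by self-injectivity it is a right
  multiplication, and r = 1 gives the factor.\<close>

lemma rprin_of_lann_subset:
  assumes "a \<in> carrier R" "b \<in> carrier R" "lann R {a} \<subseteq> lann R {b}"
  shows "b \<in> rprin R a"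
proof -
  let ?G = "(\<lambda>r. (r \<otimes> a, r \<otimes> b)) ` carrier R"
  obtain c where "c \<in> carrier R" "\<And>x y. (x, y) \<in> ?G \<Longrightarrow> y = x \<otimes> c"
  proof (rule linj_graph[OF left_inj, of ?G])
    show "?G \<subseteq> carrier R \<times> carrier R" using assms by auto
    show "(\<zero>, \<zero>) \<in> ?G" using assms by (intro image_eqI[of _ _ \<zero>]) auto
    show "(x \<oplus> x', y \<oplus> y') \<in> ?G" if "(x, y) \<in> ?G" "(x', y') \<in> ?G" for x y x' y'
      using that assms by (auto simp: l_distr[symmetric])
    show "(r \<otimes> x, r \<otimes> y) \<in> ?G" if "r \<in> carrier R" "(x, y) \<in> ?G" for r x y
      using that assms by (auto simp: m_assoc[symmetric])
    show "y = \<zero>" if "(\<zero>, y) \<in> ?G" for y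
      using that assms by (auto simp: lann_def)
  qed blast
  moreover have "(\<one> \<otimes> a, \<one> \<otimes> b) \<in> ?G" by blast
  ultimately show ?thesis using assms by (auto simp: rprin_def)
qed

text \<open>If \<open>z\<close> kills the intersection, then x + y \<mapsto> x z is well defined on
  the sum of \<open>I\<close> and \<open>K\<close>. It is right multiplication by some
  \<open>c\<close>, which kills \<open>K\<close> and agrees with \<open>z\<close> on
  \<open>I\<close>.\<close>

lemma rann_Int_subset:
  assumes I: "left_ideal I R" and K: "left_ideal K R"
  shows "rann R (I \<inter> K) \<subseteq> rann R I <+>\<^bsub>R\<^esub> rann R K"
proof
  note Id = left_idealD[OF I] and Kd = left_idealD[OF K]
  fix z assume z: "z \<in> rann R (I \<inter> K)"
  then have zc: "z \<in> carrier R" by (simp add: rann_def)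
  let ?G = "(\<lambda>(x, y). (x \<oplus> y, x \<otimes> z)) ` (I \<times> K)"
  have mem: "(x \<oplus> y, x \<otimes> z) \<in> ?G" if "x \<in> I" "y \<in> K" for x y
    using that by (intro image_eqI[of _ _ "(x, y)"]) auto
  obtain c where c: "c \<in> carrier R" "\<And>x y. (x, y) \<in> ?G \<Longrightarrow> y = x \<otimes> c"
  proof (rule linj_graph[OF left_inj, of ?G])
    show "?G \<subseteq> carrier R \<times> carrier R" using Id(2) Kd(2) zc by auto
    show "(\<zero>, \<zero>) \<in> ?G" using Id(3) Kd(3) zc by (intro image_eqI[of _ _ "(\<zero>, \<zero>)"]) auto
    show "(x \<oplus> x', y \<oplus> y') \<in> ?G" if xy: "(x, y) \<in> ?G" "(x', y') \<in> ?G" for x y x' y'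
    proof -
      obtain a b a' b' where *: "a \<in> I" "b \<in> K" "x = a \<oplus> b" "y = a \<otimes> z"
        "a' \<in> I" "b' \<in> K" "x' = a' \<oplus> b'" "y' = a' \<otimes> z" using xy by auto
      have "x \<oplus> x' = (a \<oplus> a') \<oplus> (b \<oplus> b')" "y \<oplus> y' = (a \<oplus> a') \<otimes> z"
        using * Id(2) Kd(2) zc by (simp_all add: a_ac l_distr)
      then show ?thesis using mem[of "a \<oplus> a'" "b \<oplus> b'"] * Id(4) Kd(4) by simp
    qed
    show "(r \<otimes> x, r \<otimes> y) \<in> ?G" if r: "r \<in> carrier R" and xy: "(x, y) \<in> ?G" for r x y
    proof -
      obtain a b where *: "a \<in> I" "b \<in> K" "x = a \<oplus> b" "y = a \<otimes> z" using xy by auto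
      have "r \<otimes> x = r \<otimes> a \<oplus> r \<otimes> b" "r \<otimes> y = (r \<otimes> a) \<otimes> z"
        using * Id(2) Kd(2) zc r by (simp_all add: r_distr m_assoc)
      then show ?thesis using mem[of "r \<otimes> a" "r \<otimes> b"] * Id(5) Kd(5) r by simp
    qed
    show "y = \<zero>" if "(\<zero>, y) \<in> ?G" for y
    proof -
      have "\<exists>a\<in>I. \<exists>b\<in>K. (\<zero>, y) = (a \<oplus> b, a \<otimes> z)" using that by fast
      then obtain a b where *: "a \<in> I" "b \<in> K" "\<zero> = a \<oplus> b" "y = a \<otimes> z" unfolding prod.inject by blast
      have "a = \<ominus> b" using * Id(2) Kd(2) by (metis minus_equality)
      then have "a \<in> I \<inter> K" using * Kd(6) by auto
      then show ?thesis using z * by (simp add: rann_def)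
    qed
  qed blast
  have 1: "x \<otimes> z = x \<otimes> c" if "x \<in> I" for x
    using c(2)[OF mem[OF that Kd(3)]] that Id(2) by simp
  have 2: "y \<otimes> c = \<zero>" if "y \<in> K" for y
    using c(2)[OF mem[OF Id(3) that]] that Kd(2) zc by simp
  have "z \<ominus> c \<in> rann R I" using 1 c(1) zc Id(2) by (simp add: rann_def r_minus_distr)
  moreover have "c \<in> rann R K" using 2 c(1) by (simp add: rann_def)
  moreover have "z = (z \<ominus> c) \<oplus> c" using zc c(1) minus_add_cancel by simp
  ultimately show "z \<in> rann R I <+>\<^bsub>R\<^esub> rann R K" unfolding set_add_mem by blast
qed

text \<open>Principal right ideals are double annihilators by \<open>rprin_of_lann_subset\<close>,
  and \<open>rann_Int_subset\<close> allows one more generator to be added. The descending chain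
  condition, applied to left annihilators of double annihilators inside \<open>U\<close>, yields one
  that cannot grow any more.\<close>

lemma rann_lann:
  assumes "right_ideal U R"
  shows "rann R (lann R U) = U"
proof
  note Ud = right_idealD[OF assms]
  show "U \<subseteq> rann R (lann R U)" using rann_lann_subset Ud(1) .
  let ?P = "\<lambda>Y. right_ideal Y R \<and> Y \<subseteq> U \<and> rann R (lann R Y) = Y"
  have "lann R {\<zero>} = carrier R" by (auto simp: lann_def)
  moreover have "rann R (carrier R) \<subseteq> {\<zero>}"
  proof
    fix y assume "y \<in> rann R (carrier R)"
    then have "y \<in> carrier R" "\<one> \<otimes> y = \<zero>" by (auto simp: rann_def simp del: l_one)
    then show "y \<in> {\<zero>}" by simp
  qed
  ultimately have P0: "?P {\<zero>}" using Ud(3) by (auto simp: rann_def)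
  have PL: "\<And>Y. ?P Y \<Longrightarrow> left_ideal (lann R Y) R" using right_idealD(1) by simp
  obtain Y where Y: "?P Y" and min: "\<forall>Z. ?P Z \<longrightarrow> lann R Z \<subseteq> lann R Y \<longrightarrow> lann R Z = lann R Y"
    using left_artinian_minimal_image[of ?P "{\<zero>}" "lann R", OF left_artin P0 PL] by blast
  have Yr: "right_ideal Y R" "Y \<subseteq> U" "rann R (lann R Y) = Y" using Y by auto
  have "U \<subseteq> Y"
  proof
    fix x assume x: "x \<in> U"
    then have xc: "x \<in> carrier R" using Ud by blast
    let ?Z = "Y <+>\<^bsub>R\<^esub> rprin R x"
    have Zr: "right_ideal ?Z R" using right_ideal_sum Yr(1) xc by simp
    have up: "Y \<subseteq> ?Z" "rprin R x \<subseteq> ?Z"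
      using ring.set_add_upper[OF ring_opp, of Y "rprin R x"] Yr(1) xc by simp_all
    have sub: "?Z \<subseteq> U"
      using ring.set_add_least[OF ring_opp, of U Y "rprin R x"] assms Yr(2) rprin_least[OF assms x] by simp
    have lZ: "lann R ?Z = lann R Y \<inter> lann R {x}"
      using lann_set_add[of Y "rprin R x"] Yr(1) xc lann_rprin by simp
    have "rann R (lann R {x}) \<subseteq> rprin R x"
    proof
      fix y assume "y \<in> rann R (lann R {x})"
      then have "y \<in> carrier R" "lann R {x} \<subseteq> lann R {y}" by (auto simp: rann_def lann_def)
      then show "y \<in> rprin R x" using rprin_of_lann_subset xc by blast
    qed
    then have "rann R (lann R Y) <+>\<^bsub>R\<^esub> rann R (lann R {x}) \<subseteq> ?Z"
      unfolding Yr(3) set_add_def set_mult_def by auto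
    then have "rann R (lann R ?Z) \<subseteq> ?Z"
      using rann_Int_subset[of "lann R Y" "lann R {x}"] lZ xc right_idealD(1)[OF Yr(1)] by force
    then have "rann R (lann R ?Z) = ?Z"
      using rann_lann_subset[of ?Z] right_idealD(1)[OF Zr] by blast
    then have "lann R ?Z = lann R Y" using min Zr sub lZ by blast
    then have "?Z = Y" using \<open>rann R (lann R ?Z) = ?Z\<close> Yr(3) by simp
    then show "x \<in> Y" using up rprin_self[OF xc] by auto
  qed
  then show "rann R (lann R U) \<subseteq> U" using Yr by auto
qed

text \<open>Right ideals are determined by their left annihilators, so the descending chain
  condition on left ideals acts as an ascending one on right ideals.\<close>

lemma right_ideal_maximal_image:
  assumes "P x" "\<And>x. P x \<Longrightarrow> right_ideal (F x) R"
  shows "\<exists>y. P y \<and> (\<forall>z. P z \<longrightarrow> F y \<subseteq> F z \<longrightarrow> F z = F y)"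
proof -
  have PL: "\<And>y. P y \<Longrightarrow> left_ideal (lann R (F y)) R" using assms(2) right_idealD(1) by simp
  obtain y where y: "P y" and min: "\<forall>z. P z \<longrightarrow> lann R (F z) \<subseteq> lann R (F y) \<longrightarrow> lann R (F z) = lann R (F y)"
    using left_artinian_minimal_image[of P x "\<lambda>y. lann R (F y)", OF left_artin assms(1) PL] by blast
  have "F z = F y" if "P z" "F y \<subseteq> F z" for z
  proof -
    have "lann R (F z) = lann R (F y)" using min that lann_antimono by blast
    then show ?thesis using rann_lann[OF assms(2)] that(1) y by metis
  qed
  then show ?thesis using y by blast
qed

text \<open>The left annihilator of an element \<open>a\<close> of the radical is essential: otherwise right
  multiplication by \<open>a\<close> could be inverted on a nonzero left ideal by right multiplication by some
  \<open>c\<close>, although \<open>1 - a c\<close> is a unit.\<close>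

lemma lann_jac_essential:
  assumes a: "a \<in> J" and L: "left_ideal L R" and int: "L \<inter> lann R {a} \<subseteq> {\<zero>}"
  shows "L = {\<zero>}"
proof -
  note Ld = left_idealD[OF L]
  have ac: "a \<in> carrier R" using a jac_subset by auto
  let ?G = "(\<lambda>x. (x \<otimes> a, x)) ` L"
  obtain c where c: "c \<in> carrier R" "\<And>x y. (x, y) \<in> ?G \<Longrightarrow> y = x \<otimes> c"
  proof (rule linj_graph[OF left_inj, of ?G])
    show "?G \<subseteq> carrier R \<times> carrier R" using Ld(2) ac by auto
    show "(\<zero>, \<zero>) \<in> ?G" using Ld(3) ac by (intro image_eqI[of _ _ \<zero>]) auto
    show "(x \<oplus> x', y \<oplus> y') \<in> ?G" if "(x, y) \<in> ?G" "(x', y') \<in> ?G" for x y x' y'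
      using that ac Ld(2,4) by (auto simp: l_distr[symmetric])
    show "(r \<otimes> x, r \<otimes> y) \<in> ?G" if "r \<in> carrier R" "(x, y) \<in> ?G" for r x y
      using that ac Ld(2,5) by (auto simp: m_assoc[symmetric])
    show "y = \<zero>" if "(\<zero>, y) \<in> ?G" for y
    proof -
      have "y \<in> L" "y \<otimes> a = \<zero>" using that by auto
      then have "y \<in> L \<inter> lann R {a}" using Ld(2) by (simp add: lann_def)
      then show ?thesis using int by blast
    qed
  qed blast
  have "x = \<zero>" if x: "x \<in> L" for x
  proof -
    have xc: "x \<in> carrier R" using x Ld by blast
    have "x = x \<otimes> a \<otimes> c" using c(2)[of "x \<otimes> a" x] x by blast
    then have "x \<otimes> (\<one> \<ominus> a \<otimes> c) = \<zero>" using xc ac c(1) by (simp add: r_minus_distr m_assoc)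
    moreover have "\<one> \<ominus> a \<otimes> c \<in> Units R" using jac_unit jac_right_closed a c(1) by blast
    ultimately show ?thesis using xc
      by (metis Units_closed Units_r_inv_ex l_null m_assoc r_one)
  qed
  then show ?thesis using Ld(3) by blast
qed

lemma left_ideal_T [simp]: "left_ideal T R"
  by (rule left_ideal_rann) simp

lemma right_ideal_T [simp]: "right_ideal T R"
  using jac_subset by simp

text \<open>Split 1 = l + k along the left annihilator of \<open>t \<otimes> a\<close>, which
  contains \<open>J\<close>. The left ideal generated by \<open>k \<otimes> t\<close> meets the
  essential left annihilator of \<open>a\<close> in zero, so k t = 0 and t a = l (t a) = 0.\<close>

lemma T_mult_jac:
  assumes t: "t \<in> T" and a: "a \<in> J"
  shows "t \<otimes> a = \<zero>"
proof -
  have c: "t \<in> carrier R" "a \<in> carrier R" using t a jac_subset by (auto simp: rann_def)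
  let ?L = "lann R {t \<otimes> a}"
  have "J \<subseteq> ?L"
  proof
    fix j assume j: "j \<in> J"
    then have jc: "j \<in> carrier R" using jac_subset by auto
    have "j \<otimes> (t \<otimes> a) = j \<otimes> t \<otimes> a" using jc c by (simp add: m_assoc)
    then show "j \<in> ?L" using t j jc c by (simp add: rann_def lann_def)
  qed
  then obtain l k where lk: "l \<in> ?L" "k \<in> carrier R" "\<one> = l \<oplus> k"
      "\<And>r. r \<in> carrier R \<Longrightarrow> r \<otimes> k \<in> ?L \<Longrightarrow> r \<otimes> k \<in> J"
    using complement_mod_jac[OF left_artin, of ?L] c by (metis empty_subsetI insert_subset left_ideal_lann m_closed)
  have lc: "l \<in> carrier R" using lk by (simp add: lann_def)
  have "lprin R (k \<otimes> t) = {\<zero>}"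
  proof (rule lann_jac_essential[OF a])
    show "left_ideal (lprin R (k \<otimes> t)) R" using lk c by simp
    show "lprin R (k \<otimes> t) \<inter> lann R {a} \<subseteq> {\<zero>}"
    proof
      fix y assume y: "y \<in> lprin R (k \<otimes> t) \<inter> lann R {a}"
      then obtain r where r: "r \<in> carrier R" "y = r \<otimes> (k \<otimes> t)" by (auto simp: lprin_def)
      have "r \<otimes> k \<otimes> (t \<otimes> a) = y \<otimes> a" using r lk(2) c by (simp add: m_assoc)
      then have "r \<otimes> k \<in> ?L" using y r lk(2) by (simp add: lann_def)
      then have "r \<otimes> k \<in> J" using lk(4) r by blast
      then have "r \<otimes> k \<otimes> t = \<zero>" using t by (simp add: rann_def)
      then show "y \<in> {\<zero>}" using r lk(2) c by (simp add: m_assoc)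
    qed
  qed
  then have "k \<otimes> t = \<zero>" using lprin_self[of "k \<otimes> t"] lk c by simp
  then have "t = l \<otimes> t" using lk c lc by (metis l_distr l_one m_closed r_zero)
  then have "t \<otimes> a = l \<otimes> (t \<otimes> a)" using c lc by (metis m_assoc)
  then show ?thesis using lk by (simp add: lann_def)
qed

text \<open>If \<open>a\<close> kills \<open>T\<close> but lies outside a maximal left ideal
  \<open>M\<close>, write 1 = b a + m with \<open>m\<close> in \<open>M\<close>. Then
  \<open>m\<close> acts on \<open>T\<close> from the right as the identity, so its left annihilator
  contains no minimal left ideal and vanishes; hence \<open>m\<close> has a left inverse, which is
  absurd in \<open>M\<close>.\<close>

lemma rann_T: "rann R T = J"
proof
  show "J \<subseteq> rann R T" using T_mult_jac jac_subset by (auto simp: rann_def)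
  show "rann R T \<subseteq> J"
  proof
    fix a assume a: "a \<in> rann R T"
    then have ac: "a \<in> carrier R" by (simp add: rann_def)
    show "a \<in> J"
    proof (rule ccontr)
      assume "a \<notin> J"
      then obtain M where M: "maximal_left_ideal M R" "a \<notin> M" using ac by (auto simp: jacobson_radical_def)
      note Md = maximal_left_idealD[OF M(1)]
      obtain b m where bm: "b \<in> carrier R" "m \<in> M" "\<one> = b \<otimes> a \<oplus> m" using Md(3)[OF ac M(2)] by blast
      have mc: "m \<in> carrier R" using bm left_idealD(2)[OF Md(1)] by blast
      have "m = \<one> \<ominus> b \<otimes> a" using bm mc ac add_minus_cancel_left by simp
      then have tm: "t \<otimes> m = t" if "t \<in> T" for t
      proof -
        have tc: "t \<in> carrier R" using that by (simp add: rann_def)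
        have "t \<otimes> b \<in> T" using right_idealD(5)[OF right_ideal_T] that bm(1) by blast
        then have "t \<otimes> b \<otimes> a = \<zero>" using a by (simp add: rann_def)
        then show ?thesis using tc bm(1) ac \<open>m = _\<close> by (simp add: r_minus_distr m_assoc)
      qed
      have "lann R {m} = {\<zero>}"
      proof (rule ccontr)
        assume "lann R {m} \<noteq> {\<zero>}"
        then obtain S where S: "minimal_left_ideal S R" "S \<subseteq> lann R {m}"
          using minimal_left_ideal_exists[OF left_artin, of "lann R {m}"] mc by auto
        have "S \<subseteq> {\<zero>}" using minimal_left_ideal_annihilated[OF S(1)] S(2) tm by (force simp: lann_def)
        moreover have "\<zero> \<in> S" "S \<noteq> {\<zero>}" using S(1) left_idealD(3) by (auto simp: minimal_left_ideal_def)
        ultimately show False by auto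
      qed
      then obtain d where "d \<in> carrier R" "d \<otimes> m = \<one>"
        using left_inverse_of_lann_zero[OF left_artin mc] by blast
      then have "\<one> \<in> M" using left_idealD(5)[OF Md(1) _ bm(2)] by metis
      then show False using Md(2) by simp
    qed
  qed
qed

text \<open>The map \<open>\<Omega>\<close> sends a two-sided ideal \<open>P \<supseteq> J\<close> to the left annihilator of \<open>T \<inter> l(P)\<close>.  It is
  monotone and injective (\<open>r(r(\<Omega> P)) = P\<close>), so the ascending chain \<open>J \<subseteq> \<Omega> J \<subseteq> \<Omega>\<^sup>2 J \<subseteq> \<dots>\<close> can only
  become stationary if \<open>\<Omega> J = J\<close>.  It expresses the Nakayama permutation of the simple modules.\<close>

lemma lann_T: "lann R T = J"
proof -
  define \<Omega> where "\<Omega> = (\<lambda>P. lann R (T \<inter> lann R P))"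
  define ok where "ok = (\<lambda>P. left_ideal P R \<and> right_ideal P R \<and> J \<subseteq> P)"
  have ok_step: "ok (\<Omega> P)" "rann R (rann R (\<Omega> P)) = P" if P: "ok P" for P
  proof -
    have Pl: "left_ideal P R" and Pr: "right_ideal P R" and JP: "J \<subseteq> P" using P by (auto simp: ok_def)
    note c = left_idealD(1)[OF Pl]
    have U: "left_ideal (T \<inter> lann R P) R" "right_ideal (T \<inter> lann R P) R"
      using left_ideal_Int right_ideal_Int right_ideal_lann[OF Pl] c by simp_all
    have "J \<subseteq> \<Omega> P" using jac_subset by (auto simp: \<Omega>_def lann_def rann_def)
    then show "ok (\<Omega> P)" using U right_ideal_lann left_idealD(1)[OF U(1)] by (simp add: ok_def \<Omega>_def)
    have "rann R (rann R (\<Omega> P)) = rann R (T \<inter> lann R P)" unfolding \<Omega>_def using rann_lann[OF U(2)] by simp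
    also have "\<dots> = P"
    proof
      have "rann R (T \<inter> lann R P) \<subseteq> rann R T <+>\<^bsub>R\<^esub> rann R (lann R P)"
        using rann_Int_subset[of T "lann R P"] c by simp
      also have "\<dots> \<subseteq> P" unfolding rann_T rann_lann[OF Pr] using set_add_least[OF Pl JP] by simp
      finally show "rann R (T \<inter> lann R P) \<subseteq> P" .
      show "P \<subseteq> rann R (T \<inter> lann R P)" using c by (auto simp: rann_def lann_def)
    qed
    finally show "rann R (rann R (\<Omega> P)) = P" .
  qed
  have mono: "\<Omega> P \<subseteq> \<Omega> Q" if "P \<subseteq> Q" for P Q
    using that by (auto simp: \<Omega>_def lann_def)
  define p where "p = (\<lambda>k. (\<Omega> ^^ k) J)"
  have "ok J" by (simp add: ok_def)
  then have ok: "ok (p k)" for k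
    by (induction k) (auto simp: p_def ok_step)
  have step: "p k \<subseteq> p (Suc k)" for k
  proof (induction k)
    case 0
    show ?case using ok[of 1] by (simp add: p_def ok_def)
  next
    case (Suc k)
    then show ?case using mono[of "p k" "p (Suc k)"] by (simp add: p_def)
  qed
  have "\<And>k. True \<Longrightarrow> right_ideal (p k) R" using ok by (simp add: ok_def)
  then obtain k where k: "\<forall>z. p k \<subseteq> p z \<longrightarrow> p z = p k"
    using right_ideal_maximal_image[of "\<lambda>_. True" 0 p] by blast
  have "p (Suc k) = p k" using k step by blast
  \<comment> \<open>A left inverse of \<open>\<Omega>\<close> along the chain; it carries the
    equality of two neighbours down to the first two members.\<close>
  have rev: "rann R (rann R (p (Suc k))) = p k" for k
    using ok_step(2)[OF ok[of k]] by (simp add: p_def)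
  have "p (Suc 0) = p 0"
    using \<open>p (Suc k) = p k\<close>
  proof (induction k)
    case (Suc k)
    then show ?case using rev[of "Suc k"] rev[of k] by simp
  qed
  then have "\<Omega> J = J" by (simp add: p_def)
  moreover have "T \<inter> lann R J = T" using T_mult_jac by (auto simp: lann_def rann_def)
  ultimately show ?thesis by (simp add: \<Omega>_def)
qed

text \<open>The ring is a cogenerator. For \<open>y\<close> outside \<open>L\<close>, the elements
  moving \<open>y\<close> into \<open>L\<close> lie in a maximal left ideal \<open>M\<close>, and
  R/M has a copy in the ring, generated by an element \<open>k \<otimes> t\<close> that exists
  because only \<open>J\<close> kills \<open>T\<close> from the left. The map x + ry \<mapsto> r (k
  t) is a right multiplication by some \<open>c\<close> that kills \<open>L\<close> but not
  \<open>y\<close>.\<close>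

lemma lann_rann:
  assumes L: "left_ideal L R"
  shows "lann R (rann R L) = L"
proof
  note Ld = left_idealD[OF L]
  show "L \<subseteq> lann R (rann R L)" using lann_rann_subset Ld(1) .
  show "lann R (rann R L) \<subseteq> L"
  proof
    fix y assume y: "y \<in> lann R (rann R L)"
    then have yc: "y \<in> carrier R" by (simp add: lann_def)
    show "y \<in> L"
    proof (rule ccontr)
      assume "y \<notin> L"
      let ?C = "{r \<in> carrier R. r \<otimes> y \<in> L}"
      have "\<one> \<notin> ?C" using \<open>y \<notin> L\<close> yc by simp
      then obtain M where M: "maximal_left_ideal M R" "?C \<subseteq> M"
        using maximal_left_ideal_exists[OF left_ideal_colon[OF L yc]] by blast
      note Md = maximal_left_idealD[OF M(1)] and Mi = left_idealD[OF maximal_left_idealD(1)[OF M(1)]]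
      have JM: "J \<subseteq> M" using M(1) by (auto simp: jacobson_radical_def)
      obtain m k where mk: "m \<in> M" "k \<in> carrier R" "\<one> = m \<oplus> k" "\<And>x. x \<in> M \<Longrightarrow> x \<otimes> k \<in> J"
        using complement_mod_jac[OF left_artin Md(1) JM] by metis
      have "k \<notin> J" using mk Mi(4) JM Md(2) by auto
      then obtain t where t: "t \<in> T" "k \<otimes> t \<noteq> \<zero>" using mk(2) lann_T by (auto simp: lann_def)
      have tc: "t \<in> carrier R" using t by (simp add: rann_def)
      have Mkt: "x \<otimes> (k \<otimes> t) = \<zero>" if "x \<in> M" for x
      proof -
        have "x \<otimes> k \<otimes> t = \<zero>" using mk(4)[OF that] t by (simp add: rann_def)
        then show ?thesis using that Mi(2) mk tc by (simp add: m_assoc)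
      qed
      define s where "s = k \<otimes> t"
      have sc: "s \<in> carrier R" using mk tc by (simp add: s_def)
      let ?G = "(\<lambda>(x, r). (x \<oplus> r \<otimes> y, r \<otimes> s)) ` (L \<times> carrier R)"
      have mem: "(x \<oplus> r \<otimes> y, r \<otimes> s) \<in> ?G" if "x \<in> L" "r \<in> carrier R" for x r
        using that by (intro image_eqI[of _ _ "(x, r)"]) auto
      obtain c where c: "c \<in> carrier R" "\<And>x y. (x, y) \<in> ?G \<Longrightarrow> y = x \<otimes> c"
      proof (rule linj_graph[OF left_inj, of ?G])
        show "?G \<subseteq> carrier R \<times> carrier R" using Ld(2) yc sc by auto
        show "(\<zero>, \<zero>) \<in> ?G" using Ld(3) yc sc by (intro image_eqI[of _ _ "(\<zero>, \<zero>)"]) auto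
        show "(x \<oplus> x', z \<oplus> z') \<in> ?G" if xy: "(x, z) \<in> ?G" "(x', z') \<in> ?G" for x z x' z'
        proof -
          obtain a r a' r' where *: "a \<in> L" "r \<in> carrier R" "x = a \<oplus> r \<otimes> y" "z = r \<otimes> s"
            "a' \<in> L" "r' \<in> carrier R" "x' = a' \<oplus> r' \<otimes> y" "z' = r' \<otimes> s" using xy by auto
          have "x \<oplus> x' = (a \<oplus> a') \<oplus> (r \<oplus> r') \<otimes> y" "z \<oplus> z' = (r \<oplus> r') \<otimes> s"
            using * Ld(2) yc sc by (simp_all add: a_ac l_distr)
          then show ?thesis using mem[of "a \<oplus> a'" "r \<oplus> r'"] * Ld(4) by simp
        qed
        show "(b \<otimes> x, b \<otimes> z) \<in> ?G" if b: "b \<in> carrier R" and xz: "(x, z) \<in> ?G" for b x z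
        proof -
          obtain a r where *: "a \<in> L" "r \<in> carrier R" "x = a \<oplus> r \<otimes> y" "z = r \<otimes> s" using xz by auto
          have "b \<otimes> x = b \<otimes> a \<oplus> (b \<otimes> r) \<otimes> y" "b \<otimes> z = (b \<otimes> r) \<otimes> s"
            using * Ld(2) yc sc b by (simp_all add: r_distr m_assoc)
          then show ?thesis using mem[of "b \<otimes> a" "b \<otimes> r"] * Ld(5) b by simp
        qed
        show "z = \<zero>" if "(\<zero>, z) \<in> ?G" for z
        proof -
          have "\<exists>a\<in>L. \<exists>r\<in>carrier R. (\<zero>, z) = (a \<oplus> r \<otimes> y, r \<otimes> s)" using that by fast
          then obtain a r where *: "a \<in> L" "r \<in> carrier R" "\<zero> = a \<oplus> r \<otimes> y" "z = r \<otimes> s"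
            unfolding prod.inject by blast
          have "r \<otimes> y = \<ominus> a" using * Ld(2) yc by (metis minus_equality a_comm m_closed)
          then have "r \<in> M" using * Ld(6) M(2) by auto
          then show ?thesis using Mkt * by (simp add: s_def)
        qed
      qed blast
      have "c \<in> rann R L"
        using c mem[of _ \<zero>] Ld(2) yc sc by (force simp: rann_def)
      then have "y \<otimes> c = \<zero>" using y by (simp add: lann_def)
      moreover have "s = y \<otimes> c" using c(2)[OF mem[OF Ld(3) one_closed]] yc sc by simp
      ultimately show False using t(2) by (simp add: s_def)
    qed
  qed
qed

end

section \<open>Corners of semisimple rings\<close>

text \<open>For idempotents this is eRf, which is Hom(Re, Rf) with homomorphisms written as right
  multiplications.\<close>

definition corner :: "('a, 'r) ring_scheme \<Rightarrow> 'a \<Rightarrow> 'a \<Rightarrow> 'a set"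
  where "corner R e f = {x \<in> carrier R. e \<otimes>\<^bsub>R\<^esub> x = x \<and> x \<otimes>\<^bsub>R\<^esub> f = x}"

definition idem :: "('a, 'r) ring_scheme \<Rightarrow> 'a \<Rightarrow> bool"
  where "idem R e \<longleftrightarrow> e \<in> carrier R \<and> e \<otimes>\<^bsub>R\<^esub> e = e"

lemma corner_opp: "corner (opp R) e f = corner R f e"
  by (auto simp: corner_def)

lemma image_eqpoll:
  assumes "\<And>a b. a \<in> C \<Longrightarrow> b \<in> C \<Longrightarrow> f a = f b \<longleftrightarrow> g a = g b"
  shows "f ` C \<approx> g ` C"
proof -
  define h where "h = (\<lambda>y. g (SOME a. a \<in> C \<and> f a = y))"
  have h: "h (f a) = g a" if "a \<in> C" for a
  proof -
    have "(SOME b. b \<in> C \<and> f b = f a) \<in> C \<and> f (SOME b. b \<in> C \<and> f b = f a) = f a"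
      by (rule someI[of _ a]) (use that in simp)
    then show ?thesis using assms[of _ a] that by (auto simp: h_def)
  qed
  have "bij_betw h (f ` C) (g ` C)"
    using h assms by (auto simp: bij_betw_def inj_on_def image_image)
  then show ?thesis by (auto simp: eqpoll_def)
qed

context ring
begin

text \<open>One step of the Peirce decomposition.\<close>

lemma corner_split:
  assumes "idem R e1" "idem R e2" "e1 \<otimes> e2 = \<zero>" "e2 \<otimes> e1 = \<zero>" "f \<in> carrier R"
  shows "corner R f (e1 \<oplus> e2) \<approx> corner R f e1 \<times> corner R f e2"
proof -
  have c: "e1 \<in> carrier R" "e2 \<in> carrier R" "e1 \<otimes> e1 = e1" "e2 \<otimes> e2 = e2"
    using assms by (auto simp: idem_def)
  have "bij_betw (\<lambda>x. (x \<otimes> e1, x \<otimes> e2)) (corner R f (e1 \<oplus> e2)) (corner R f e1 \<times> corner R f e2)"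
  proof (rule bij_betw_byWitness[of _ "\<lambda>(y, z). y \<oplus> z"])
    show "\<forall>x\<in>corner R f (e1 \<oplus> e2). (\<lambda>(y, z). y \<oplus> z) (x \<otimes> e1, x \<otimes> e2) = x"
      using c by (auto simp: corner_def r_distr)
    have orth: "y \<otimes> e2 = \<zero>" "z \<otimes> e1 = \<zero>"
      if "y \<in> corner R f e1" "z \<in> corner R f e2" for y z
    proof -
      have yz: "y \<in> carrier R" "y \<otimes> e1 = y" "z \<in> carrier R" "z \<otimes> e2 = z" using that by (auto simp: corner_def)
      have "y \<otimes> e1 \<otimes> e2 = \<zero>" "z \<otimes> e2 \<otimes> e1 = \<zero>" using yz(1,3) assms(3,4) c by (simp_all add: m_assoc)
      then show "y \<otimes> e2 = \<zero>" "z \<otimes> e1 = \<zero>" unfolding yz(2,4) .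
    qed
    show "\<forall>p\<in>corner R f e1 \<times> corner R f e2. (\<lambda>x. (x \<otimes> e1, x \<otimes> e2)) (case p of (y, z) \<Rightarrow> y \<oplus> z) = p"
    proof
      fix p assume "p \<in> corner R f e1 \<times> corner R f e2"
      then obtain y z where p: "p = (y, z)" and yz: "y \<in> corner R f e1" "z \<in> corner R f e2" by blast
      then have "y \<in> carrier R" "y \<otimes> e1 = y" "z \<in> carrier R" "z \<otimes> e2 = z" by (auto simp: corner_def)
      then show "(\<lambda>x. (x \<otimes> e1, x \<otimes> e2)) (case p of (y, z) \<Rightarrow> y \<oplus> z) = p"
        using orth[OF yz] c p by (simp add: l_distr)
    qed
    show "(\<lambda>x. (x \<otimes> e1, x \<otimes> e2)) ` corner R f (e1 \<oplus> e2) \<subseteq> corner R f e1 \<times> corner R f e2"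
    proof -
      have "f \<otimes> (x \<otimes> e1) = x \<otimes> e1" "f \<otimes> (x \<otimes> e2) = x \<otimes> e2"
        if "x \<in> carrier R" "f \<otimes> x = x" for x using that assms(5) c by (simp_all add: m_assoc[symmetric])
      then show ?thesis using c by (auto simp: corner_def m_assoc)
    qed
    show "(\<lambda>(y, z). y \<oplus> z) ` (corner R f e1 \<times> corner R f e2) \<subseteq> corner R f (e1 \<oplus> e2)"
    proof clarify
      fix y z assume yz: "y \<in> corner R f e1" "z \<in> corner R f e2"
      then have "y \<in> carrier R" "y \<otimes> e1 = y" "z \<in> carrier R" "z \<otimes> e2 = z" "f \<otimes> y = y" "f \<otimes> z = z"
        by (auto simp: corner_def)
      then show "y \<oplus> z \<in> corner R f (e1 \<oplus> e2)"
        using orth[OF yz] c assms(5) by (simp add: corner_def l_distr r_distr)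
    qed
  qed
  then show ?thesis by (auto simp: eqpoll_def)
qed

lemma corner_split':
  assumes "idem R e1" "idem R e2" "e1 \<otimes> e2 = \<zero>" "e2 \<otimes> e1 = \<zero>" "f \<in> carrier R"
  shows "corner R (e1 \<oplus> e2) f \<approx> corner R e1 f \<times> corner R e2 f"
  using ring.corner_split[OF ring_opp, of e1 e2 f] assms by (simp add: corner_opp idem_def)

end

section \<open>Opposite corners of a semisimple ring\<close>

context semisimple_ring
begin

definition simple_idem :: "'a \<Rightarrow> bool"
  where "simple_idem e \<longleftrightarrow> idem R e \<and> (\<forall>L. left_ideal L R \<and> L \<subseteq> lprin R e \<longrightarrow> L = {\<zero>} \<or> L = lprin R e)"

lemma lprin_idem_iff: "idem R e \<Longrightarrow> x \<in> lprin R e \<longleftrightarrow> x \<in> carrier R \<and> x \<otimes> e = x"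
proof
  assume "x \<in> lprin R e" "idem R e"
  then show "x \<in> carrier R \<and> x \<otimes> e = x" by (auto simp: lprin_def idem_def m_assoc)
next
  assume "x \<in> carrier R \<and> x \<otimes> e = x" "idem R e"
  then show "x \<in> lprin R e" unfolding lprin_def by (metis imageI)
qed

text \<open>A right identity \<open>g\<close> of a proper nonzero left ideal inside Re need not be
  fixed by \<open>e\<close> from the left. The product \<open>e \<otimes> g\<close> is fixed on both
  sides and is still a right identity, so it can be subtracted from \<open>e\<close>.\<close>

lemma idem_split:
  assumes e: "idem R e" and ns: "\<not> simple_idem e"
  obtains e1 e2 where "idem R e1" "idem R e2" "e1 \<otimes> e2 = \<zero>" "e2 \<otimes> e1 = \<zero>" "e = e1 \<oplus> e2"
    "lprin R e1 \<subset> lprin R e" "lprin R e2 \<subset> lprin R e"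
proof -
  have ec: "e \<in> carrier R" "e \<otimes> e = e" using e by (auto simp: idem_def)
  obtain L where L: "left_ideal L R" "L \<subseteq> lprin R e" "L \<noteq> {\<zero>}" "L \<noteq> lprin R e"
    using e ns by (auto simp: simple_idem_def)
  note Ld = left_idealD[OF L(1)]
  obtain g where g: "g \<in> L" "\<And>x. x \<in> L \<Longrightarrow> x \<otimes> g = x" using idempotent_generator[OF L(1)] by auto
  have Le: "x \<otimes> e = x" if "x \<in> L" for x using that L(2) lprin_idem_iff[OF e] by auto
  have gc: "g \<in> carrier R" using g Ld by auto
  define e1 where "e1 = e \<otimes> g"
  have e1L: "e1 \<in> L" using Ld(5) ec g by (simp add: e1_def)
  have e1c: "e1 \<in> carrier R" using e1L Ld by auto
  have Le1: "x \<otimes> e1 = x" if "x \<in> L" for x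
    using Le[OF that] g(2)[OF that] Ld(2)[OF that] ec gc by (simp add: e1_def m_assoc[symmetric])
  have ee1: "e \<otimes> e1 = e1" using ec gc by (simp add: e1_def m_assoc[symmetric])
  have e1e: "e1 \<otimes> e = e1" using Le e1L by simp
  have e1e1: "e1 \<otimes> e1 = e1" using Le1 e1L by simp
  define e2 where "e2 = e \<ominus> e1"
  have e2c: "e2 \<in> carrier R" using ec e1c by (simp add: e2_def)
  have 12: "e1 \<otimes> e2 = \<zero>" "e2 \<otimes> e1 = \<zero>"
    using ec e1c e1e e1e1 ee1 by (simp_all add: e2_def r_minus_distr l_minus_distr)
  have e2e: "e2 \<otimes> e = e2" using ec e1c e1e by (simp add: e2_def l_minus_distr)
  have e2e2: "e2 \<otimes> e2 = e2" using 12 e2e e2c ec e1c by (simp add: e2_def r_minus_distr)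
  have "e2 \<oplus> e1 = e" unfolding e2_def using ec(1) e1c by (rule minus_add_cancel)
  then have sum: "e = e1 \<oplus> e2" using a_comm[OF e1c e2c] by simp
  have "e1 \<noteq> \<zero>"
  proof
    assume "e1 = \<zero>"
    have "x = \<zero>" if "x \<in> L" for x using Le1[OF that] Ld(2)[OF that] \<open>e1 = \<zero>\<close> by simp
    then show False using L(3) Ld(3) by blast
  qed
  have "lprin R e1 \<subset> lprin R e"
    using lprin_least[OF L(1) e1L] L(2,4) by auto
  moreover have "lprin R e2 \<subset> lprin R e"
  proof
    show "lprin R e2 \<subseteq> lprin R e"
      using lprin_least[of "lprin R e" e2] e2e e2c ec lprin_idem_iff[OF e] by simp
    show "lprin R e2 \<noteq> lprin R e"
    proof
      assume "lprin R e2 = lprin R e"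
      then have "e \<in> lprin R e2" using lprin_self ec by simp
      then obtain r where "r \<in> carrier R" "e = r \<otimes> e2" by (auto simp: lprin_def)
      then have "e \<otimes> e1 = \<zero>" using 12 e2c e1c by (simp add: m_assoc)
      then show False using ee1 \<open>e1 \<noteq> \<zero>\<close> by simp
    qed
  qed
  ultimately show thesis using that[of e1 e2] e1c e2c e1e1 e2e2 12 sum by (auto simp: idem_def)
qed

text \<open>Schur's lemma: a nonzero \<open>a\<close> in eRf is an isomorphism of the simple modules
  Re and Rf, with an inverse \<open>b\<close> in fRe. Multiplying by \<open>b\<close> on both sides
  carries one corner onto the other.\<close>

lemma corner_simple_eqpoll_aux:
  assumes e: "simple_idem e" and f: "simple_idem f" and a: "a \<in> corner R e f" "a \<noteq> \<zero>"
  shows "corner R e f \<approx> corner R f e"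
proof -
  have ei: "idem R e" and fi: "idem R f" using e f by (auto simp: simple_idem_def)
  have c: "e \<in> carrier R" "e \<otimes> e = e" "f \<in> carrier R" "f \<otimes> f = f" "a \<in> carrier R" "e \<otimes> a = a" "a \<otimes> f = a"
    using ei fi a by (auto simp: idem_def corner_def)
  have "lprin R a \<subseteq> lprin R f" using lprin_least[of "lprin R f" a] c lprin_idem_iff[OF fi] by simp
  moreover have "lprin R a \<noteq> {\<zero>}" using lprin_self[of a] a c by auto
  ultimately have "lprin R a = lprin R f" using f c left_ideal_lprin unfolding simple_idem_def by blast
  then have "f \<in> lprin R a" using lprin_self c by simp
  then obtain b' where b': "b' \<in> carrier R" "f = b' \<otimes> a" by (auto simp: lprin_def)
  define b where "b = f \<otimes> b' \<otimes> e"
  have bc: "b \<in> carrier R" using b'(1) c by (simp add: b_def)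
  have "b \<otimes> a = f \<otimes> (b' \<otimes> a)" using b'(1) c by (simp add: b_def m_assoc)
  then have ba: "b \<otimes> a = f" using b'(2)[symmetric] c by simp
  have fb: "f \<otimes> b = b" "b \<otimes> e = b"
    using b'(1) c by (simp_all add: b_def m_assoc) (simp add: m_assoc[symmetric])
  have abab: "(a \<otimes> b) \<otimes> (a \<otimes> b) = a \<otimes> b" using ba fb bc c by (metis m_assoc m_closed)
  have "a \<otimes> b \<noteq> \<zero>"
  proof
    assume "a \<otimes> b = \<zero>"
    then have "a \<otimes> (b \<otimes> a) = \<zero>" using bc c by (simp add: m_assoc[symmetric])
    then show False using ba c a by simp
  qed
  moreover have abe: "a \<otimes> b \<otimes> e = a \<otimes> b" using fb bc c by (simp add: m_assoc)
  ultimately have "lprin R (a \<otimes> b) = lprin R e"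
    using e lprin_least[of "lprin R e" "a \<otimes> b"] lprin_idem_iff[OF ei] bc c lprin_self[of "a \<otimes> b"]
      left_ideal_lprin[of "a \<otimes> b"] left_ideal_lprin[of e]
    unfolding simple_idem_def by (metis m_closed singletonD)
  then have "e \<in> lprin R (a \<otimes> b)" using lprin_self c by simp
  then obtain r where r: "r \<in> carrier R" "e = r \<otimes> (a \<otimes> b)" by (auto simp: lprin_def)
  have "e \<otimes> (a \<otimes> b) = r \<otimes> ((a \<otimes> b) \<otimes> (a \<otimes> b))" unfolding r(2) using r(1) bc c by (simp add: m_assoc)
  also have "\<dots> = e" unfolding abab using r(2) by simp
  finally have ab: "a \<otimes> b = e" using bc c by (simp add: m_assoc[symmetric])
  have "bij_betw (\<lambda>x. b \<otimes> x \<otimes> b) (corner R e f) (corner R f e)"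
  proof (rule bij_betw_byWitness[of _ "\<lambda>y. a \<otimes> y \<otimes> a"])
    show "\<forall>x\<in>corner R e f. a \<otimes> (b \<otimes> x \<otimes> b) \<otimes> a = x"
    proof
      fix x assume "x \<in> corner R e f"
      then have x: "x \<in> carrier R" "e \<otimes> x = x" "x \<otimes> f = x" by (auto simp: corner_def)
      have "a \<otimes> (b \<otimes> x \<otimes> b) \<otimes> a = (a \<otimes> b) \<otimes> x \<otimes> (b \<otimes> a)" using x(1) c(5) bc by (simp add: m_assoc)
      then show "a \<otimes> (b \<otimes> x \<otimes> b) \<otimes> a = x" using ab ba x by simp
    qed
    show "\<forall>y\<in>corner R f e. b \<otimes> (a \<otimes> y \<otimes> a) \<otimes> b = y"
    proof
      fix y assume "y \<in> corner R f e"
      then have y: "y \<in> carrier R" "f \<otimes> y = y" "y \<otimes> e = y" by (auto simp: corner_def)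
      have "b \<otimes> (a \<otimes> y \<otimes> a) \<otimes> b = (b \<otimes> a) \<otimes> y \<otimes> (a \<otimes> b)" using y(1) c(5) bc by (simp add: m_assoc)
      then show "b \<otimes> (a \<otimes> y \<otimes> a) \<otimes> b = y" using ab ba y by simp
    qed
    have "f \<otimes> (b \<otimes> x \<otimes> b) = b \<otimes> x \<otimes> b" if "x \<in> carrier R" for x
      using that fb bc c by (simp add: m_assoc[symmetric])
    then show "(\<lambda>x. b \<otimes> x \<otimes> b) ` corner R e f \<subseteq> corner R f e"
      using fb bc c by (auto simp: corner_def m_assoc)
    have "e \<otimes> (a \<otimes> y \<otimes> a) = a \<otimes> y \<otimes> a" if "y \<in> carrier R" for y
      using that c by (simp add: m_assoc[symmetric])
    then show "(\<lambda>y. a \<otimes> y \<otimes> a) ` corner R f e \<subseteq> corner R e f"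
      using bc c by (auto simp: corner_def m_assoc)
  qed
  then show ?thesis by (auto simp: eqpoll_def)
qed

lemma corner_simple_eqpoll:
  assumes e: "simple_idem e" and f: "simple_idem f"
  shows "corner R e f \<approx> corner R f e"
proof (cases "corner R e f \<subseteq> {\<zero>} \<and> corner R f e \<subseteq> {\<zero>}")
  case True
  have "\<zero> \<in> corner R e f" "\<zero> \<in> corner R f e" using e f by (auto simp: corner_def simple_idem_def idem_def)
  then have "corner R e f = corner R f e" using True by auto
  then show ?thesis by simp
next
  case False
  then show ?thesis
    using corner_simple_eqpoll_aux[OF e f] corner_simple_eqpoll_aux[OF f e] eqpoll_sym by blast
qed

text \<open>Both corners are multiplicative under orthogonal splitting of either idempotent, so a
  double well-founded induction reduces the claim to simple idempotents.\<close>

lemma corner_eqpoll: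
  assumes "idem R e" "idem R f"
  shows "corner R e f \<approx> corner R f e"
proof -
  let ?W = "inv_image {(I, J). left_ideal I R \<and> left_ideal J R \<and> I \<subset> J} (lprin R)"
  have wf: "wf ?W" using left_artinian_wf[OF artinian] by simp
  have comb: "corner R (a1 \<oplus> a2) b \<approx> corner R b (a1 \<oplus> a2)"
    if "idem R a1" "idem R a2" "a1 \<otimes> a2 = \<zero>" "a2 \<otimes> a1 = \<zero>" "idem R b"
      "corner R a1 b \<approx> corner R b a1" "corner R a2 b \<approx> corner R b a2" for a1 a2 b
  proof -
    have b: "b \<in> carrier R" using that(5) by (simp add: idem_def)
    have "corner R (a1 \<oplus> a2) b \<approx> corner R a1 b \<times> corner R a2 b" using corner_split'[OF that(1-4) b] .
    also have "\<dots> \<approx> corner R b a1 \<times> corner R b a2" using that(6,7) by (rule times_eqpoll_cong)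
    also have "\<dots> \<approx> corner R b (a1 \<oplus> a2)" using corner_split[OF that(1-4) b] by (rule eqpoll_sym)
    finally show ?thesis .
  qed
  have "idem R e \<longrightarrow> (\<forall>f. idem R f \<longrightarrow> corner R e f \<approx> corner R f e)"
  proof (rule wf_induct_rule[OF wf, of _ e])
    fix e assume IH: "\<And>e'. (e', e) \<in> ?W \<Longrightarrow> idem R e' \<longrightarrow> (\<forall>f. idem R f \<longrightarrow> corner R e' f \<approx> corner R f e')"
    show "idem R e \<longrightarrow> (\<forall>f. idem R f \<longrightarrow> corner R e f \<approx> corner R f e)"
    proof (intro impI allI)
      fix f assume e: "idem R e" and f: "idem R f"
      show "corner R e f \<approx> corner R f e"
      proof (cases "simple_idem e")
        case False
        obtain e1 e2 where s: "idem R e1" "idem R e2" "e1 \<otimes> e2 = \<zero>" "e2 \<otimes> e1 = \<zero>" "e = e1 \<oplus> e2"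
          "lprin R e1 \<subset> lprin R e" "lprin R e2 \<subset> lprin R e" using idem_split[OF e False] .
        have "(e1, e) \<in> ?W" "(e2, e) \<in> ?W" using s e by (auto simp: idem_def)
        then show ?thesis unfolding s(5) using comb[OF s(1-4) f] IH s(1,2) f s(5) by blast
      next
        case True
        have "idem R f \<longrightarrow> corner R e f \<approx> corner R f e"
        proof (rule wf_induct_rule[OF wf, of _ f])
          fix f assume IH': "\<And>f'. (f', f) \<in> ?W \<Longrightarrow> idem R f' \<longrightarrow> corner R e f' \<approx> corner R f' e"
          show "idem R f \<longrightarrow> corner R e f \<approx> corner R f e"
          proof
            assume f: "idem R f"
            show "corner R e f \<approx> corner R f e"
            proof (cases "simple_idem f")
              case True
              then show ?thesis using corner_simple_eqpoll \<open>simple_idem e\<close> by blast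
            next
              case False
              obtain e1 e2 where s: "idem R e1" "idem R e2" "e1 \<otimes> e2 = \<zero>" "e2 \<otimes> e1 = \<zero>" "f = e1 \<oplus> e2"
                "lprin R e1 \<subset> lprin R f" "lprin R e2 \<subset> lprin R f" using idem_split[OF f False] .
              have W: "(e1, f) \<in> ?W" "(e2, f) \<in> ?W" using s f by (auto simp: idem_def)
              have "corner R e1 e \<approx> corner R e e1" "corner R e2 e \<approx> corner R e e2"
                using IH'[OF W(1)] IH'[OF W(2)] s(1,2) eqpoll_sym by blast+
              then show ?thesis unfolding s(5) using comb[OF s(1-4) e] eqpoll_sym by blast
            qed
          qed
        qed
        then show ?thesis using f by blast
      qed
    qed
  qed
  then show ?thesis using assms by blast
qed

text \<open>Let \<open>e\<close> be an idempotent generating Ry. Then Ry = Re and eR are the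
  opposite corners for \<open>\<one>\<close> and \<open>e\<close>, and eR corresponds to yR through
  eu \<mapsto> yu, since y = ye and \<open>e\<close> is a left multiple of \<open>y\<close>.\<close>

lemma lprin_eqpoll_rprin:
  assumes y: "y \<in> carrier R"
  shows "lprin R y \<approx> rprin R y"
proof -
  obtain e where e: "e \<in> lprin R y" "\<And>x. x \<in> lprin R y \<Longrightarrow> x \<otimes> e = x"
    using idempotent_generator[OF left_ideal_lprin[OF y]] by auto
  have ye: "y \<otimes> e = y" using e lprin_self[OF y] by auto
  obtain b where b: "b \<in> carrier R" "e = b \<otimes> y" using e by (auto simp: lprin_def)
  have ec: "e \<in> carrier R" using b y by simp
  have ei: "idem R e" using e ec by (simp add: idem_def)
  have oi: "idem R \<one>" by (simp add: idem_def)
  have "lprin R y = lprin R e"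
  proof
    show "lprin R e \<subseteq> lprin R y" using lprin_least e(1) y by simp
    show "lprin R y \<subseteq> lprin R e" using lprin_least[of "lprin R e" y] ec ye y lprin_idem_iff[OF ei] by simp
  qed
  also have "\<dots> = corner R \<one> e" using lprin_idem_iff[OF ei] by (auto simp: corner_def)
  also have "\<dots> \<approx> corner R e \<one>" using corner_eqpoll[OF oi ei] .
  also have "corner R e \<one> = (\<lambda>z. e \<otimes> z) ` carrier R"
  proof
    show "corner R e \<one> \<subseteq> (\<lambda>z. e \<otimes> z) ` carrier R" by (auto simp: corner_def image_iff) (metis)
    show "(\<lambda>z. e \<otimes> z) ` carrier R \<subseteq> corner R e \<one>"
      using ec ei by (auto simp: corner_def idem_def m_assoc[symmetric])
  qed
  also have "\<dots> \<approx> (\<lambda>z. y \<otimes> z) ` carrier R"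
  proof (rule image_eqpoll)
    fix u v assume uv: "u \<in> carrier R" "v \<in> carrier R"
    show "e \<otimes> u = e \<otimes> v \<longleftrightarrow> y \<otimes> u = y \<otimes> v"
    proof
      assume "e \<otimes> u = e \<otimes> v"
      then have "y \<otimes> e \<otimes> u = y \<otimes> e \<otimes> v" using uv y ec by (simp add: m_assoc)
      then show "y \<otimes> u = y \<otimes> v" using ye by simp
    next
      assume "y \<otimes> u = y \<otimes> v"
      then show "e \<otimes> u = e \<otimes> v" using uv y b(1) unfolding b(2) by (simp add: m_assoc)
    qed
  qed
  finally show ?thesis by (simp add: rprin_def)
qed

end

section \<open>Relations between indicator functions of subgroups\<close>

context abelian_group
begin

definition asub :: "'a set \<Rightarrow> bool"
  where "asub K \<longleftrightarrow> K \<subseteq> carrier G \<and> \<zero> \<in> K \<and> (\<forall>x\<in>K. \<forall>y\<in>K. x \<ominus> y \<in> K)"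

text \<open>For subgroups this says that \<open>K \<inter> L\<close> has finite index in
  \<open>K\<close>. It is phrased as a covering by cosets of \<open>L\<close> whose representatives
  may lie outside \<open>K\<close>, which makes transitivity direct and fits
  \<open>neumann\<close>.\<close>

definition almost_in :: "'a set \<Rightarrow> 'a set \<Rightarrow> bool"
  where "almost_in K L \<longleftrightarrow> (\<exists>F. finite F \<and> F \<subseteq> carrier G \<and> (\<forall>x\<in>K. \<exists>f\<in>F. x \<ominus> f \<in> L))"

lemma asubD:
  assumes "asub K"
  shows "K \<subseteq> carrier G" "x \<in> K \<Longrightarrow> x \<in> carrier G" "\<zero> \<in> K" "x \<in> K \<Longrightarrow> y \<in> K \<Longrightarrow> x \<ominus> y \<in> K"
    "x \<in> K \<Longrightarrow> y \<in> K \<Longrightarrow> x \<oplus> y \<in> K"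
proof -
  show d: "\<And>x y. x \<in> K \<Longrightarrow> y \<in> K \<Longrightarrow> x \<ominus> y \<in> K" and K: "K \<subseteq> carrier G" and z: "\<zero> \<in> K"
    using assms by (auto simp: asub_def)
  show "x \<in> K \<Longrightarrow> x \<in> carrier G" using K by auto
  assume xy: "x \<in> K" "y \<in> K"
  have "x \<ominus> (\<zero> \<ominus> y) \<in> K" using d z xy by blast
  moreover have "x \<ominus> (\<zero> \<ominus> y) = x \<oplus> y" using xy K by (simp add: minus_eq subset_iff)
  ultimately show "x \<oplus> y \<in> K" by simp
qed

lemma asub_Int: "asub K \<Longrightarrow> asub L \<Longrightarrow> asub (K \<inter> L)"
  by (auto simp: asub_def)

lemma almost_in_refl: "asub K \<Longrightarrow> almost_in K K"
  unfolding almost_in_def by (intro exI[of _ "{\<zero>}"]) (auto simp: asub_def minus_eq subset_iff)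

lemma diff_diff: "x \<in> carrier G \<Longrightarrow> f \<in> carrier G \<Longrightarrow> g \<in> carrier G \<Longrightarrow> (x \<ominus> f) \<ominus> g = x \<ominus> (f \<oplus> g)"
  by (simp add: minus_eq minus_add a_assoc)

lemma almost_in_trans:
  assumes "almost_in K L" "almost_in L M" "K \<subseteq> carrier G"
  shows "almost_in K M"
proof -
  obtain F where F: "finite F" "F \<subseteq> carrier G" "\<forall>x\<in>K. \<exists>f\<in>F. x \<ominus> f \<in> L"
    using assms(1) by (auto simp: almost_in_def)
  obtain F' where F': "finite F'" "F' \<subseteq> carrier G" "\<forall>x\<in>L. \<exists>f\<in>F'. x \<ominus> f \<in> M"
    using assms(2) by (auto simp: almost_in_def)
  have "\<exists>f\<in>(\<lambda>(f, g). f \<oplus> g) ` (F \<times> F'). x \<ominus> f \<in> M" if x: "x \<in> K" for x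
  proof -
    obtain f where f: "f \<in> F" "x \<ominus> f \<in> L" using F x by blast
    obtain g where g: "g \<in> F'" "(x \<ominus> f) \<ominus> g \<in> M" using F' f by blast
    have "x \<in> carrier G" "f \<in> carrier G" "g \<in> carrier G" using x f g assms(3) F(2) F'(2) by blast+
    then have "x \<ominus> (f \<oplus> g) \<in> M" using diff_diff[of x f g] g(2) by simp
    then show ?thesis using f g by force
  qed
  then show ?thesis unfolding almost_in_def using F F'
    by (intro exI[of _ "(\<lambda>(f, g). f \<oplus> g) ` (F \<times> F')"]) auto
qed

lemma sub_cong_trans:
  assumes "asub L" "x \<in> carrier G" "y \<in> carrier G" "z \<in> carrier G" "x \<ominus> z \<in> L" "y \<ominus> z \<in> L"
  shows "x \<ominus> y \<in> L"
proof -
  have "(x \<ominus> z) \<ominus> (y \<ominus> z) \<in> L" using assms asubD(4) by blast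
  moreover have "(x \<ominus> z) \<ominus> (y \<ominus> z) = x \<ominus> y"
    using assms(2-4) by (simp add: minus_eq minus_add a_assoc) (simp add: a_lcomm[of "\<ominus> z"] r_neg l_neg)
  ultimately show ?thesis by simp
qed

lemma almost_in_Int:
  assumes "asub A" "asub B" "K \<subseteq> carrier G" "almost_in K A" "almost_in K B"
  shows "almost_in K (A \<inter> B)"
proof -
  obtain F where F: "finite F" "F \<subseteq> carrier G" "\<forall>x\<in>K. \<exists>f\<in>F. x \<ominus> f \<in> A"
    using assms(4) by (auto simp: almost_in_def)
  obtain F' where F': "finite F'" "F' \<subseteq> carrier G" "\<forall>x\<in>K. \<exists>f\<in>F'. x \<ominus> f \<in> B"
    using assms(5) by (auto simp: almost_in_def)
  \<comment> \<open>A representative inside \<open>K\<close> for each pair of cosets that meet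
    within \<open>K\<close>. For other pairs the choice is arbitrary, and the intersection with the
    carrier removes values outside the group.\<close>
  define q where "q = (\<lambda>(f, g). SOME x. x \<in> K \<and> x \<ominus> f \<in> A \<and> x \<ominus> g \<in> B)"
  have "\<exists>f\<in>q ` (F \<times> F') \<inter> carrier G. x \<ominus> f \<in> A \<inter> B" if x: "x \<in> K" for x
  proof -
    obtain f g where fg: "f \<in> F" "x \<ominus> f \<in> A" "g \<in> F'" "x \<ominus> g \<in> B" using F F' x by blast
    have "q (f, g) \<in> K \<and> q (f, g) \<ominus> f \<in> A \<and> q (f, g) \<ominus> g \<in> B"
      unfolding q_def prod.case by (rule someI[of _ x]) (use fg x in blast)
    then have q: "q (f, g) \<in> K" "q (f, g) \<ominus> f \<in> A" "q (f, g) \<ominus> g \<in> B" by auto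
    have "x \<ominus> q (f, g) \<in> A" "x \<ominus> q (f, g) \<in> B"
      using sub_cong_trans[OF assms(1) _ _ _ fg(2) q(2)] sub_cong_trans[OF assms(2) _ _ _ fg(4) q(3)]
        x q(1) assms(3) F(2) F'(2) fg by auto
    then show ?thesis using fg q(1) assms(3) by blast
  qed
  then show ?thesis unfolding almost_in_def using F(1) F'(1)
    by (intro exI[of _ "q ` (F \<times> F') \<inter> carrier G"]) auto
qed

text \<open>B. H. Neumann: in a finite covering by cosets, the subgroups of infinite index are redundant.\<close>

lemma neumann:
  assumes "finite \<H>" "\<And>H. H \<in> \<H> \<Longrightarrow> asub H" "asub P"
    and "finite F" "F \<subseteq> carrier G" "\<forall>x\<in>P. \<exists>H\<in>\<H>. \<exists>f\<in>F. x \<ominus> f \<in> H"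
  shows "\<exists>H\<in>\<H>. almost_in P H"
  using assms(1,2,4-)
proof (induction \<H> arbitrary: F rule: finite_induct)
  case empty
  then show ?case using asubD(3)[OF assms(3)] by blast
next
  case (insert H \<H>)
  note Pd = asubD[OF assms(3)]
  have Hs: "asub H" using insert.prems by blast
  note Hd = asubD[OF Hs]
  show ?case
  proof (cases "\<forall>x\<in>P. \<exists>f\<in>F. x \<ominus> f \<in> H")
    case True
    then have "almost_in P H" using insert.prems by (auto simp: almost_in_def)
    then show ?thesis by blast
  next
    case False
    then obtain c where c: "c \<in> P" "\<And>f. f \<in> F \<Longrightarrow> c \<ominus> f \<notin> H" by blast
    define q where "q = (\<lambda>f. SOME x. x \<in> P \<and> x \<ominus> f \<in> H)"
    \<comment> \<open>The \<open>H\<close>-coset of \<open>c\<close> avoids all cosets of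
      \<open>H\<close> in the covering, so its part in \<open>P\<close> is covered by cosets of the
      other subgroups. Translating by \<open>q f \<ominus> c\<close> transfers this covering to the
      coset of \<open>f\<close>, so each coset of \<open>H\<close> can be replaced.\<close>
    define F' where "F' = F \<union> ((\<lambda>(f, g). (q f \<ominus> c) \<oplus> g) ` (F \<times> F) \<inter> carrier G)"
    have "\<exists>H\<in>\<H>. \<exists>f\<in>F'. x \<ominus> f \<in> H" if x: "x \<in> P" for x
    proof (cases "\<exists>H\<in>\<H>. \<exists>f\<in>F. x \<ominus> f \<in> H")
      case True
      then show ?thesis by (auto simp: F'_def)
    next
      case False
      then obtain f where f: "f \<in> F" "x \<ominus> f \<in> H" using insert.prems(4) x by blast
      have "q f \<in> P \<and> q f \<ominus> f \<in> H" unfolding q_def by (rule someI[of _ x]) (use f x in blast)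
      then have q: "q f \<in> P" "q f \<ominus> f \<in> H" by auto
      have cc: "x \<in> carrier G" "q f \<in> carrier G" "f \<in> carrier G" "c \<in> carrier G"
        using x q c f Pd insert.prems by auto
      have xq: "x \<ominus> q f \<in> H" using sub_cong_trans[OF Hs cc(1,2,3) f(2) q(2)] .
      define y where "y = c \<oplus> (x \<ominus> q f)"
      have yP: "y \<in> P" using Pd c x q by (simp add: y_def)
      then have yc: "y \<in> carrier G" using Pd by auto
      have "y \<ominus> g \<notin> H" if g: "g \<in> F" for g
      proof
        assume yg: "y \<ominus> g \<in> H"
        have gc: "g \<in> carrier G" using g insert.prems by auto
        have "(y \<ominus> g) \<ominus> (x \<ominus> q f) \<in> H" using Hd(4) yg xq by blast
        moreover have "(y \<ominus> g) \<ominus> (x \<ominus> q f) = c \<ominus> g"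
        proof -
          have "\<And>a b d. a \<in> carrier G \<Longrightarrow> b \<in> carrier G \<Longrightarrow> d \<in> carrier G \<Longrightarrow> ((a \<oplus> b) \<ominus> d) \<ominus> b = a \<ominus> d"
          proof -
            fix a b d assume "a \<in> carrier G" "b \<in> carrier G" "d \<in> carrier G"
            then show "((a \<oplus> b) \<ominus> d) \<ominus> b = a \<ominus> d"
              using a_comm[of "\<ominus> d" "\<ominus> b"] by (simp add: minus_eq a_assoc r_neg2)
          qed
          then show ?thesis using cc gc by (simp add: y_def)
        qed
        ultimately show False using c(2)[OF g] by simp
      qed
      then obtain H' g where g: "H' \<in> \<H>" "g \<in> F" "y \<ominus> g \<in> H'" using insert.prems(4) yP by blast
      have gc: "g \<in> carrier G" using g insert.prems by auto
      have "y \<ominus> g = x \<ominus> ((q f \<ominus> c) \<oplus> g)"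
        using cc gc by (simp add: y_def minus_eq minus_add) (simp add: a_ac)
      then have "x \<ominus> ((q f \<ominus> c) \<oplus> g) \<in> H'" using g by simp
      moreover have "(q f \<ominus> c) \<oplus> g \<in> F'" using f g cc gc by (auto simp: F'_def)
      ultimately show ?thesis using g by blast
    qed
    moreover have "finite F'" "F' \<subseteq> carrier G" using insert.prems by (auto simp: F'_def)
    ultimately show ?thesis using insert.IH[of F'] insert.prems(1) by blast
  qed
qed

lemma transversal:
  assumes K: "asub K" and P: "asub P" "P \<subseteq> K" and fin: "almost_in K P"
  shows "\<exists>F. finite F \<and> F \<subseteq> K \<and> (\<forall>x\<in>K. \<exists>!f. f \<in> F \<and> x \<ominus> f \<in> P)"
proof -
  note Kd = asubD[OF K] and Pd = asubD[OF P(1)]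
  obtain F0 where F0: "finite F0" "F0 \<subseteq> carrier G" "\<forall>x\<in>K. \<exists>f\<in>F0. x \<ominus> f \<in> P"
    using fin by (auto simp: almost_in_def)
  define rep where "rep = (\<lambda>x. SOME y. y \<in> K \<and> x \<ominus> y \<in> P)"
  have neg: "y \<ominus> x \<in> P" if "x \<in> carrier G" "y \<in> carrier G" "x \<ominus> y \<in> P" for x y
  proof -
    have "\<zero> \<ominus> (x \<ominus> y) \<in> P" using Pd that by blast
    moreover have "\<zero> \<ominus> (x \<ominus> y) = y \<ominus> x" using that by (simp add: minus_eq minus_add a_comm)
    ultimately show ?thesis by simp
  qed
  have tr: "x \<ominus> z \<in> P" if "x \<in> carrier G" "y \<in> carrier G" "z \<in> carrier G" "x \<ominus> y \<in> P" "y \<ominus> z \<in> P" for x y z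
    using sub_cong_trans[OF P(1) that(1,3,2,4)] neg that by blast
  have rep: "rep x \<in> K" "x \<ominus> rep x \<in> P" if x: "x \<in> K" for x
  proof -
    have "x \<ominus> x = \<zero>" using Kd x by (simp add: minus_eq r_neg)
    then have "x \<in> K \<and> x \<ominus> x \<in> P" using x Pd(3) by simp
    then have "rep x \<in> K \<and> x \<ominus> rep x \<in> P"
      unfolding rep_def by (rule someI)
    then show "rep x \<in> K" "x \<ominus> rep x \<in> P" by auto
  qed
  have rep_eq: "rep x = rep y" if "x \<in> K" "y \<in> K" "x \<ominus> y \<in> P" for x y
  proof -
    have "x \<ominus> z \<in> P \<longleftrightarrow> y \<ominus> z \<in> P" if "z \<in> K" for z
      using tr[of x y z] tr[of y x z] neg[of x y] that \<open>x \<in> K\<close> \<open>y \<in> K\<close> \<open>x \<ominus> y \<in> P\<close> Kd(2) by blast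
    then have "(\<lambda>z. z \<in> K \<and> x \<ominus> z \<in> P) = (\<lambda>z. z \<in> K \<and> y \<ominus> z \<in> P)" by blast
    then show ?thesis by (simp add: rep_def)
  qed
  show ?thesis
  proof (intro exI[of _ "rep ` K"] conjI ballI)
    define g where "g = (\<lambda>x. SOME f. f \<in> F0 \<and> x \<ominus> f \<in> P)"
    have g: "g x \<in> F0 \<and> x \<ominus> g x \<in> P" if "x \<in> K" for x
      unfolding g_def by (rule someI_ex) (use F0 that in blast)
    have "rep x = rep (SOME y. y \<in> K \<and> g y = g x)" if x: "x \<in> K" for x
    proof -
      have "(SOME y. y \<in> K \<and> g y = g x) \<in> K \<and> g (SOME y. y \<in> K \<and> g y = g x) = g x"
        by (rule someI[of _ x]) (use x in blast)
      then obtain y where y: "y = (SOME y. y \<in> K \<and> g y = g x)" "y \<in> K" "g y = g x" by blast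
      have "y \<ominus> g x \<in> P" using g[OF y(2)] y(3) by simp
      then have "x \<ominus> y \<in> P" using sub_cong_trans[OF P(1), of x y "g x"] g x y(2) F0(2) Kd(2) by blast
      then show ?thesis using rep_eq x y(1,2) by simp
    qed
    then have "rep ` K \<subseteq> (\<lambda>f. rep (SOME y. y \<in> K \<and> g y = f)) ` F0" using g by blast
    then show "finite (rep ` K)" using F0(1) finite_surj by blast
    show "rep ` K \<subseteq> K" using rep by blast
    fix x assume x: "x \<in> K"
    show "\<exists>!f. f \<in> rep ` K \<and> x \<ominus> f \<in> P"
    proof (rule ex1I[of _ "rep x"])
      show "rep x \<in> rep ` K \<and> x \<ominus> rep x \<in> P" using rep x by blast
      fix f assume f: "f \<in> rep ` K \<and> x \<ominus> f \<in> P"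
      then obtain y where y: "y \<in> K" "f = rep y" by blast
      have "y \<ominus> f \<in> P" using rep y by simp
      then have "x \<ominus> y \<in> P" using f sub_cong_trans[OF P(1), of x y f] tr[of x f y] neg[of y f] x y rep Kd(2) by blast
      then show "f = rep x" using rep_eq x y by simp
    qed
  qed
qed

lemma asub_Inter:
  assumes "finite \<F>" "\<F> \<noteq> {}" "\<And>L. L \<in> \<F> \<Longrightarrow> asub L \<and> almost_in K L" "K \<subseteq> carrier G"
  shows "asub (\<Inter>\<F>) \<and> almost_in K (\<Inter>\<F>)"
  using assms(1-3)
proof (induction \<F> rule: finite_ne_induct)
  case (insert L \<F>)
  then show ?case using asub_Int[of L "\<Inter>\<F>"] almost_in_Int[OF _ _ assms(4), of L "\<Inter>\<F>"] by auto
qed auto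

text \<open>A linear relation between indicator functions of subgroups is first restricted to one
  commensurability class and then averaged over a subgroup \<open>K0\<close> that is minimal in that class.\<close>

lemma indicator_reduction:
  assumes fin: "finite \<K>" and sub: "\<And>K. K \<in> \<K> \<Longrightarrow> asub K" and ne: "\<K> \<noteq> {}"
    and sum: "\<And>x. x \<in> carrier G \<Longrightarrow> (\<Sum>K\<in>\<K>. h K * (if x \<in> K then 1 else 0 :: real)) = 0"
  obtains K0 \<F> n where "K0 \<in> \<F>" "\<F> \<subseteq> \<K>" "\<And>K. K \<in> \<F> \<Longrightarrow> (n K :: real) > 0"
    "\<And>K. K \<in> \<F> \<Longrightarrow> almost_in K K0" "\<And>K. K \<in> \<F> \<Longrightarrow> K \<subseteq> K0 \<Longrightarrow> K = K0"
    "\<And>x. x \<in> carrier G \<Longrightarrow> (\<Sum>K\<in>\<F>. h K * n K * (if \<exists>k\<in>K. x \<ominus> k \<in> K0 then 1 else 0)) = 0"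
proof -
  have subc: "K \<subseteq> carrier G" if "K \<in> \<K>" for K using sub[OF that] asubD(1) by blast
  \<comment> \<open>A subgroup with the most members almost inside it is maximal for the preorder
    \<open>almost_in\<close>. The members in which it is almost contained then form one
    commensurability class.\<close>
  define f where "f = (\<lambda>K. card {L \<in> \<K>. almost_in L K})"
  have "Max (f ` \<K>) \<in> f ` \<K>" using fin ne by simp
  then obtain k where k: "k \<in> \<K>" "f k = Max (f ` \<K>)" by force
  have kmax: "f L \<le> f k" if "L \<in> \<K>" for L using that fin k(2) by simp
  have absorb: "almost_in L k" if L: "L \<in> \<K>" "almost_in k L" for L
  proof (rule ccontr)
    assume n: "\<not> almost_in L k"
    have "{M \<in> \<K>. almost_in M k} \<subseteq> {M \<in> \<K>. almost_in M L}"
      using almost_in_trans[OF _ L(2)] subc by blast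
    moreover have "L \<in> {M \<in> \<K>. almost_in M L}" "L \<notin> {M \<in> \<K>. almost_in M k}"
      using n L(1) almost_in_refl sub by auto
    ultimately have "{M \<in> \<K>. almost_in M k} \<subset> {M \<in> \<K>. almost_in M L}" by blast
    then have "f k < f L" unfolding f_def using fin by (intro psubset_card_mono) auto
    then show False using kmax[OF L(1)] by simp
  qed
  let ?C = "{K \<in> \<K>. almost_in k K}"
  have finC: "finite ?C" using fin by simp
  have neC: "?C \<noteq> {}" using k(1) almost_in_refl sub by blast
  obtain K0 where K0: "K0 \<in> ?C" "\<forall>K\<in>?C. K \<subseteq> K0 \<longrightarrow> K0 = K"
    using finite_has_minimal[OF finC neC] by (rule bexE)
  have K0k: "K0 \<in> \<K>" "almost_in k K0" using K0(1) by auto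
  have K0s: "asub K0" using sub K0k by blast
  note K0d = asubD[OF K0s]
  define \<F> where "\<F> = {K \<in> \<K>. almost_in K0 K}"
  have finF: "finite \<F>" using fin by (simp add: \<F>_def)
  have Fk: "almost_in k K" if "K \<in> \<F>" for K
    using almost_in_trans[OF K0k(2) _ subc[OF k(1)]] that by (auto simp: \<F>_def)
  have K0F: "K0 \<in> \<F>" using K0k(1) almost_in_refl[OF K0s] by (simp add: \<F>_def)
  define P where "P = \<Inter>\<F>"
  have P: "asub P" "almost_in K0 P"
    using asub_Inter[OF finF, of K0] K0F sub K0d(1) unfolding P_def \<F>_def by blast+
  have PF: "P \<subseteq> K" if "K \<in> \<F>" for K using that by (auto simp: P_def)
  note Pd = asubD[OF P(1)]
  have shift: "x \<oplus> p \<in> K \<longleftrightarrow> x \<in> K" if "asub K" "p \<in> K" "x \<in> carrier G" for K x p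
  proof
    assume "x \<oplus> p \<in> K"
    then have "(x \<oplus> p) \<ominus> p \<in> K" using asubD(4) that by blast
    moreover have "(x \<oplus> p) \<ominus> p = x" using that asubD(2)[OF that(1,2)] by (simp add: minus_eq a_assoc r_neg)
    ultimately show "x \<in> K" by simp
  qed (use asubD(5) that in blast)
  \<comment> \<open>Members outside \<open>\<F>\<close> drop out: if their translates covered
    \<open>P\<close>, then \<open>P\<close>, and with it \<open>K0\<close>, would be almost inside
    one of them by \<open>neumann\<close>. So some shift of \<open>y\<close> by an element of
    \<open>P\<close> misses them all, and such a shift changes no membership in a subgroup from
    \<open>\<F>\<close>.\<close>
  have sumF: "(\<Sum>K\<in>\<F>. h K * (if y \<in> K then 1 else 0)) = 0" if y: "y \<in> carrier G" for y
  proof -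
    have "\<exists>p\<in>P. \<forall>K\<in>\<K> - \<F>. y \<oplus> p \<notin> K"
    proof (rule ccontr)
      assume n: "\<not> ?thesis"
      have "\<exists>H\<in>\<K> - \<F>. \<exists>f\<in>{\<ominus> y}. p \<ominus> f \<in> H" if p: "p \<in> P" for p
      proof -
        have "p \<ominus> (\<ominus> y) = y \<oplus> p" using y p Pd(2) by (simp add: minus_eq a_comm)
        then show ?thesis using n p by auto
      qed
      then have "\<exists>H\<in>\<K> - \<F>. almost_in P H"
        using neumann[of "\<K> - \<F>" P "{\<ominus> y}"] fin sub P(1) y by simp
      then obtain H where H: "H \<in> \<K>" "H \<notin> \<F>" "almost_in P H" by blast
      then have "almost_in K0 H" using almost_in_trans[OF P(2)] K0d(1) by blast
      then show False using H by (simp add: \<F>_def)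
    qed
    then obtain p where p: "p \<in> P" "\<And>K. K \<in> \<K> \<Longrightarrow> K \<notin> \<F> \<Longrightarrow> y \<oplus> p \<notin> K" by blast
    have "0 = (\<Sum>K\<in>\<K>. h K * (if y \<oplus> p \<in> K then 1 else 0))" using sum y p(1) Pd(2) by simp
    also have "\<dots> = (\<Sum>K\<in>\<F>. h K * (if y \<oplus> p \<in> K then 1 else 0))"
      using fin p(2) by (intro sum.mono_neutral_right) (auto simp: \<F>_def)
    also have "\<dots> = (\<Sum>K\<in>\<F>. h K * (if y \<in> K then 1 else 0))"
    proof (rule sum.cong[OF refl])
      fix K assume "K \<in> \<F>"
      then have "asub K" "p \<in> K" using sub p(1) PF by (auto simp: \<F>_def)
      then show "h K * (if y \<oplus> p \<in> K then 1 else 0) = h K * (if y \<in> K then 1 else 0)"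
        using shift[of K p y] y by simp
    qed
    finally show ?thesis by simp
  qed
  obtain F where "finite F \<and> F \<subseteq> K0 \<and> (\<forall>x\<in>K0. \<exists>!f. f \<in> F \<and> x \<ominus> f \<in> P)"
    using transversal[OF K0s P(1) PF[OF K0F] P(2)] by blast
  then have F: "finite F" "F \<subseteq> K0" "\<And>x. x \<in> K0 \<Longrightarrow> \<exists>!f. f \<in> F \<and> x \<ominus> f \<in> P" by blast+
  define n where "n = (\<lambda>K. card {f \<in> F. f \<in> K})"
  have npos: "n K > 0" if "K \<in> \<F>" for K
  proof -
    obtain f where f: "f \<in> F" "\<zero> \<ominus> f \<in> P" using F(3)[OF K0d(3)] by (auto elim: ex1E)
    have fc: "f \<in> carrier G" using f F(2) K0d(2) by blast
    have "\<zero> \<ominus> (\<zero> \<ominus> f) \<in> P" using Pd(3,4) f by blast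
    then have "f \<in> P" using fc by (simp add: minus_eq)
    then have "f \<in> {f \<in> F. f \<in> K}" using f PF[OF that] by blast
    then have "{f \<in> F. f \<in> K} \<noteq> {}" by blast
    then show ?thesis using F(1) by (simp add: n_def card_gt_0_iff)
  qed
  \<comment> \<open>The averaging step. The coset of \<open>x\<close> modulo \<open>K0\<close>
    either misses \<open>K\<close> or meets it in a translate of \<open>K \<inter> K0\<close>, which
    consists of \<open>n K\<close> classes modulo \<open>P\<close>.\<close>
  have count: "card {f \<in> F. x \<oplus> f \<in> K} = (if \<exists>k\<in>K. x \<ominus> k \<in> K0 then n K else 0)"
    if x: "x \<in> carrier G" and K: "K \<in> \<F>" for x K
  proof (cases "\<exists>k\<in>K. x \<ominus> k \<in> K0")
    case False
    have "x \<oplus> f \<notin> K" if f: "f \<in> F" for f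
    proof
      assume "x \<oplus> f \<in> K"
      moreover have "x \<ominus> (x \<oplus> f) = \<zero> \<ominus> f"
      proof -
        have "f \<in> carrier G" using f F(2) K0d(2) by blast
        then show ?thesis using x by (simp add: minus_eq minus_add a_assoc[symmetric] r_neg)
      qed
      moreover have "\<zero> \<ominus> f \<in> K0" using K0d(4)[OF K0d(3)] f F(2) by blast
      ultimately have "x \<oplus> f \<in> K" "x \<ominus> (x \<oplus> f) \<in> K0" by simp_all
      then show False using False by blast
    qed
    then have "{f \<in> F. x \<oplus> f \<in> K} = {}" by blast
    then show ?thesis using False by (simp only: card.empty if_False)
  next
    case True
    then obtain k where k: "k \<in> K" "x \<ominus> k \<in> K0" by blast
    have Ks: "asub K" using K sub by (auto simp: \<F>_def)
    have kc: "k \<in> carrier G" using k asubD[OF Ks] by blast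
    define k0 where "k0 = x \<ominus> k"
    have k0: "k0 \<in> K0" "k0 \<in> carrier G" using k K0d by (auto simp: k0_def)
    have e1: "x \<oplus> f \<in> K \<longleftrightarrow> k0 \<oplus> f \<in> K" if f: "f \<in> F" for f
    proof -
      have fc: "f \<in> carrier G" using f F(2) K0d(2) by blast
      have "x \<oplus> f = (k0 \<oplus> f) \<oplus> k"
        unfolding k0_def using x fc kc a_comm[of "\<ominus> k" f] by (simp add: minus_eq a_assoc l_neg)
      then show ?thesis using shift[OF Ks k(1), of "k0 \<oplus> f"] k0 fc by simp
    qed
    \<comment> \<open>Translation by \<open>k0\<close> permutes the classes of \<open>K0\<close>
      modulo \<open>P\<close>; this is the permutation induced on their representatives.\<close>
    define r where "r = (\<lambda>f. THE g. g \<in> F \<and> (k0 \<oplus> f) \<ominus> g \<in> P)"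
    have r: "r f \<in> F" "(k0 \<oplus> f) \<ominus> r f \<in> P" if f: "f \<in> F" for f
    proof -
      have "k0 \<oplus> f \<in> K0" using K0d(5)[OF k0(1)] f F(2) by blast
      then have "\<exists>!g. g \<in> F \<and> (k0 \<oplus> f) \<ominus> g \<in> P" by (rule F(3))
      then have "r f \<in> F \<and> (k0 \<oplus> f) \<ominus> r f \<in> P" unfolding r_def by (rule theI')
      then show "r f \<in> F" "(k0 \<oplus> f) \<ominus> r f \<in> P" by simp_all
    qed
    have rinj: "inj_on r F"
    proof (rule inj_onI)
      fix f g assume fg: "f \<in> F" "g \<in> F" "r f = r g"
      have c: "f \<in> carrier G" "g \<in> carrier G" "r f \<in> carrier G" using fg(1,2) F(2) K0d(2) r(1) by blast+
      have "(k0 \<oplus> f) \<ominus> (k0 \<oplus> g) \<in> P"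
        using sub_cong_trans[OF P(1), of "k0 \<oplus> f" "k0 \<oplus> g" "r f"] r[OF fg(1)] r[OF fg(2)] fg(3) c k0 by simp
      moreover have "(k0 \<oplus> f) \<ominus> (k0 \<oplus> g) = f \<ominus> g"
        using c k0 a_comm[of k0 f] by (simp add: minus_eq minus_add a_assoc r_neg2)
      moreover have "g \<ominus> g \<in> P" using c Pd(3) by (simp add: minus_eq r_neg)
      ultimately have "f \<ominus> g \<in> P" "f \<ominus> f \<in> P" using c Pd(3) by (simp_all add: minus_eq r_neg)
      then show "f = g" using F(3)[of f] fg F(2) by blast
    qed
    have rsurj: "r ` F = F" using endo_inj_surj[OF F(1) _ rinj] r by blast
    have e2: "k0 \<oplus> f \<in> K \<longleftrightarrow> r f \<in> K" if f: "f \<in> F" for f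
    proof -
      have c: "f \<in> carrier G" "r f \<in> carrier G" using f F(2) K0d(2) r(1)[OF f] by blast+
      have "(k0 \<oplus> f) = r f \<oplus> ((k0 \<oplus> f) \<ominus> r f)"
        using c k0 by (simp add: minus_eq a_lcomm[of "r f"] r_neg a_assoc)
      then show ?thesis using shift[OF Ks, of "(k0 \<oplus> f) \<ominus> r f" "r f"] r(2)[OF f] PF[OF K] c by auto
    qed
    have "bij_betw r {f \<in> F. x \<oplus> f \<in> K} {f \<in> F. f \<in> K}"
      unfolding bij_betw_def
    proof
      show "inj_on r {f \<in> F. x \<oplus> f \<in> K}" using rinj by (rule inj_on_subset) auto
      show "r ` {f \<in> F. x \<oplus> f \<in> K} = {f \<in> F. f \<in> K}"
      proof
        show "r ` {f \<in> F. x \<oplus> f \<in> K} \<subseteq> {f \<in> F. f \<in> K}" using e1 e2 r by blast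
        show "{f \<in> F. f \<in> K} \<subseteq> r ` {f \<in> F. x \<oplus> f \<in> K}"
        proof
          fix g assume g: "g \<in> {f \<in> F. f \<in> K}"
          then obtain f where f: "f \<in> F" "g = r f" using rsurj by blast
          then show "g \<in> r ` {f \<in> F. x \<oplus> f \<in> K}" using e1[OF f(1)] e2[OF f(1)] g by blast
        qed
      qed
    qed
    then show ?thesis using True bij_betw_same_card by (simp add: n_def)
  qed
  show thesis
  proof (rule that[of K0 \<F> "\<lambda>K. real (n K)"])
    show "K0 \<in> \<F>" "\<F> \<subseteq> \<K>" using K0F by (auto simp: \<F>_def)
    show "0 < real (n K)" if "K \<in> \<F>" for K using npos[OF that] by simp
    show "almost_in K K0" if "K \<in> \<F>" for K
      using almost_in_trans[OF absorb K0k(2)] Fk[OF that] that subc by (auto simp: \<F>_def)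
    show "K = K0" if "K \<in> \<F>" "K \<subseteq> K0" for K
      using K0(2) Fk[OF that(1)] that by (auto simp: \<F>_def)
    fix x assume x: "x \<in> carrier G"
    have "0 = (\<Sum>f\<in>F. \<Sum>K\<in>\<F>. h K * (if x \<oplus> f \<in> K then 1 else 0))"
      using sumF x F(2) K0d(2) by (simp add: subset_iff)
    also have "\<dots> = (\<Sum>K\<in>\<F>. h K * (\<Sum>f\<in>F. if x \<oplus> f \<in> K then 1 else 0))"
      by (subst sum.swap) (simp add: sum_distrib_left)
    also have "\<dots> = (\<Sum>K\<in>\<F>. h K * real (card {f \<in> F. x \<oplus> f \<in> K}))"
      using F(1) by (intro sum.cong refl) (simp add: sum.If_cases Int_def)
    also have "\<dots> = (\<Sum>K\<in>\<F>. h K * real (n K) * (if \<exists>k\<in>K. x \<ominus> k \<in> K0 then 1 else 0))"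
      using count[OF x] by (intro sum.cong refl) simp
    finally show "(\<Sum>K\<in>\<F>. h K * real (n K) * (if \<exists>k\<in>K. x \<ominus> k \<in> K0 then 1 else 0)) = 0" by simp
  qed
qed

end

section \<open>Counting right multiplications\<close>

text \<open>Over a left self-injective ring and for a left ideal \<open>U\<close> these are all
  homomorphisms from \<open>U\<close> to the ring, so this is the dual of \<open>U\<close>. The
  restriction makes equality of functions mean equality on \<open>U\<close>.\<close>

definition mults :: "('a, 'r) ring_scheme \<Rightarrow> 'a set \<Rightarrow> ('a \<Rightarrow> 'a) set"
  where "mults R U = (\<lambda>a. \<lambda>y\<in>U. y \<otimes>\<^bsub>R\<^esub> a) ` carrier R"

context ring
begin

lemma restrict_mult_eq_iff:
  "(\<lambda>y\<in>U. y \<otimes> a) = (\<lambda>y\<in>U. y \<otimes> b) \<longleftrightarrow> (\<forall>y\<in>U. y \<otimes> a = y \<otimes> b)"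
  by (auto simp: fun_eq_iff restrict_def)

text \<open>Every decomposition of an element of the sum arises from a chosen one by adding an
  element of the intersection to the first part and subtracting it from the second.\<close>

lemma set_add_times_Int_eqpoll:
  assumes U: "left_ideal U R" and V: "left_ideal V R"
  shows "(U \<inter> V) \<times> (U <+>\<^bsub>R\<^esub> V) \<approx> U \<times> V"
proof -
  note Ud = left_idealD[OF U] and Vd = left_idealD[OF V]
  define s where "s = (\<lambda>z. SOME p. p \<in> U \<times> V \<and> z = fst p \<oplus> snd p)"
  have s: "fst (s z) \<in> U \<and> snd (s z) \<in> V \<and> fst (s z) \<oplus> snd (s z) = z" if "z \<in> U <+>\<^bsub>R\<^esub> V" for z
  proof -
    have "\<exists>p. p \<in> U \<times> V \<and> z = fst p \<oplus> snd p" using that by (force simp: set_add_mem)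
    then have "s z \<in> U \<times> V \<and> z = fst (s z) \<oplus> snd (s z)" unfolding s_def by (rule someI_ex)
    then show ?thesis by auto
  qed
  have "bij_betw (\<lambda>(w, z). (fst (s z) \<oplus> w, snd (s z) \<ominus> w)) ((U \<inter> V) \<times> (U <+>\<^bsub>R\<^esub> V)) (U \<times> V)"
  proof (rule bij_betw_byWitness[of _ "\<lambda>(u, v). (u \<ominus> fst (s (u \<oplus> v)), u \<oplus> v)"])
    have sum: "(a \<oplus> w) \<oplus> (b \<ominus> w) = a \<oplus> b" if "a \<in> carrier R" "b \<in> carrier R" "w \<in> carrier R" for a b w
      using that by (simp add: minus_eq a_ac r_neg2) (metis a_assoc a_inv_closed a_lcomm r_neg r_zero)
    show "\<forall>p\<in>(U \<inter> V) \<times> (U <+>\<^bsub>R\<^esub> V).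
        (\<lambda>(u, v). (u \<ominus> fst (s (u \<oplus> v)), u \<oplus> v)) ((\<lambda>(w, z). (fst (s z) \<oplus> w, snd (s z) \<ominus> w)) p) = p"
    proof clarsimp
      fix w z assume w: "w \<in> U" "w \<in> V" and z: "z \<in> U <+>\<^bsub>R\<^esub> V"
      have c: "fst (s z) \<in> carrier R" "snd (s z) \<in> carrier R" "w \<in> carrier R" using s[OF z] w Ud Vd by auto
      have e: "(fst (s z) \<oplus> w) \<oplus> (snd (s z) \<ominus> w) = z" using sum[OF c] s[OF z] by simp
      show "fst (s z) \<oplus> w \<ominus> fst (s (fst (s z) \<oplus> w \<oplus> (snd (s z) \<ominus> w))) = w \<and>
          fst (s z) \<oplus> w \<oplus> (snd (s z) \<ominus> w) = z"
        unfolding e using add_minus_cancel_left[OF c(1,3)] by simp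
    qed
    have mem: "u \<oplus> v \<in> U <+>\<^bsub>R\<^esub> V" if "u \<in> U" "v \<in> V" for u v using that by (auto simp: set_add_mem)
    have diff: "u \<ominus> fst (s (u \<oplus> v)) = snd (s (u \<oplus> v)) \<ominus> v" if "u \<in> U" "v \<in> V" for u v
    proof -
      have c: "fst (s (u \<oplus> v)) \<in> carrier R" "snd (s (u \<oplus> v)) \<in> carrier R" "u \<in> carrier R" "v \<in> carrier R"
        using s[OF mem[OF that]] that Ud Vd by auto
      have "fst (s (u \<oplus> v)) \<oplus> snd (s (u \<oplus> v)) = u \<oplus> v" using s[OF mem[OF that]] by auto
      then have "(v \<oplus> u) \<ominus> (v \<oplus> fst (s (u \<oplus> v))) =
          (fst (s (u \<oplus> v)) \<oplus> snd (s (u \<oplus> v))) \<ominus> (fst (s (u \<oplus> v)) \<oplus> v)"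
        using c a_comm[of v u] a_comm[of v "fst (s (u \<oplus> v))"] by simp
      moreover have "(p \<oplus> q) \<ominus> (p \<oplus> r) = q \<ominus> r"
        if "p \<in> carrier R" "q \<in> carrier R" "r \<in> carrier R" for p q r
        using that a_comm[of p q] by (simp add: minus_eq minus_add a_assoc r_neg2)
      ultimately show ?thesis using c by simp
    qed
    have back': "a \<oplus> (u \<ominus> a) = u" if "a \<in> carrier R" "u \<in> carrier R" for a u
      using that minus_add_cancel a_comm by (metis minus_closed)
    have back2: "b \<ominus> (b \<ominus> v) = v" if "b \<in> carrier R" "v \<in> carrier R" for b v
      using that add_minus_cancel_left[of "b \<ominus> v" v] minus_add_cancel[of b v] by simp
    show "\<forall>p\<in>U \<times> V.
        (\<lambda>(w, z). (fst (s z) \<oplus> w, snd (s z) \<ominus> w)) ((\<lambda>(u, v). (u \<ominus> fst (s (u \<oplus> v)), u \<oplus> v)) p) = p"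
    proof clarsimp
      fix u v assume uv: "u \<in> U" "v \<in> V"
      have c: "fst (s (u \<oplus> v)) \<in> carrier R" "snd (s (u \<oplus> v)) \<in> carrier R" "u \<in> carrier R" "v \<in> carrier R"
        using s[OF mem[OF uv]] uv Ud Vd by auto
      show "fst (s (u \<oplus> v)) \<oplus> (u \<ominus> fst (s (u \<oplus> v))) = u \<and>
          snd (s (u \<oplus> v)) \<ominus> (u \<ominus> fst (s (u \<oplus> v))) = v"
        using back'[OF c(1,3)] back2[OF c(2,4)] diff[OF uv] by simp
    qed
    show "(\<lambda>(w, z). (fst (s z) \<oplus> w, snd (s z) \<ominus> w)) ` ((U \<inter> V) \<times> (U <+>\<^bsub>R\<^esub> V)) \<subseteq> U \<times> V"
      using s Ud(4) Vd(7) by auto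
    show "(\<lambda>(u, v). (u \<ominus> fst (s (u \<oplus> v)), u \<oplus> v)) ` (U \<times> V) \<subseteq> (U \<inter> V) \<times> (U <+>\<^bsub>R\<^esub> V)"
    proof clarsimp
      fix u v assume uv: "u \<in> U" "v \<in> V"
      show "u \<ominus> fst (s (u \<oplus> v)) \<in> U \<and> u \<ominus> fst (s (u \<oplus> v)) \<in> V \<and> u \<oplus> v \<in> U <+>\<^bsub>R\<^esub> V"
        using s[OF mem[OF uv]] uv Ud(7) Vd(7) mem[OF uv] diff[OF uv] by metis
    qed
  qed
  then show ?thesis by (auto simp: eqpoll_def)
qed

lemma eqpoll_card: "A \<approx> B \<Longrightarrow> card A = card B"
  by (auto simp: eqpoll_def bij_betw_same_card)

lemma card_set_add:
  "left_ideal U R \<Longrightarrow> left_ideal V R \<Longrightarrow> card (U \<inter> V) * card (U <+>\<^bsub>R\<^esub> V) = card U * card V"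
  using eqpoll_card[OF set_add_times_Int_eqpoll, of U V] by (simp add: card_cartesian_product)

text \<open>Take \<open>V\<close> maximal with zero intersection. If the sum missed
  \<open>x\<close>, split 1 = l + k along the elements that move \<open>x\<close> into the sum. As
  \<open>J\<close> kills \<open>x\<close>, the multiples of \<open>k \<otimes> x\<close> meet the
  sum only in zero, so \<open>V\<close> could be enlarged.\<close>

lemma complement_in_annihilator:
  assumes art: "left_artinian R" and A: "left_ideal A R" "A \<subseteq> rann R J" "finite A"
    and U: "left_ideal U R" "U \<subseteq> A"
  obtains V where "left_ideal V R" "V \<subseteq> A" "U \<inter> V = {\<zero>}" "U <+>\<^bsub>R\<^esub> V = A"
proof -
  note Ad = left_idealD[OF A(1)] and Ud = left_idealD[OF U(1)]
  let ?D = "{V. left_ideal V R \<and> V \<subseteq> A \<and> U \<inter> V = {\<zero>}}"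
  have fin: "finite ?D" using A(3) by (auto intro: finite_subset[of _ "Pow A"])
  have "{\<zero>} \<in> ?D" using Ad(3) Ud(3) by auto
  then have "?D \<noteq> {}" by (metis empty_iff)
  from finite_has_maximal[OF fin this]
  obtain V where V: "V \<in> ?D" "\<forall>W\<in>?D. V \<subseteq> W \<longrightarrow> V = W" by (rule bexE)
  have Vl: "left_ideal V R" "V \<subseteq> A" "U \<inter> V = {\<zero>}" using V(1) by auto
  note Vd = left_idealD[OF Vl(1)]
  let ?S = "U <+>\<^bsub>R\<^esub> V"
  have S: "left_ideal ?S R" using left_ideal_sum U(1) Vl(1) .
  note Sd = left_idealD[OF S]
  have up: "U \<subseteq> ?S" "V \<subseteq> ?S" using set_add_upper[OF U(1) Vl(1)] .
  have "A \<subseteq> ?S"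
  proof
    fix x assume x: "x \<in> A"
    show "x \<in> ?S"
    proof (rule ccontr)
      assume xS: "x \<notin> ?S"
      have xc: "x \<in> carrier R" using x Ad by blast
      define C where "C = {r \<in> carrier R. r \<otimes> x \<in> ?S}"
      have C: "left_ideal C R" unfolding C_def using left_ideal_colon[OF S xc] .
      have Jx: "j \<otimes> x = \<zero>" if "j \<in> J" for j using x A(2) that by (auto simp: rann_def)
      have JC: "J \<subseteq> C" unfolding C_def using jac_subset Jx Sd(3) by auto
      obtain l k where lk: "l \<in> C" "k \<in> carrier R" "\<one> = l \<oplus> k"
          "\<And>r. r \<in> carrier R \<Longrightarrow> r \<otimes> k \<in> C \<Longrightarrow> r \<otimes> k \<in> J"
        using complement_mod_jac[OF art C JC] by metis
      have lc: "l \<in> carrier R" "l \<otimes> x \<in> ?S" using lk(1) by (auto simp: C_def)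
      define y where "y = k \<otimes> x"
      have yc: "y \<in> carrier R" using lk xc by (simp add: y_def)
      have yA: "y \<in> A" using Ad(5) lk x by (simp add: y_def)
      have yS: "r \<otimes> y = \<zero>" if "r \<in> carrier R" "r \<otimes> y \<in> ?S" for r
      proof -
        have "r \<otimes> k \<in> C" using that lk(2) xc by (simp add: y_def C_def m_assoc)
        then have "(r \<otimes> k) \<otimes> x = \<zero>" using lk(4) that Jx by blast
        then show ?thesis using that lk(2) xc by (simp add: y_def m_assoc)
      qed
      have x_eq: "x = l \<otimes> x \<oplus> y" using lk lc xc unfolding y_def by (metis l_distr l_one)
      have "y \<notin> ?S"
      proof
        assume "y \<in> ?S"
        then have "l \<otimes> x \<oplus> y \<in> ?S" using Sd(4) lc(2) by blast
        then show False unfolding x_eq[symmetric] using xS by simp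
      qed
      let ?V = "V <+>\<^bsub>R\<^esub> lprin R y"
      have V': "left_ideal ?V R" using left_ideal_sum Vl(1) yc by simp
      have sub: "?V \<subseteq> A" using set_add_least[OF A(1) Vl(2) lprin_least[OF A(1) yA]] .
      have "U \<inter> ?V \<subseteq> {\<zero>}"
      proof
        fix z assume z: "z \<in> U \<inter> ?V"
        then obtain v r where vr: "v \<in> V" "r \<in> carrier R" "z = v \<oplus> r \<otimes> y" by (auto simp: set_add_mem lprin_def)
        have zv: "z \<ominus> v = r \<otimes> y" using vr add_minus_cancel_left Vd(2) yc by simp
        have "z \<ominus> v \<in> ?S" using Sd(7) up z vr(1) by blast
        then have "r \<otimes> y \<in> ?S" unfolding zv .
        then have "r \<otimes> y = \<zero>" using yS vr by blast
        then have "z = v" using vr Vd(2) by simp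
        then show "z \<in> {\<zero>}" using z vr Vl(3) by blast
      qed
      then have "?V \<in> ?D" using V' sub Ud(3) left_idealD(3)[OF V'] by auto
      moreover have up': "V \<subseteq> ?V" "lprin R y \<subseteq> ?V" using set_add_upper[OF Vl(1)] yc by auto
      ultimately have "V = ?V" using V(2) by blast
      then show False using up' up lprin_self[OF yc] \<open>y \<notin> ?S\<close> by blast
    qed
  qed
  then have "?S = A" using set_add_least[OF A(1) U(2) Vl(2)] by auto
  then show thesis using that Vl by blast
qed

end

section \<open>Duals of finite left ideals in the socle\<close>

context left_selfinjective
begin

lemma mults_lprin: "x \<in> carrier R \<Longrightarrow> mults R (lprin R x) \<approx> rprin R x"
  unfolding mults_def rprin_def
proof (rule image_eqpoll, unfold restrict_mult_eq_iff)
  fix a b assume c: "x \<in> carrier R" "a \<in> carrier R" "b \<in> carrier R"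
  show "(\<forall>y\<in>lprin R x. y \<otimes> a = y \<otimes> b) \<longleftrightarrow> x \<otimes> a = x \<otimes> b"
  proof
    assume "x \<otimes> a = x \<otimes> b"
    then show "\<forall>y\<in>lprin R x. y \<otimes> a = y \<otimes> b" using c by (auto simp: lprin_def m_assoc)
  qed (use lprin_self[OF c(1)] in blast)
qed

text \<open>By \<open>rann_Int_subset\<close> every element is a sum of one killing \<open>U\<close>
  and one killing \<open>V\<close>. Splitting the difference of \<open>a\<close> and
  \<open>b\<close> in this way gives the common multiplier.\<close>

lemma mults_pair:
  assumes U: "left_ideal U R" and V: "left_ideal V R" and int: "U \<inter> V = {\<zero>}"
    and a: "a \<in> carrier R" and b: "b \<in> carrier R"
  obtains c where "c \<in> carrier R" "\<And>y. y \<in> U \<Longrightarrow> y \<otimes> c = y \<otimes> a" "\<And>y. y \<in> V \<Longrightarrow> y \<otimes> c = y \<otimes> b"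
proof -
  note Ud = left_idealD[OF U] and Vd = left_idealD[OF V]
  have "a \<ominus> b \<in> rann R (U \<inter> V)" using a b int by (simp add: rann_def)
  then obtain p q where pq: "p \<in> rann R U" "q \<in> rann R V" "a \<ominus> b = p \<oplus> q"
    using rann_Int_subset[OF U V] by (auto simp: set_add_mem subset_iff)
  have c: "p \<in> carrier R" "q \<in> carrier R" using pq by (auto simp: rann_def)
  have "a = (p \<oplus> q) \<oplus> b" using minus_add_cancel[of a b] pq a b by simp
  then have e: "a \<ominus> p = q \<oplus> b" using add_minus_cancel_left[of p "q \<oplus> b"] c b by (simp add: a_assoc)
  show thesis
  proof (rule that[of "a \<ominus> p"])
    show "y \<otimes> (a \<ominus> p) = y \<otimes> a" if "y \<in> U" for y
      using that pq(1) a c Ud(2) by (simp add: r_minus_distr rann_def)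
    show "y \<otimes> (a \<ominus> p) = y \<otimes> b" if "y \<in> V" for y
      unfolding e using that pq(2) b c Vd(2) by (simp add: r_distr rann_def)
  qed (use a c in simp)
qed

lemma mults_set_add:
  assumes U: "left_ideal U R" and V: "left_ideal V R" and int: "U \<inter> V = {\<zero>}"
  shows "mults R (U <+>\<^bsub>R\<^esub> V) \<approx> mults R U \<times> mults R V"
proof -
  note Ud = left_idealD[OF U] and Vd = left_idealD[OF V]
  have "mults R (U <+>\<^bsub>R\<^esub> V) \<approx> (\<lambda>a. (\<lambda>y\<in>U. y \<otimes> a, \<lambda>y\<in>V. y \<otimes> a)) ` carrier R"
    unfolding mults_def
  proof (rule image_eqpoll, unfold restrict_mult_eq_iff prod.inject)
    fix a b assume c: "a \<in> carrier R" "b \<in> carrier R"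
    show "(\<forall>y\<in>U <+>\<^bsub>R\<^esub> V. y \<otimes> a = y \<otimes> b) \<longleftrightarrow> (\<forall>y\<in>U. y \<otimes> a = y \<otimes> b) \<and> (\<forall>y\<in>V. y \<otimes> a = y \<otimes> b)"
      (is "?A \<longleftrightarrow> ?B")
    proof
      assume ?A
      then show ?B using set_add_upper[OF U V] by blast
    next
      assume ?B
      then show ?A using c Ud(2) Vd(2) by (auto simp: set_add_mem l_distr)
    qed
  qed
  also have "(\<lambda>a. (\<lambda>y\<in>U. y \<otimes> a, \<lambda>y\<in>V. y \<otimes> a)) ` carrier R = mults R U \<times> mults R V"
  proof
    show "mults R U \<times> mults R V \<subseteq> (\<lambda>a. (\<lambda>y\<in>U. y \<otimes> a, \<lambda>y\<in>V. y \<otimes> a)) ` carrier R"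
    proof
      fix p assume "p \<in> mults R U \<times> mults R V"
      then obtain a b where p: "p = (\<lambda>y\<in>U. y \<otimes> a, \<lambda>y\<in>V. y \<otimes> b)" and c: "a \<in> carrier R" "b \<in> carrier R"
        by (auto simp: mults_def)
      obtain d where d: "d \<in> carrier R" "\<And>y. y \<in> U \<Longrightarrow> y \<otimes> d = y \<otimes> a" "\<And>y. y \<in> V \<Longrightarrow> y \<otimes> d = y \<otimes> b"
        using mults_pair[OF U V int c] by blast
      have "p = (\<lambda>y\<in>U. y \<otimes> d, \<lambda>y\<in>V. y \<otimes> d)"
        unfolding p prod.inject restrict_mult_eq_iff using d(2,3) by simp
      then show "p \<in> (\<lambda>a. (\<lambda>y\<in>U. y \<otimes> a, \<lambda>y\<in>V. y \<otimes> a)) ` carrier R" using d(1) by blast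
    qed
  qed (auto simp: mults_def)
  finally show ?thesis .
qed

text \<open>The right ideal xR stands for the dual of Rx, by \<open>mults_lprin\<close>. The
  condition thus says that finite cyclic left ideals in the socle have duals of their own
  size.\<close>

definition balanced :: bool
  where "balanced \<longleftrightarrow> (\<forall>x\<in>T. finite (lprin R x) \<longrightarrow> card (rprin R x) = card (lprin R x))"

lemma mults_zero: "mults R {\<zero>} = {\<lambda>y\<in>{\<zero>}. \<zero>}"
proof -
  have "(\<lambda>y\<in>{\<zero>}. y \<otimes> a) = (\<lambda>y\<in>{\<zero>}. \<zero>)" if "a \<in> carrier R" for a
    using that by (intro restrict_ext) auto
  then show ?thesis by (auto simp: mults_def)
qed

text \<open>A finite left ideal in the socle is a direct sum of cyclic ones, and both its size and
  that of its dual are multiplicative. The relation is kept abstract because equality is used under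
  \<open>balanced\<close>, and the inequality on the way to it.\<close>

lemma card_mults_rel:
  fixes P :: "nat \<Rightarrow> nat \<Rightarrow> bool"
  assumes P: "P 1 1" "\<And>a b c d. P a b \<Longrightarrow> P c d \<Longrightarrow> P (a * c) (b * d)"
    and cyc: "\<And>x. x \<in> T \<Longrightarrow> finite (lprin R x) \<Longrightarrow> finite (rprin R x) \<and> P (card (rprin R x)) (card (lprin R x))"
    and "finite U" "left_ideal U R" "U \<subseteq> T"
  shows "finite (mults R U) \<and> P (card (mults R U)) (card U)"
  using assms(4-)
proof (induction "card U" arbitrary: U rule: less_induct)
  case less
  note Ud = left_idealD[OF less.prems(2)]
  show ?case
  proof (cases "U = {\<zero>}")
    case True
    then show ?thesis using P(1) by (simp add: mults_zero)
  next
    case False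
    then obtain x where x: "x \<in> U" "x \<noteq> \<zero>" using Ud(3) by blast
    then have xc: "x \<in> carrier R" using Ud by blast
    have sub: "lprin R x \<subseteq> U" using lprin_least less.prems(2) x(1) .
    have fin: "finite (lprin R x)" using sub less.prems(1) finite_subset by blast
    obtain V where V: "left_ideal V R" "V \<subseteq> U" "lprin R x \<inter> V = {\<zero>}" "lprin R x <+>\<^bsub>R\<^esub> V = U"
      using complement_in_annihilator[OF left_artin less.prems(2,3,1) _ sub] xc by auto
    have fV: "finite V" using V(2) less.prems(1) finite_subset by blast
    have cU: "card U = card (lprin R x) * card V"
      using card_set_add[of "lprin R x" V] V xc by simp
    have pos: "card V > 0" using fV left_idealD(3)[OF V(1)] card_gt_0_iff by blast
    have "card {x, \<zero>} \<le> card (lprin R x)"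
      using fin lprin_self[OF xc] left_idealD(3)[OF left_ideal_lprin[OF xc]] by (intro card_mono) auto
    then have c2: "card (lprin R x) \<ge> 2" using x(2) by simp
    then have "card V < card U" using pos cU by simp
    then have IH: "finite (mults R V)" "P (card (mults R V)) (card V)" using less.hyps fV V(1,2) less.prems by blast+
    have "finite (rprin R x)" "P (card (rprin R x)) (card (lprin R x))" using cyc fin x less.prems(3) by blast+
    then have X: "finite (mults R (lprin R x))" "P (card (mults R (lprin R x))) (card (lprin R x))"
      using eqpoll_card[OF mults_lprin[OF xc]] eqpoll_finite_iff[OF mults_lprin[OF xc]] by simp_all
    have e: "mults R U \<approx> mults R (lprin R x) \<times> mults R V"
      using mults_set_add[OF _ V(1,3)] xc unfolding V(4) by simp
    show ?thesis
      unfolding eqpoll_card[OF e] eqpoll_finite_iff[OF e] cU card_cartesian_product using X IH P(2) by simp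
  qed
qed

lemma card_mults:
  assumes balanced "finite U" "left_ideal U R" "U \<subseteq> T"
  shows "finite (mults R U) \<and> card (mults R U) = card U"
proof (rule card_mults_rel[of "(=)"])
  fix x assume x: "x \<in> T" "finite (lprin R x)"
  then have c: "x \<in> carrier R" by (simp add: rann_def)
  have "card (rprin R x) = card (lprin R x)" using assms(1) x by (simp add: balanced_def)
  moreover have "card (lprin R x) > 0" using x(2) lprin_self[OF c] card_gt_0_iff by blast
  ultimately show "finite (rprin R x) \<and> card (rprin R x) = card (lprin R x)" using card_ge_0_finite[of "rprin R x"] by simp
qed (use assms in simp_all)

text \<open>The right multiplications that kill \<open>L\<close> restrict bijectively to the dual of
  a complement of \<open>L\<close>, which has the size of the complement. This is the analogue of
  the order of an annihilator in the character group.\<close>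

lemma card_mults_annihilating:
  assumes bal: balanced and S: "finite S" "left_ideal S R" "S \<subseteq> T" and L: "left_ideal L R" "L \<subseteq> S"
  shows "card {\<phi> \<in> mults R S. \<forall>y\<in>L. \<phi> y = \<zero>} * card L = card S"
proof -
  obtain V where V: "left_ideal V R" "V \<subseteq> S" "L \<inter> V = {\<zero>}" "L <+>\<^bsub>R\<^esub> V = S"
    using complement_in_annihilator[OF left_artin S(2,3,1) L] .
  note Ld = left_idealD[OF L(1)] and Vd = left_idealD[OF V(1)]
  let ?K = "{a \<in> carrier R. \<forall>y\<in>L. y \<otimes> a = \<zero>}"
  have "{\<phi> \<in> mults R S. \<forall>y\<in>L. \<phi> y = \<zero>} = (\<lambda>a. \<lambda>y\<in>S. y \<otimes> a) ` ?K"
    unfolding mults_def using L(2) by (auto 4 3 intro!: image_eqI simp: subset_iff)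
  also have "\<dots> \<approx> (\<lambda>a. \<lambda>y\<in>V. y \<otimes> a) ` ?K"
  proof (rule image_eqpoll, unfold restrict_mult_eq_iff)
    fix a b assume c: "a \<in> ?K" "b \<in> ?K"
    show "(\<forall>y\<in>S. y \<otimes> a = y \<otimes> b) \<longleftrightarrow> (\<forall>y\<in>V. y \<otimes> a = y \<otimes> b)"
    proof
      assume "\<forall>y\<in>V. y \<otimes> a = y \<otimes> b"
      then show "\<forall>y\<in>S. y \<otimes> a = y \<otimes> b"
        unfolding V(4)[symmetric] using c Ld(2) Vd(2) by (auto simp: set_add_mem l_distr)
    qed (use V(2) in blast)
  qed
  also have "(\<lambda>a. \<lambda>y\<in>V. y \<otimes> a) ` ?K = mults R V"
  proof
    show "mults R V \<subseteq> (\<lambda>a. \<lambda>y\<in>V. y \<otimes> a) ` ?K"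
    proof
      fix \<phi> assume "\<phi> \<in> mults R V"
      then obtain a where a: "a \<in> carrier R" "\<phi> = (\<lambda>y\<in>V. y \<otimes> a)" by (auto simp: mults_def)
      obtain c where c: "c \<in> carrier R" "\<And>y. y \<in> L \<Longrightarrow> y \<otimes> c = y \<otimes> \<zero>" "\<And>y. y \<in> V \<Longrightarrow> y \<otimes> c = y \<otimes> a"
        using mults_pair[OF L(1) V(1,3) zero_closed a(1)] by blast
      have "\<phi> = (\<lambda>y\<in>V. y \<otimes> c)" unfolding a restrict_mult_eq_iff using c by simp
      moreover have "c \<in> ?K" using c Ld(2) by auto
      ultimately show "\<phi> \<in> (\<lambda>a. \<lambda>y\<in>V. y \<otimes> a) ` ?K" by blast
    qed
  qed (auto simp: mults_def)
  finally have "card {\<phi> \<in> mults R S. \<forall>y\<in>L. \<phi> y = \<zero>} = card (mults R V)" by (rule eqpoll_card)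
  also have "\<dots> = card V" using card_mults[OF bal _ V(1)] V(2) S finite_subset by blast
  finally show ?thesis using card_set_add[OF L(1) V(1)] V(3,4) by simp
qed

end

section \<open>A substitute for character orthogonality\<close>

context left_selfinjective
begin

text \<open>The Fourier-type step: the functional \<open>w \<mapsto> \<Sum>\<^sub>\<phi> \<mu>(\<phi>) w(\<phi>)\<close> over right multiplications \<open>\<phi>\<close> on \<open>S\<close> is
  replaced by an induction from large to small kernels, which shows that \<open>B \<phi> = 0\<close> for every \<open>\<phi>\<close>,
  whereas \<open>B = 1\<close> at the identity.\<close>

lemma delta_not_combination:
  assumes bal: balanced and S: "finite S" "left_ideal S R" "S \<subseteq> T" and K: "finite K"
    and N: "\<And>j. j \<in> K \<Longrightarrow> left_ideal (N j) R" "\<And>j. j \<in> K \<Longrightarrow> N j \<subseteq> S" "\<And>j. j \<in> K \<Longrightarrow> N j \<noteq> {\<zero>}"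
    and delta: "\<And>y. y \<in> S \<Longrightarrow> (if y = \<zero> then 1 else 0 :: real) = (\<Sum>j\<in>K. b j * (if y \<in> N j then 1 else 0))"
  shows False
proof -
  note Sd = left_idealD[OF S(2)]
  define H where "H = mults R S"
  define an where "an = (\<lambda>L. {\<phi> \<in> H. \<forall>y\<in>L. \<phi> y = \<zero>})"
  define ker where "ker = (\<lambda>\<phi>. {y \<in> S. \<phi> y = \<zero>})"
  \<comment> \<open>If \<open>H\<close> were the character group of \<open>S\<close>, this would be
    the Fourier transform of the difference of the two sides of \<open>delta\<close>: the indicator
    of a submodule transforms into its size times the indicator of its annihilator.\<close>
  define B where "B = (\<lambda>\<phi>. 1 - (\<Sum>j\<in>K. b j * card (N j) * (if N j \<subseteq> ker \<phi> then 1 else 0 :: real)))"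
  have finH: "finite H" using card_mults[OF bal S] by (simp add: H_def)
  have finan: "finite (an L)" for L using finH by (simp add: an_def)
  have phi: "\<exists>a\<in>carrier R. \<forall>y\<in>S. \<phi> y = y \<otimes> a" if "\<phi> \<in> H" for \<phi>
    using that by (auto simp: H_def mults_def)
  have kerl: "left_ideal (ker \<phi>) R" if "\<phi> \<in> H" for \<phi>
  proof -
    obtain a where a: "a \<in> carrier R" "\<forall>y\<in>S. \<phi> y = y \<otimes> a" using phi[OF \<open>\<phi> \<in> H\<close>] by blast
    have "ker \<phi> = S \<inter> lann R {a}" using a Sd(2) by (auto simp: ker_def lann_def)
    then show ?thesis using left_ideal_Int[OF S(2)] a(1) by simp
  qed
  have cardan: "real (card (an L)) = card S / card L" "card L > 0" if L: "left_ideal L R" "L \<subseteq> S" for L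
  proof -
    have "finite L" using L(2) S(1) finite_subset by blast
    then show "card L > 0" using left_idealD(3)[OF L(1)] card_gt_0_iff by blast
    moreover have "real (card (an L)) * card L = card S"
      using card_mults_annihilating[OF bal S L] unfolding an_def H_def of_nat_mult[symmetric] by simp
    ultimately show "real (card (an L)) = card S / card L" by (simp add: field_simps)
  qed
  \<comment> \<open>Poisson summation, proved by counting: the sum over the annihilator of
    \<open>L\<close> equals the size of that annihilator times the sum over \<open>L\<close> of the
    difference of the two sides of \<open>delta\<close>.\<close>
  have Bsum: "(\<Sum>\<phi>\<in>an L. B \<phi>) = 0" if L: "left_ideal L R" "L \<subseteq> S" for L
  proof -
    have finL: "finite L" using L(2) S(1) finite_subset by blast
    have "1 = (\<Sum>y\<in>L. if y = \<zero> then 1 else 0 :: real)" using finL left_idealD(3)[OF L(1)] by simp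
    also have "\<dots> = (\<Sum>y\<in>L. \<Sum>j\<in>K. b j * (if y \<in> N j then 1 else 0))"
      by (rule sum.cong[OF refl], rule delta) (use L(2) in blast)
    also have "\<dots> = (\<Sum>j\<in>K. b j * (\<Sum>y\<in>L. if y \<in> N j then 1 else 0))"
      by (subst sum.swap) (simp add: sum_distrib_left)
    also have "\<dots> = (\<Sum>j\<in>K. b j * card (N j \<inter> L))"
      using finL by (intro sum.cong refl arg_cong2[where f="(*)"]) (simp add: sum.If_cases Int_commute Int_def)
    finally have one: "(\<Sum>j\<in>K. b j * card (N j \<inter> L)) = 1" by simp
    have 2: "real (card (N j)) * card {\<phi> \<in> an L. N j \<subseteq> ker \<phi>} = card (N j \<inter> L) * card (an L)" if j: "j \<in> K" for j
    proof -
      have sub: "N j <+>\<^bsub>R\<^esub> L \<subseteq> S" using set_add_least[OF S(2) N(2)[OF j] L(2)] .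
      have Sl: "left_ideal (N j <+>\<^bsub>R\<^esub> L) R" using left_ideal_sum[OF N(1)[OF j] L(1)] .
      have eq: "{\<phi> \<in> an L. N j \<subseteq> ker \<phi>} = an (N j <+>\<^bsub>R\<^esub> L)"
      proof
        show "an (N j <+>\<^bsub>R\<^esub> L) \<subseteq> {\<phi> \<in> an L. N j \<subseteq> ker \<phi>}"
          using set_add_upper[OF N(1)[OF j] L(1)] N(2)[OF j] by (auto simp: an_def ker_def)
        show "{\<phi> \<in> an L. N j \<subseteq> ker \<phi>} \<subseteq> an (N j <+>\<^bsub>R\<^esub> L)"
        proof
          fix \<phi> assume "\<phi> \<in> {\<phi> \<in> an L. N j \<subseteq> ker \<phi>}"
          then have \<phi>: "\<phi> \<in> H" "L \<subseteq> ker \<phi>" "N j \<subseteq> ker \<phi>" using L(2) by (auto simp: an_def ker_def)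
          then have "N j <+>\<^bsub>R\<^esub> L \<subseteq> ker \<phi>" using set_add_least[OF kerl[OF \<phi>(1)]] by blast
          then show "\<phi> \<in> an (N j <+>\<^bsub>R\<^esub> L)" using \<phi>(1) by (auto simp: an_def ker_def)
        qed
      qed
      have "real (card (N j \<inter> L)) * card (N j <+>\<^bsub>R\<^esub> L) = card (N j) * card L"
        using card_set_add[OF N(1)[OF j] L(1)] unfolding of_nat_mult[symmetric] by simp
      then show ?thesis unfolding eq of_nat_mult cardan(1)[OF Sl sub] cardan(1)[OF L]
        using cardan(2)[OF Sl sub] cardan(2)[OF L] by (simp add: field_simps)
    qed
    have "(\<Sum>\<phi>\<in>an L. B \<phi>) = card (an L) - (\<Sum>\<phi>\<in>an L. \<Sum>j\<in>K. b j * card (N j) * (if N j \<subseteq> ker \<phi> then 1 else 0))"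
      by (simp add: B_def sum_subtractf)
    also have "(\<Sum>\<phi>\<in>an L. \<Sum>j\<in>K. b j * card (N j) * (if N j \<subseteq> ker \<phi> then 1 else 0 :: real))
        = (\<Sum>j\<in>K. b j * card (N j) * (\<Sum>\<phi>\<in>an L. if N j \<subseteq> ker \<phi> then 1 else 0))"
      by (subst sum.swap) (simp add: sum_distrib_left)
    also have "\<dots> = (\<Sum>j\<in>K. b j * (card (N j) * card {\<phi> \<in> an L. N j \<subseteq> ker \<phi>}))"
      using finan by (intro sum.cong refl) (simp add: sum.If_cases Int_def)
    also have "\<dots> = (\<Sum>j\<in>K. b j * card (N j \<inter> L)) * card (an L)"
      unfolding sum_distrib_right using 2 by (intro sum.cong refl) (simp add: algebra_simps)
    also have "\<dots> = card (an L)" using one by simp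
    finally show ?thesis by simp
  qed
  have B0: "B \<phi> = 0" if "\<phi> \<in> H" for \<phi>
    using that
  proof (induction "card S - card (ker \<phi>)" arbitrary: \<phi> rule: less_induct)
    case less
    have kS: "ker \<phi> \<subseteq> S" by (auto simp: ker_def)
    let ?A = "{\<psi> \<in> an (ker \<phi>). ker \<psi> = ker \<phi>}"
    have "B \<psi> = 0" if \<psi>: "\<psi> \<in> an (ker \<phi>) - ?A" for \<psi>
    proof (rule less.hyps)
      show "\<psi> \<in> H" using \<psi> by (auto simp: an_def)
      have "ker \<phi> \<subseteq> ker \<psi>" using \<psi> by (auto simp: an_def ker_def)
      then have "ker \<phi> \<subset> ker \<psi>" using \<psi> by blast
      moreover have "ker \<psi> \<subseteq> S" by (auto simp: ker_def)
      ultimately have "card (ker \<phi>) < card (ker \<psi>)" "card (ker \<psi>) \<le> card S"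
        using S(1) by (meson finite_subset psubset_card_mono, meson card_mono)
      then show "card S - card (ker \<psi>) < card S - card (ker \<phi>)" by simp
    qed
    then have "(\<Sum>\<psi>\<in>an (ker \<phi>). B \<psi>) = (\<Sum>\<psi>\<in>?A. B \<psi>)"
      using finan by (intro sum.mono_neutral_right) auto
    also have "\<dots> = (\<Sum>\<psi>\<in>?A. B \<phi>)" by (intro sum.cong refl) (simp add: B_def)
    finally have "card ?A * B \<phi> = 0" using Bsum[OF kerl[OF less.prems] kS] by simp
    moreover have "\<phi> \<in> ?A" using less.prems by (auto simp: an_def ker_def)
    then have "?A \<noteq> {}" by blast
    then have "card ?A > 0" using finan[of "ker \<phi>"] by (simp add: card_gt_0_iff)
    ultimately show ?case by simp
  qed
  define i where "i = (\<lambda>y\<in>S. y \<otimes> \<one>)"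
  have iH: "i \<in> H" unfolding i_def H_def mults_def by blast
  have "ker i = {\<zero>}" using Sd(2,3) by (auto simp: ker_def i_def)
  then have "\<not> N j \<subseteq> ker i" if "j \<in> K" for j using N(3)[OF that] left_idealD(3)[OF N(1)[OF that]] by auto
  then have "B i = 1" by (simp add: B_def)
  then show False using B0[OF iH] by simp
qed

end

section \<open>Extension of weight-preserving homomorphisms\<close>

lemma left_regular_sel [simp]:
  "carrier (left_regular R) = carrier R" "x \<oplus>\<^bsub>left_regular R\<^esub> y = x \<oplus>\<^bsub>R\<^esub> y"
  "\<zero>\<^bsub>left_regular R\<^esub> = \<zero>\<^bsub>R\<^esub>" "a \<odot>\<^bsub>left_regular R\<^esub> x = a \<otimes>\<^bsub>R\<^esub> x"
  by (simp_all add: left_regular_def)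

lemma left_power_sel [simp]:
  "carrier (left_power R n) = {..<n} \<rightarrow>\<^sub>E carrier R"
  "x \<oplus>\<^bsub>left_power R n\<^esub> y = (\<lambda>i\<in>{..<n}. x i \<oplus>\<^bsub>R\<^esub> y i)"
  "\<zero>\<^bsub>left_power R n\<^esub> = (\<lambda>i\<in>{..<n}. \<zero>\<^bsub>R\<^esub>)"
  "a \<odot>\<^bsub>left_power R n\<^esub> x = (\<lambda>i\<in>{..<n}. a \<otimes>\<^bsub>R\<^esub> x i)"
  by (simp_all add: left_power_def)

lemma submoduleD:
  assumes "submodule N R M"
  shows "N \<subseteq> carrier M" "\<zero>\<^bsub>M\<^esub> \<in> N" "\<And>x y. x \<in> N \<Longrightarrow> y \<in> N \<Longrightarrow> x \<oplus>\<^bsub>M\<^esub> y \<in> N"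
    "\<And>a x. a \<in> carrier R \<Longrightarrow> x \<in> N \<Longrightarrow> a \<odot>\<^bsub>M\<^esub> x \<in> N"
proof -
  interpret submodule N R M by fact
  show "N \<subseteq> carrier M" "\<zero>\<^bsub>M\<^esub> \<in> N" "\<And>x y. x \<in> N \<Longrightarrow> y \<in> N \<Longrightarrow> x \<oplus>\<^bsub>M\<^esub> y \<in> N"
    "\<And>a x. a \<in> carrier R \<Longrightarrow> x \<in> N \<Longrightarrow> a \<odot>\<^bsub>M\<^esub> x \<in> N"
    using subset m_closed one_closed smult_closed by auto
qed

context left_module
begin

lemma zero_smult: "x \<in> carrier M \<Longrightarrow> \<zero>\<^bsub>R\<^esub> \<odot>\<^bsub>M\<^esub> x = \<zero>\<^bsub>M\<^esub>"
proof -
  assume x: "x \<in> carrier M"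
  have "\<zero>\<^bsub>R\<^esub> \<odot>\<^bsub>M\<^esub> x \<oplus>\<^bsub>M\<^esub> \<zero>\<^bsub>R\<^esub> \<odot>\<^bsub>M\<^esub> x = \<zero>\<^bsub>R\<^esub> \<odot>\<^bsub>M\<^esub> x"
    using smult_l_distr[of "\<zero>\<^bsub>R\<^esub>" "\<zero>\<^bsub>R\<^esub>" x] x by simp
  then show ?thesis using smult_closed[of "\<zero>\<^bsub>R\<^esub>" x] x by (metis M.add.l_cancel_one R.zero_closed)
qed

lemma neg_one_smult: "x \<in> carrier M \<Longrightarrow> (\<ominus>\<^bsub>R\<^esub> \<one>\<^bsub>R\<^esub>) \<odot>\<^bsub>M\<^esub> x = \<ominus>\<^bsub>M\<^esub> x"
proof -
  assume x: "x \<in> carrier M"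
  have "(\<ominus>\<^bsub>R\<^esub> \<one>\<^bsub>R\<^esub>) \<odot>\<^bsub>M\<^esub> x \<oplus>\<^bsub>M\<^esub> x = \<zero>\<^bsub>M\<^esub>"
    using smult_l_distr[of "\<ominus>\<^bsub>R\<^esub> \<one>\<^bsub>R\<^esub>" "\<one>\<^bsub>R\<^esub>" x] x zero_smult[OF x] smult_one[OF x] by (simp add: R.l_neg)
  then show ?thesis using smult_closed[of "\<ominus>\<^bsub>R\<^esub> \<one>\<^bsub>R\<^esub>" x] x by (metis M.minus_equality R.a_inv_closed R.one_closed)
qed

lemma submodule_left_module:
  assumes "submodule N R M"
  shows "left_module R (M\<lparr>carrier := N\<rparr>)"
proof -
  note N = submoduleD[OF assms]
  have c: "x \<in> carrier M" if "x \<in> N" for x using that N by auto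
  have "abelian_group (M\<lparr>carrier := N\<rparr>)"
  proof (rule abelian_groupI)
    fix x assume "x \<in> carrier (M\<lparr>carrier := N\<rparr>)"
    then have x: "x \<in> N" by simp
    then have "\<ominus>\<^bsub>M\<^esub> x \<in> N" using N(4)[of "\<ominus>\<^bsub>R\<^esub> \<one>\<^bsub>R\<^esub>" x] neg_one_smult c by simp
    then show "\<exists>y\<in>carrier (M\<lparr>carrier := N\<rparr>). y \<oplus>\<^bsub>M\<lparr>carrier := N\<rparr>\<^esub> x = \<zero>\<^bsub>M\<lparr>carrier := N\<rparr>\<^esub>"
      using c[OF x] by (intro bexI[of _ "\<ominus>\<^bsub>M\<^esub> x"]) (auto simp: M.l_neg)
  qed (use N c in \<open>auto simp: M.a_ac\<close>)
  then show ?thesis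
    unfolding left_module_def left_module_axioms_def
    using R.ring_axioms N c by (simp add: smult_l_distr smult_r_distr smult_assoc smult_one)
qed

lemma hom_regular:
  assumes "f \<in> mod_homs R M (left_regular R)"
  shows "\<And>x. x \<in> carrier M \<Longrightarrow> f x \<in> carrier R" "f \<zero>\<^bsub>M\<^esub> = \<zero>\<^bsub>R\<^esub>"
    "\<And>x y. x \<in> carrier M \<Longrightarrow> y \<in> carrier M \<Longrightarrow> f (x \<oplus>\<^bsub>M\<^esub> y) = f x \<oplus>\<^bsub>R\<^esub> f y"
    "\<And>x y. x \<in> carrier M \<Longrightarrow> y \<in> carrier M \<Longrightarrow> f (x \<ominus>\<^bsub>M\<^esub> y) = f x \<ominus>\<^bsub>R\<^esub> f y"
    "\<And>a x. a \<in> carrier R \<Longrightarrow> x \<in> carrier M \<Longrightarrow> f (a \<odot>\<^bsub>M\<^esub> x) = a \<otimes>\<^bsub>R\<^esub> f x"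
proof -
  show c: "\<And>x. x \<in> carrier M \<Longrightarrow> f x \<in> carrier R"
    and add: "\<And>x y. x \<in> carrier M \<Longrightarrow> y \<in> carrier M \<Longrightarrow> f (x \<oplus>\<^bsub>M\<^esub> y) = f x \<oplus>\<^bsub>R\<^esub> f y"
    and mult: "\<And>a x. a \<in> carrier R \<Longrightarrow> x \<in> carrier M \<Longrightarrow> f (a \<odot>\<^bsub>M\<^esub> x) = a \<otimes>\<^bsub>R\<^esub> f x"
    using assms by (auto simp: mod_homs_def)
  show "f \<zero>\<^bsub>M\<^esub> = \<zero>\<^bsub>R\<^esub>" using mult[of "\<zero>\<^bsub>R\<^esub>" "\<zero>\<^bsub>M\<^esub>"] zero_smult[of "\<zero>\<^bsub>M\<^esub>"] c[of "\<zero>\<^bsub>M\<^esub>"] by simp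
  show "f (x \<ominus>\<^bsub>M\<^esub> y) = f x \<ominus>\<^bsub>R\<^esub> f y" if "x \<in> carrier M" "y \<in> carrier M" for x y
    using add[of x "\<ominus>\<^bsub>M\<^esub> y"] mult[of "\<ominus>\<^bsub>R\<^esub> \<one>\<^bsub>R\<^esub>" y] neg_one_smult[of y] c that
    by (simp add: M.minus_eq R.minus_eq R.l_minus)
qed

end

lemma (in ring) left_module_left_power: "left_module R (left_power R n)"
proof -
  have "abelian_group (left_power R n)"
  proof (rule abelian_groupI)
    fix x assume x: "x \<in> carrier (left_power R n)"
    then show "\<exists>y\<in>carrier (left_power R n). y \<oplus>\<^bsub>left_power R n\<^esub> x = \<zero>\<^bsub>left_power R n\<^esub>"
    proof (intro bexI[of _ "\<lambda>i\<in>{..<n}. \<ominus> x i"])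
      have "x i \<in> carrier R" if "i < n" for i using x that by auto
      then have "(\<lambda>i\<in>{..<n}. (\<lambda>i\<in>{..<n}. \<ominus> x i) i \<oplus> x i) = (\<lambda>i\<in>{..<n}. \<zero>)"
        by (intro restrict_ext) (auto simp: l_neg)
      then show "(\<lambda>i\<in>{..<n}. \<ominus> x i) \<oplus>\<^bsub>left_power R n\<^esub> x = \<zero>\<^bsub>left_power R n\<^esub>" by simp
    qed auto
    have "x i \<in> carrier R" if "i < n" for i using x that by auto
    then have "\<zero>\<^bsub>left_power R n\<^esub> \<oplus>\<^bsub>left_power R n\<^esub> x = restrict x {..<n}"
      by (auto intro: restrict_ext)
    then show "\<zero>\<^bsub>left_power R n\<^esub> \<oplus>\<^bsub>left_power R n\<^esub> x = x" using x PiE_restrict by simp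
  next
    fix x y assume xy: "x \<in> carrier (left_power R n)" "y \<in> carrier (left_power R n)"
    then have c: "x i \<in> carrier R" "y i \<in> carrier R" if "i < n" for i using that by auto
    then show "x \<oplus>\<^bsub>left_power R n\<^esub> y \<in> carrier (left_power R n)" by simp
    show "x \<oplus>\<^bsub>left_power R n\<^esub> y = y \<oplus>\<^bsub>left_power R n\<^esub> x"
      using c by (auto simp: a_comm intro: restrict_ext)
    fix z assume "z \<in> carrier (left_power R n)"
    then have "z i \<in> carrier R" if "i < n" for i using that by auto
    then show "x \<oplus>\<^bsub>left_power R n\<^esub> y \<oplus>\<^bsub>left_power R n\<^esub> z = x \<oplus>\<^bsub>left_power R n\<^esub> (y \<oplus>\<^bsub>left_power R n\<^esub> z)"
      using c by (auto simp: a_assoc intro: restrict_ext)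
  qed auto
  moreover have "left_module_axioms R (left_power R n)"
  proof
    fix x assume x: "x \<in> carrier (left_power R n)"
    then have c: "x i \<in> carrier R" if "i < n" for i using that by auto
    then have "\<one> \<odot>\<^bsub>left_power R n\<^esub> x = restrict x {..<n}" by (auto intro: restrict_ext)
    then show "\<one> \<odot>\<^bsub>left_power R n\<^esub> x = x" using x PiE_restrict by simp
    fix a assume a: "a \<in> carrier R"
    then show "a \<odot>\<^bsub>left_power R n\<^esub> x \<in> carrier (left_power R n)" using c by simp
    show "(a \<oplus> b) \<odot>\<^bsub>left_power R n\<^esub> x = a \<odot>\<^bsub>left_power R n\<^esub> x \<oplus>\<^bsub>left_power R n\<^esub> b \<odot>\<^bsub>left_power R n\<^esub> x"
      "(a \<otimes> b) \<odot>\<^bsub>left_power R n\<^esub> x = a \<odot>\<^bsub>left_power R n\<^esub> (b \<odot>\<^bsub>left_power R n\<^esub> x)"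
      if "b \<in> carrier R" for b
      using that a c by (auto simp: l_distr m_assoc intro: restrict_ext)
    fix y assume "y \<in> carrier (left_power R n)"
    then have "y i \<in> carrier R" if "i < n" for i using that by auto
    then show "a \<odot>\<^bsub>left_power R n\<^esub> (x \<oplus>\<^bsub>left_power R n\<^esub> y) =
        a \<odot>\<^bsub>left_power R n\<^esub> x \<oplus>\<^bsub>left_power R n\<^esub> a \<odot>\<^bsub>left_power R n\<^esub> y"
      using a c by (auto simp: r_distr intro: restrict_ext)
  qed
  ultimately show ?thesis by (simp add: left_module_def ring_axioms)
qed

section \<open>Multiplicities of kernels in a linear relation\<close>

context left_selfinjective
begin

lemma finite_left_ideal_containing:
  assumes "finite \<F>" "\<And>N. N \<in> \<F> \<Longrightarrow> left_ideal N R \<and> finite N \<and> N \<subseteq> I" "left_ideal I R"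
  shows "\<exists>Y. left_ideal Y R \<and> finite Y \<and> Y \<subseteq> I \<and> (\<forall>N\<in>\<F>. N \<subseteq> Y)"
  using assms(1,2)
proof (induction \<F> rule: finite_induct)
  case empty
  then show ?case using left_idealD(3)[OF assms(3)] by (intro exI[of _ "{\<zero>}"]) auto
next
  case (insert N \<F>)
  then obtain Y where Y: "left_ideal Y R" "finite Y" "Y \<subseteq> I" "\<forall>N\<in>\<F>. N \<subseteq> Y" by auto
  have N: "left_ideal N R" "finite N" "N \<subseteq> I" using insert.prems by auto
  have "finite (N <+>\<^bsub>R\<^esub> Y)" using N(2) Y(2) by (auto simp: set_add_def set_mult_def)
  then show ?case
    using left_ideal_sum[OF N(1) Y(1)] set_add_least[OF assms(3) N(3) Y(3)] set_add_upper[OF N(1) Y(1)] Y(4)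
    by (intro exI[of _ "N <+>\<^bsub>R\<^esub> Y"]) blast
qed

text \<open>Otherwise the sums of coefficients over equal kernels form a nontrivial relation between
  indicators of subgroups. After \<open>indicator_reduction\<close> it is pushed forward along a map
  \<open>lam\<close> with kernel \<open>K0\<close>: the remaining kernels have finite images, since
  they are almost inside \<open>K0\<close>, and only \<open>K0\<close> itself goes to zero. This
  expresses the indicator of zero by those of nonzero left ideals, against
  \<open>delta_not_combination\<close>.\<close>

lemma kernel_multiplicity:
  assumes bal: balanced and M: "left_module R M" and Idx: "finite Idx"
    and hom: "\<And>i. i \<in> Idx \<Longrightarrow> \<kappa> i \<in> mod_homs R M (left_regular R)"
    and sum: "\<And>x. x \<in> carrier M \<Longrightarrow> (\<Sum>i\<in>Idx. c i * (if \<kappa> i x = \<zero> then 1 else 0 :: real)) = 0"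
  shows "(\<Sum>i | i \<in> Idx \<and> {x \<in> carrier M. \<kappa> i x = \<zero>} = K. c i) = 0"
proof (rule ccontr)
  interpret M: left_module R M by fact
  define kr where "kr = (\<lambda>i. {x \<in> carrier M. \<kappa> i x = \<zero>})"
  define h where "h = (\<lambda>K. \<Sum>i | i \<in> Idx \<and> kr i = K. c i)"
  assume "\<not> ?thesis"
  then have hK: "h K \<noteq> 0" by (simp add: h_def kr_def)
  note H = M.hom_regular[OF hom]
  have asub: "M.asub (kr i)" if "i \<in> Idx" for i
    using H[OF that] by (auto simp: M.asub_def kr_def)
  define \<K> where "\<K> = {K \<in> kr ` Idx. h K \<noteq> 0}"
  have "\<exists>i\<in>Idx. kr i = K"
  proof (rule ccontr)
    assume "\<not> ?thesis"
    then have "{i. i \<in> Idx \<and> kr i = K} = {}" by blast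
    then show False using hK unfolding h_def by (simp only: sum.empty)
  qed
  then have "K \<in> \<K>" using hK by (auto simp: \<K>_def)
  then have ne: "\<K> \<noteq> {}" by blast
  have fin: "finite \<K>" using Idx by (simp add: \<K>_def)
  have Ks: "M.asub K" if "K \<in> \<K>" for K using that asub by (auto simp: \<K>_def)
  have sumK: "(\<Sum>K\<in>\<K>. h K * (if x \<in> K then 1 else 0)) = 0" if x: "x \<in> carrier M" for x
  proof -
    have "0 = (\<Sum>i\<in>Idx. c i * (if x \<in> kr i then 1 else 0))" using sum[OF x] x by (simp add: kr_def)
    also have "\<dots> = (\<Sum>K\<in>kr ` Idx. \<Sum>i | i \<in> Idx \<and> kr i = K. c i * (if x \<in> kr i then 1 else 0))"
      using Idx by (rule sum.image_gen)
    also have "\<dots> = (\<Sum>K\<in>kr ` Idx. h K * (if x \<in> K then 1 else 0))"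
      unfolding h_def sum_distrib_right by (intro sum.cong refl) auto
    also have "\<dots> = (\<Sum>K\<in>\<K>. h K * (if x \<in> K then 1 else 0))"
      using Idx by (intro sum.mono_neutral_right) (auto simp: \<K>_def)
    finally show ?thesis by simp
  qed
  obtain K0 \<F> n where red: "K0 \<in> \<F> \<and> \<F> \<subseteq> \<K> \<and> (\<forall>K\<in>\<F>. (n K :: real) > 0) \<and> (\<forall>K\<in>\<F>. M.almost_in K K0) \<and>
      (\<forall>K\<in>\<F>. K \<subseteq> K0 \<longrightarrow> K = K0) \<and>
      (\<forall>x\<in>carrier M. (\<Sum>K\<in>\<F>. h K * n K * (if \<exists>k\<in>K. x \<ominus>\<^bsub>M\<^esub> k \<in> K0 then 1 else 0)) = 0)"
  proof (rule M.indicator_reduction[OF fin Ks ne sumK])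
    fix K0 \<F> n assume "K0 \<in> \<F>" "\<F> \<subseteq> \<K>" "\<And>K. K \<in> \<F> \<Longrightarrow> (n K :: real) > 0"
      "\<And>K. K \<in> \<F> \<Longrightarrow> M.almost_in K K0" "\<And>K. K \<in> \<F> \<Longrightarrow> K \<subseteq> K0 \<Longrightarrow> K = K0"
      "\<And>x. x \<in> carrier M \<Longrightarrow> (\<Sum>K\<in>\<F>. h K * n K * (if \<exists>k\<in>K. x \<ominus>\<^bsub>M\<^esub> k \<in> K0 then 1 else 0)) = 0"
    then show thesis by (intro that[of K0 \<F> n]) blast
  qed
  have K0F: "K0 \<in> \<F>" and FK: "\<F> \<subseteq> \<K>" and npos: "\<And>K. K \<in> \<F> \<Longrightarrow> n K > 0"
    and alm: "\<And>K. K \<in> \<F> \<Longrightarrow> M.almost_in K K0" and minK: "\<And>K. K \<in> \<F> \<Longrightarrow> K \<subseteq> K0 \<Longrightarrow> K = K0"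
    and sumF: "\<And>x. x \<in> carrier M \<Longrightarrow> (\<Sum>K\<in>\<F>. h K * n K * (if \<exists>k\<in>K. x \<ominus>\<^bsub>M\<^esub> k \<in> K0 then 1 else 0)) = 0"
    using red by blast+
  obtain i0 where i0: "i0 \<in> Idx" "kr i0 = K0" using K0F FK by (auto simp: \<K>_def)
  define lam where "lam = \<kappa> i0"
  note L = H[OF i0(1), folded lam_def]
  have K0: "K0 = {x \<in> carrier M. lam x = \<zero>}" using i0 by (simp add: kr_def lam_def)
  have Kc: "K \<subseteq> carrier M" if "K \<in> \<F>" for K using that FK Ks M.asubD(1) by blast
  have img: "left_ideal (lam ` K) R" if "M.asub K" "\<And>a x. a \<in> carrier R \<Longrightarrow> x \<in> K \<Longrightarrow> a \<odot>\<^bsub>M\<^esub> x \<in> K" for K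
  proof (rule left_idealI)
    note Kd = M.asubD[OF that(1)]
    show "lam ` K \<subseteq> carrier R" using Kd(2) L(1) by auto
    show "\<zero> \<in> lam ` K" using Kd(3) L(2) by (metis imageI)
    show "x \<oplus> y \<in> lam ` K" if xy: "x \<in> lam ` K" "y \<in> lam ` K" for x y
    proof -
      obtain x' y' where "x' \<in> K" "x = lam x'" "y' \<in> K" "y = lam y'" using xy by blast
      then show ?thesis using L(3)[of x' y'] Kd(2,5) by (intro image_eqI[of _ _ "x' \<oplus>\<^bsub>M\<^esub> y'"]) auto
    qed
    show "a \<otimes> x \<in> lam ` K" if a: "a \<in> carrier R" and x: "x \<in> lam ` K" for a x
    proof -
      obtain x' where "x' \<in> K" "x = lam x'" using x by blast
      then show ?thesis using L(5)[of a x'] a Kd(2) \<open>\<And>a x. a \<in> carrier R \<Longrightarrow> x \<in> K \<Longrightarrow> a \<odot>\<^bsub>M\<^esub> x \<in> K\<close>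
        by (intro image_eqI[of _ _ "a \<odot>\<^bsub>M\<^esub> x'"]) auto
    qed
  qed
  define I where "I = lam ` carrier M"
  have Iid: "left_ideal I R"
    unfolding I_def by (rule img) (auto simp: M.asub_def M.smult_closed)
  have Nid: "left_ideal (lam ` K) R" if K: "K \<in> \<F>" for K
  proof (rule img)
    show "M.asub K" using K FK Ks by blast
    obtain i where i: "i \<in> Idx" "K = kr i" using K FK by (auto simp: \<K>_def)
    show "a \<odot>\<^bsub>M\<^esub> x \<in> K" if "a \<in> carrier R" "x \<in> K" for a x
      using that H(5)[OF i(1)] i(2) M.smult_closed by (simp add: kr_def)
  qed
  have Nfin: "finite (lam ` K)" if K: "K \<in> \<F>" for K
  proof -
    obtain F where F: "finite F" "F \<subseteq> carrier M" "\<forall>x\<in>K. \<exists>f\<in>F. x \<ominus>\<^bsub>M\<^esub> f \<in> K0"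
      using alm[OF K] by (auto simp: M.almost_in_def)
    have "lam ` K \<subseteq> lam ` F"
    proof
      fix s assume "s \<in> lam ` K"
      then obtain x where x: "x \<in> K" "s = lam x" by blast
      then obtain f where f: "f \<in> F" "x \<ominus>\<^bsub>M\<^esub> f \<in> K0" using F(3) by blast
      have c: "x \<in> carrier M" "f \<in> carrier M" using x f F(2) Kc[OF K] by auto
      have "lam x \<ominus> lam f = \<zero>" using f(2) L(4)[OF c] by (simp add: K0)
      then have "lam x = lam f" using L(1) c by simp
      then show "s \<in> lam ` F" using x f by blast
    qed
    then show ?thesis using F(1) finite_surj by blast
  qed
  have mem: "(\<exists>k\<in>K. x \<ominus>\<^bsub>M\<^esub> k \<in> K0) \<longleftrightarrow> lam x \<in> lam ` K" if x: "x \<in> carrier M" and K: "K \<in> \<F>" for x K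
  proof -
    have "x \<ominus>\<^bsub>M\<^esub> k \<in> K0 \<longleftrightarrow> lam x = lam k" if "k \<in> K" for k
    proof -
      have c: "k \<in> carrier M" using that Kc[OF K] by blast
      then show ?thesis using x L(4)[OF x c] L(1) by (simp add: K0)
    qed
    then show ?thesis by blast
  qed
  have sumN: "(\<Sum>K\<in>\<F>. h K * n K * (if s \<in> lam ` K then 1 else 0)) = 0" if "s \<in> I" for s
  proof -
    obtain x where x: "x \<in> carrier M" "s = lam x" using \<open>s \<in> I\<close> by (auto simp: I_def)
    have "(\<Sum>K\<in>\<F>. h K * n K * (if s \<in> lam ` K then 1 else 0))
        = (\<Sum>K\<in>\<F>. h K * n K * (if \<exists>k\<in>K. x \<ominus>\<^bsub>M\<^esub> k \<in> K0 then 1 else 0))"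
      unfolding x(2) using mem[OF x(1)] by (intro sum.cong refl) simp
    then show ?thesis using sumF[OF x(1)] by simp
  qed
  have finF: "finite \<F>" using FK fin finite_subset by blast
  have Nsub: "lam ` K \<subseteq> I" if "K \<in> \<F>" for K using Kc[OF that] by (auto simp: I_def)
  obtain Y where Y: "left_ideal Y R" "finite Y" "Y \<subseteq> I" "\<forall>N\<in>(`) lam ` \<F>. N \<subseteq> Y"
    using finite_left_ideal_containing[of "(`) lam ` \<F>" I] finF Nid Nfin Nsub Iid by blast
  \<comment> \<open>Passing to the socle keeps every nonzero image nonzero, as each contains a
    minimal left ideal.\<close>
  define S where "S = Y \<inter> T"
  have S: "finite S" "left_ideal S R" "S \<subseteq> T" "S \<subseteq> I"
    using Y left_ideal_Int[OF Y(1) left_ideal_T] by (auto simp: S_def)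
  \<comment> \<open>The coefficients after solving the relation for the term of \<open>K0\<close>,
    whose image is zero.\<close>
  define b where "b = (\<lambda>K. - (h K * n K) / (h K0 * n K0))"
  have h0: "h K0 * n K0 \<noteq> 0" using K0F FK npos[OF K0F] by (auto simp: \<K>_def)
  show False
  proof (rule delta_not_combination[OF bal S(1-3), of "\<F> - {K0}" "\<lambda>K. lam ` K \<inter> S" b])
    show "finite (\<F> - {K0})" using finF by simp
    fix K assume K: "K \<in> \<F> - {K0}"
    then have KF: "K \<in> \<F>" by blast
    show "left_ideal (lam ` K \<inter> S) R" using left_ideal_Int Nid KF S(2) by blast
    show "lam ` K \<inter> S \<subseteq> S" by blast
    have "\<not> K \<subseteq> K0" using minK K by blast
    then obtain x where x: "x \<in> K" "x \<notin> K0" by blast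
    then have "lam x \<noteq> \<zero>" using Kc[OF KF] by (auto simp: K0)
    then have "lam ` K \<noteq> {\<zero>}" using x by blast
    then obtain S' where S': "minimal_left_ideal S' R" "S' \<subseteq> lam ` K"
      using minimal_left_ideal_exists[OF left_artin Nid[OF KF]] by blast
    have "S' \<subseteq> lam ` K \<inter> S"
      using S'(2) Y(4) KF minimal_left_ideal_annihilated[OF S'(1)] unfolding S_def by blast
    moreover have "\<zero> \<in> S'" "S' \<noteq> {\<zero>}" using S'(1) left_idealD(3) by (auto simp: minimal_left_ideal_def)
    ultimately show "lam ` K \<inter> S \<noteq> {\<zero>}" by blast
  next
    fix y assume y: "y \<in> S"
    have z: "lam ` K0 = {\<zero>}"
    proof
      show "{\<zero>} \<subseteq> lam ` K0" using left_idealD(3)[OF Nid[OF K0F]] by blast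
    qed (auto simp: K0)
    have "0 = (\<Sum>K\<in>\<F>. h K * n K * (if y \<in> lam ` K then 1 else 0))" using sumN y S(4) by auto
    also have "\<dots> = h K0 * n K0 * (if y = \<zero> then 1 else 0) +
        (\<Sum>K\<in>\<F> - {K0}. h K * n K * (if y \<in> lam ` K then 1 else 0))"
      by (subst sum.remove[OF finF K0F]) (simp add: z)
    finally have "(if y = \<zero> then 1 else 0) = - (\<Sum>K\<in>\<F> - {K0}. h K * n K * (if y \<in> lam ` K then 1 else 0)) / (h K0 * n K0)"
      using h0 by (simp add: field_simps split: if_splits)
    also have "\<dots> = (\<Sum>K\<in>\<F> - {K0}. b K * (if y \<in> lam ` K \<inter> S then 1 else 0))"
      unfolding sum_negf[symmetric] sum_divide_distrib b_def using y by (intro sum.cong refl) simp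
    finally show "(if y = \<zero> then 1 else 0) = (\<Sum>K\<in>\<F> - {K0}. b K * (if y \<in> lam ` K \<inter> S then 1 else 0))" .
  qed
qed

end

lemma permutation_of_fibre_cards:
  assumes "finite A" "\<And>K. card {i \<in> A. f i = K} = card {i \<in> A. g i = K}"
  obtains \<sigma> where "\<sigma> permutes A" "\<And>i. i \<in> A \<Longrightarrow> g i = f (\<sigma> i)"
proof -
  have "count (image_mset g (mset_set A)) K = count (image_mset f (mset_set A)) K" for K
  proof -
    have "count (image_mset h (mset_set A)) K = card {i \<in> A. h i = K}" for h :: "'a \<Rightarrow> 'b"
    proof -
      have "count (image_mset h (mset_set A)) K = (\<Sum>x | x \<in> A \<and> K = h x. 1)"
        using assms(1) by (simp add: count_image_mset')
      then show ?thesis by (simp add: eq_commute)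
    qed
    then show ?thesis using assms(2) by simp
  qed
  then have "image_mset g (mset_set A) = image_mset f (mset_set A)" by (rule multiset_eqI)
  then show thesis using image_mset_eq_implies_permutes[OF assms(1)] that by metis
qed

text \<open>The coordinates of a code and of its image are numbered jointly by
  \<open>{..<2 * n}\<close>, the first half counted with sign +1 and the second with -1.\<close>

lemma sum_signed_cards:
  fixes n :: nat
  shows "(\<Sum>i | i \<in> {..<2 * n} \<and> P i. if i < n then 1 else - 1 :: real)
    = real (card {i \<in> {..<n}. P i}) - real (card {i \<in> {..<n}. P (n + i)})"
proof -
  have "{i. i \<in> {..<2 * n} \<and> P i} = {i \<in> {..<n}. P i} \<union> (+) n ` {i \<in> {..<n}. P (n + i)}"
  proof (rule equalityI; rule subsetI)
    fix i assume i: "i \<in> {i. i \<in> {..<2 * n} \<and> P i}"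
    show "i \<in> {i \<in> {..<n}. P i} \<union> (+) n ` {i \<in> {..<n}. P (n + i)}"
    proof (cases "i < n")
      case False
      then have "i = n + (i - n)" "i - n < n" "P (n + (i - n))" using i by auto
      then show ?thesis by blast
    qed (use i in simp)
  qed auto
  moreover have "{i \<in> {..<n}. P i} \<inter> (+) n ` {i \<in> {..<n}. P (n + i)} = {}" by auto
  ultimately have "(\<Sum>i | i \<in> {..<2 * n} \<and> P i. if i < n then 1 else - 1 :: real)
      = (\<Sum>i\<in>{i \<in> {..<n}. P i}. if i < n then 1 else - 1)
        + (\<Sum>i\<in>(+) n ` {i \<in> {..<n}. P (n + i)}. if i < n then 1 else - 1)"
    by (simp add: sum.union_disjoint)
  also have "(\<Sum>i\<in>(+) n ` {i \<in> {..<n}. P (n + i)}. if i < n then 1 else - 1 :: real)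
      = (\<Sum>i\<in>{i \<in> {..<n}. P (n + i)}. - 1)"
    by (subst sum.reindex) auto
  finally show ?thesis by simp
qed

lemma hamming_weight_zeros:
  "hamming_weight R n x + card {i \<in> {..<n}. x i = \<zero>\<^bsub>R\<^esub>} = n"
proof -
  have "hamming_weight R n x = card {i \<in> {..<n}. x i \<noteq> \<zero>\<^bsub>R\<^esub>}"
    unfolding hamming_weight_def hamming_def by (simp add: sum.If_cases Int_def Collect_neg_eq[symmetric])
  moreover have "card {i \<in> {..<n}. x i = \<zero>\<^bsub>R\<^esub>} + card {i \<in> {..<n}. x i \<noteq> \<zero>\<^bsub>R\<^esub>} = n"
    by (subst card_Un_disjoint[symmetric]) (auto simp: Collect_disj_eq[symmetric] intro: arg_cong[where f = card, of _ "{..<n}", simplified])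
  ultimately show ?thesis by simp
qed

section \<open>The extension theorem for balanced rings\<close>

context left_selfinjective
begin

text \<open>Self-injectivity gives multipliers \<open>a\<close> from \<open>f\<close> to
  \<open>g\<close> and \<open>b\<close> back, so \<open>\<one> \<ominus> a \<otimes> b\<close>
  annihilates the image of \<open>f\<close>. Changing \<open>a\<close> within the right annihilator
  of that image does not affect g = f a, and \<open>unit_in_coset\<close> finds a unit among these
  changes.\<close>

lemma unit_between_homs:
  assumes M: "left_module R M" and f: "f \<in> mod_homs R M (left_regular R)"
    and g: "g \<in> mod_homs R M (left_regular R)"
    and ker: "{x \<in> carrier M. f x = \<zero>} = {x \<in> carrier M. g x = \<zero>}"
  shows "\<exists>u\<in>Units R. \<forall>x\<in>carrier M. g x = f x \<otimes> u"
proof -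
  interpret M: left_module R M by fact
  have ex: "\<exists>c\<in>carrier R. \<forall>x\<in>carrier M. g x = f x \<otimes> c"
    if f: "f \<in> mod_homs R M (left_regular R)" and g: "g \<in> mod_homs R M (left_regular R)"
      and ker: "\<And>x. x \<in> carrier M \<Longrightarrow> f x = \<zero> \<Longrightarrow> g x = \<zero>" for f g
  proof -
    note F = M.hom_regular[OF f] and G = M.hom_regular[OF g]
    let ?G = "(\<lambda>x. (f x, g x)) ` carrier M"
    obtain c where c: "c \<in> carrier R" "\<And>x y. (x, y) \<in> ?G \<Longrightarrow> y = x \<otimes> c"
    proof (rule linj_graph[OF left_inj, of ?G])
      show "?G \<subseteq> carrier R \<times> carrier R" using F(1) G(1) by auto
      show "(\<zero>, \<zero>) \<in> ?G" using F(2) G(2) by (intro image_eqI[of _ _ "\<zero>\<^bsub>M\<^esub>"]) auto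
      show "(x \<oplus> x', y \<oplus> y') \<in> ?G" if xy: "(x, y) \<in> ?G" "(x', y') \<in> ?G" for x y x' y'
      proof -
        obtain a b where "a \<in> carrier M" "b \<in> carrier M" "x = f a" "y = g a" "x' = f b" "y' = g b"
          using xy by blast
        then show ?thesis using F(3)[of a b] G(3)[of a b] by (intro image_eqI[of _ _ "a \<oplus>\<^bsub>M\<^esub> b"]) auto
      qed
      show "(r \<otimes> x, r \<otimes> y) \<in> ?G" if r: "r \<in> carrier R" and xy: "(x, y) \<in> ?G" for r x y
      proof -
        obtain a where "a \<in> carrier M" "x = f a" "y = g a" using xy by blast
        then show ?thesis using F(5)[of r a] G(5)[of r a] r M.smult_closed
          by (intro image_eqI[of _ _ "r \<odot>\<^bsub>M\<^esub> a"]) auto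
      qed
      show "y = \<zero>" if "(\<zero>, y) \<in> ?G" for y
      proof -
        have "\<exists>a\<in>carrier M. (\<zero>, y) = (f a, g a)" using that by fast
        then obtain a where "a \<in> carrier M" "f a = \<zero>" "y = g a" by auto
        then show ?thesis using ker by simp
      qed
    qed blast
    then show ?thesis by blast
  qed
  have k: "f x = \<zero> \<longleftrightarrow> g x = \<zero>" if "x \<in> carrier M" for x using ker that by blast
  obtain a where a: "a \<in> carrier R" "\<forall>x\<in>carrier M. g x = f x \<otimes> a" using ex[OF f g] k by blast
  obtain b where b: "b \<in> carrier R" "\<forall>x\<in>carrier M. f x = g x \<otimes> b" using ex[OF g f] k by blast
  note fc = M.hom_regular(1)[OF f]
  let ?B = "rann R (f ` carrier M)"
  have B: "right_ideal ?B R" using fc by (intro right_ideal_rann) auto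
  have mem: "\<one> \<ominus> a \<otimes> b \<in> ?B"
  proof -
    have "f x \<otimes> (\<one> \<ominus> a \<otimes> b) = \<zero>" if x: "x \<in> carrier M" for x
    proof -
      have "f x \<otimes> (a \<otimes> b) = f x" using a(2) b(2) x a(1) b(1) fc by (metis m_assoc)
      then show ?thesis using fc[OF x] a(1) b(1) by (simp add: r_minus_distr)
    qed
    then show ?thesis using a(1) b(1) by (auto simp: rann_def)
  qed
  have "(\<one> \<ominus> a \<otimes> b) \<oplus> a \<otimes> b = \<one>" using a(1) b(1) minus_add_cancel by simp
  then have one: "a \<otimes> b \<oplus> (\<one> \<ominus> a \<otimes> b) = \<one>" using a(1) b(1) a_comm by simp
  obtain c where c: "c \<in> ?B" "a \<oplus> c \<in> Units R"
    using unit_in_coset[OF left_artin a(1) B b(1) mem one] by blast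
  have "g x = f x \<otimes> (a \<oplus> c)" if x: "x \<in> carrier M" for x
    using a(2) x c(1) fc[OF x] a(1) by (simp add: rann_def r_distr)
  then show ?thesis using c(2) by blast
qed

lemma left_macwilliams:
  assumes bal: balanced
  shows "left_macwilliams R"
  unfolding left_macwilliams_def
proof (intro allI impI, elim conjE)
  fix n :: nat and M N \<phi>
  assume M: "submodule M R (left_power R n)" and N: "submodule N R (left_power R n)"
    and \<phi>: "\<phi> \<in> mod_homs R ((left_power R n)\<lparr>carrier := M\<rparr>) ((left_power R n)\<lparr>carrier := N\<rparr>)"
    and wt: "\<forall>x\<in>M. hamming_weight R n (\<phi> x) = hamming_weight R n x"
  interpret V: left_module R "left_power R n" by (rule left_module_left_power)
  let ?M = "(left_power R n)\<lparr>carrier := M\<rparr>"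
  have MM: "left_module R ?M" by (rule V.submodule_left_module[OF M])
  have Mc: "M \<subseteq> {..<n} \<rightarrow>\<^sub>E carrier R" and Nc: "N \<subseteq> {..<n} \<rightarrow>\<^sub>E carrier R"
    using submoduleD(1)[OF M] submoduleD(1)[OF N] by auto
  have \<phi>N: "\<phi> x \<in> N" if "x \<in> M" for x using \<phi> that by (auto simp: mod_homs_def)
  \<comment> \<open>The coordinates of \<open>x\<close>, followed by those of
    \<open>\<phi> x\<close>. Equal weights mean equally many zeros, so with signs +1 and -1 the
    indicators of their kernels sum to zero.\<close>
  define \<kappa> where "\<kappa> = (\<lambda>i x. if i < n then x i else \<phi> x (i - n))"
  have h1: "(\<lambda>x. x i) \<in> mod_homs R ?M (left_regular R)" if "i < n" for i
    using that Mc by (auto simp: mod_homs_def)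
  have h2: "(\<lambda>x. \<phi> x i) \<in> mod_homs R ?M (left_regular R)" if "i < n" for i
    using that \<phi> \<phi>N Nc by (auto simp: mod_homs_def)
  have hom: "\<kappa> i \<in> mod_homs R ?M (left_regular R)" if "i \<in> {..<2 * n}" for i
    using h1[of i] h2[of "i - n"] that by (cases "i < n") (auto simp: \<kappa>_def)
  have "(\<Sum>i\<in>{..<2 * n}. (if i < n then 1 else - 1) * (if \<kappa> i x = \<zero> then 1 else 0 :: real)) = 0"
    if x: "x \<in> carrier ?M" for x
  proof -
    have "(\<Sum>i\<in>{..<2 * n}. (if i < n then 1 else - 1) * (if \<kappa> i x = \<zero> then 1 else 0 :: real))
        = (\<Sum>i | i \<in> {..<2 * n} \<and> \<kappa> i x = \<zero>. if i < n then 1 else - 1)"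
      by (intro sum.mono_neutral_cong_right) auto
    also have "\<dots> = real (card {i \<in> {..<n}. x i = \<zero>}) - real (card {i \<in> {..<n}. \<phi> x i = \<zero>})"
      unfolding sum_signed_cards by (simp add: \<kappa>_def cong: conj_cong)
    also have "\<dots> = 0"
      using wt x hamming_weight_zeros[of R n x] hamming_weight_zeros[of R n "\<phi> x"] by simp
    finally show ?thesis .
  qed
  note mult = kernel_multiplicity[OF bal MM, of "{..<2 * n}" \<kappa> "\<lambda>i. if i < n then 1 else - 1", OF _ hom this]
  define K1 where "K1 = (\<lambda>i. {x \<in> M. x i = \<zero>})"
  define K2 where "K2 = (\<lambda>i. {x \<in> M. \<phi> x i = \<zero>})"
  have "card {i \<in> {..<n}. K1 i = K} = card {i \<in> {..<n}. K2 i = K}" for K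
  proof -
    have "real (card {i \<in> {..<n}. K1 i = K}) = card {i \<in> {..<n}. K2 i = K}"
      using mult[of K] unfolding sum_signed_cards by (simp add: \<kappa>_def K1_def K2_def cong: conj_cong)
    then show ?thesis by simp
  qed
  then obtain \<sigma> where \<sigma>: "\<sigma> permutes {..<n}" "\<And>i. i \<in> {..<n} \<Longrightarrow> K2 i = K1 (\<sigma> i)"
    using permutation_of_fibre_cards[of "{..<n}" K1 K2] by blast
  have "\<exists>u\<in>Units R. \<forall>x\<in>M. \<phi> x i = x (\<sigma> i) \<otimes> u" if i: "i < n" for i
  proof -
    have "\<sigma> i < n" using permutes_in_image[OF \<sigma>(1), of i] i by simp
    then show ?thesis
      using unit_between_homs[OF MM h1[of "\<sigma> i"] h2[OF i]] \<sigma>(2)[of i] i by (simp add: K1_def K2_def)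
  qed
  then obtain u where u: "\<And>i. i < n \<Longrightarrow> u i \<in> Units R \<and> (\<forall>x\<in>M. \<phi> x i = x (\<sigma> i) \<otimes> u i)" by metis
  have "\<phi> x = Phi_map R n \<sigma> u x" if x: "x \<in> M" for x
  proof
    fix i
    show "\<phi> x i = Phi_map R n \<sigma> u x i"
    proof (cases "i < n")
      case False
      have "\<phi> x \<in> {..<n} \<rightarrow>\<^sub>E carrier R" using \<phi>N[OF x] Nc by blast
      then have "\<phi> x i = undefined" using False PiE_arb[of "\<phi> x" "{..<n}" "\<lambda>_. carrier R" i] by simp
      then show ?thesis using False by (simp add: Phi_map_def)
    next
      case True
      then have "\<phi> x i = x (\<sigma> i) \<otimes> u i" using u x by blast
      then show ?thesis using True by (simp add: Phi_map_def)
    qed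
  qed
  moreover have "u \<in> {..<n} \<rightarrow> Units R" using u by auto
  ultimately show "\<exists>\<sigma> u. \<sigma> permutes {..<n} \<and> u \<in> {..<n} \<rightarrow> Units R \<and> (\<forall>x\<in>M. \<phi> x = Phi_map R n \<sigma> u x)"
    using \<sigma>(1) by (intro exI[of _ \<sigma>] exI[of _ u]) simp
qed

end

section \<open>Right codes as left codes over the opposite ring\<close>

lemma submodule_left_power_opp:
  "submodule M (opp R) (left_power (opp R) n) \<longleftrightarrow> submodule M R (right_power R n)"
  by (simp add: submodule_def subgroup_def submodule_axioms_def left_power_def right_power_def m_inv_def)

lemma mod_homs_left_power_opp:
  "mod_homs (opp R) ((left_power (opp R) n)\<lparr>carrier := M\<rparr>) ((left_power (opp R) n)\<lparr>carrier := N\<rparr>)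
    = mod_homs R ((right_power R n)\<lparr>carrier := M\<rparr>) ((right_power R n)\<lparr>carrier := N\<rparr>)"
  by (simp add: mod_homs_def left_power_def right_power_def)

lemma left_macwilliams_opp: "left_macwilliams (opp R) \<longleftrightarrow> right_macwilliams R"
proof -
  have "hamming_weight (opp R) = hamming_weight R"
    by (simp add: hamming_weight_def hamming_def fun_eq_iff)
  moreover have "Phi_map (opp R) = Psi_map R"
    by (simp add: Phi_map_def Psi_map_def fun_eq_iff)
  ultimately show ?thesis
    by (simp add: left_macwilliams_def right_macwilliams_def submodule_left_power_opp mod_homs_left_power_opp)
qed

lemma image_card_le:
  assumes "finite (g ` C)" "\<And>a b. a \<in> C \<Longrightarrow> b \<in> C \<Longrightarrow> g a = g b \<Longrightarrow> f a = f b"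
  shows "finite (f ` C) \<and> card (f ` C) \<le> card (g ` C)"
proof -
  define h where "h = (\<lambda>y. f (SOME a. a \<in> C \<and> g a = y))"
  have "f a = h (g a)" if "a \<in> C" for a
  proof -
    have "(SOME b. b \<in> C \<and> g b = g a) \<in> C \<and> g (SOME b. b \<in> C \<and> g b = g a) = g a"
      by (rule someI[of _ a]) (use that in simp)
    then have "f (SOME b. b \<in> C \<and> g b = g a) = f a" using assms(2) that by blast
    then show ?thesis by (simp add: h_def)
  qed
  then have "f ` C \<subseteq> h ` g ` C" by blast
  then show ?thesis using assms(1) by (meson card_image_le card_mono finite_imageI finite_subset order_trans)
qed

section \<open>The finite part of the socle\<close>

context ring
begin

text \<open>Agrees with \<open>finitary_left_socle\<close> for left Artinian rings, see
  \<open>finitary_left_socle_eq\<close>. Membership is a condition on a single element, which makes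
  it easy to see that the set is a two-sided ideal.\<close>

definition fin_socle :: "'a set"
  where "fin_socle = {t \<in> rann R J. finite (lprin R t)}"

lemma fin_socle_subset: "fin_socle \<subseteq> rann R J" "fin_socle \<subseteq> carrier R"
  by (auto simp: fin_socle_def rann_def)

lemma left_ideal_fin_socle: "left_ideal fin_socle R"
proof (rule left_idealI)
  have T: "left_ideal (rann R J) R" by (rule left_ideal_rann) simp
  note Td = left_idealD[OF T]
  show "fin_socle \<subseteq> carrier R" by (rule fin_socle_subset)
  have "lprin R \<zero> = {\<zero>}" by (auto simp: lprin_def)
  then show "\<zero> \<in> fin_socle" using Td(3) by (simp add: fin_socle_def)
  show "x \<oplus> y \<in> fin_socle" if xy: "x \<in> fin_socle" "y \<in> fin_socle" for x y
  proof -
    have c: "x \<in> carrier R" "y \<in> carrier R" using xy fin_socle_subset by auto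
    have "lprin R (x \<oplus> y) \<subseteq> (\<lambda>(a, b). a \<oplus> b) ` (lprin R x \<times> lprin R y)"
      using c by (auto simp: lprin_def r_distr image_iff)
    moreover have "finite ((\<lambda>(a, b). a \<oplus> b) ` (lprin R x \<times> lprin R y))"
      using xy by (simp add: fin_socle_def)
    ultimately have "finite (lprin R (x \<oplus> y))" by (rule finite_subset)
    then show ?thesis using xy Td(4) by (simp add: fin_socle_def)
  qed
  show "a \<otimes> x \<in> fin_socle" if a: "a \<in> carrier R" and x: "x \<in> fin_socle" for a x
  proof -
    have c: "x \<in> carrier R" using x fin_socle_subset by auto
    have "lprin R (a \<otimes> x) \<subseteq> lprin R x" by (rule lprin_least[OF left_ideal_lprin[OF c]]) (use a in \<open>auto simp: lprin_def\<close>)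
    then have "finite (lprin R (a \<otimes> x))" using x finite_subset by (auto simp: fin_socle_def)
    then show ?thesis using x a Td(5) by (simp add: fin_socle_def)
  qed
qed

lemma fin_socle_right_closed:
  assumes t: "t \<in> fin_socle" and a: "a \<in> carrier R"
  shows "t \<otimes> a \<in> fin_socle"
proof -
  have c: "t \<in> carrier R" using t fin_socle_subset by auto
  have "lprin R (t \<otimes> a) = (\<lambda>y. y \<otimes> a) ` lprin R t"
    using c a by (auto simp: lprin_def m_assoc image_iff)
  then have "finite (lprin R (t \<otimes> a))" using t by (simp add: fin_socle_def)
  moreover have "right_ideal (rann R J) R" using jac_subset by simp
  ultimately show ?thesis using t a right_idealD(5) by (simp add: fin_socle_def)
qed

lemma right_ideal_fin_socle: "right_ideal fin_socle R"
  using left_idealD[OF left_ideal_fin_socle] fin_socle_right_closed by (intro right_idealI) auto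

end

section \<open>Self-injective rings with both chain conditions\<close>

locale quasi_frobenius_ring = left_selfinjective +
  assumes right_artin: "right_artinian R"
begin

text \<open>The two double annihilator conditions are interchanged by passing to the opposite ring,
  and together with the chain condition they give self-injectivity back.\<close>

lemma opp_selfinjective: "left_selfinjective (opp R)"
  unfolding left_selfinjective_def left_selfinjective_axioms_def
proof (intro conjI)
  show "linj (opp R)"
    by (rule ring.linj_of_double_annihilator[OF ring_opp]) (simp_all add: left_artin rann_lann lann_rann)
qed (simp_all add: ring_opp right_artin)

text \<open>There is a maximal finite right ideal, and by sums it absorbs every other. Each multiple
  rx generates a finite right ideal, an image of xR, so all of Rx lies in it.\<close>

lemma finite_lprin_of_finite_rprin:
  assumes x: "x \<in> carrier R" and fin: "finite (rprin R x)"
  shows "finite (lprin R x)"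
proof -
  let ?P = "\<lambda>Y. right_ideal Y R \<and> finite Y"
  have P0: "?P {\<zero>}" by simp
  have PI: "\<And>Y. ?P Y \<Longrightarrow> right_ideal Y R" by simp
  obtain Y where Y: "right_ideal Y R" "finite Y" and max: "\<forall>Z. ?P Z \<longrightarrow> Y \<subseteq> Z \<longrightarrow> Z = Y"
    using right_ideal_maximal_image[of ?P "{\<zero>}" "\<lambda>Y. Y", OF P0 PI] by blast
  have "r \<otimes> x \<in> Y" if r: "r \<in> carrier R" for r
  proof -
    let ?Z = "Y <+>\<^bsub>R\<^esub> rprin R (r \<otimes> x)"
    have rx: "r \<otimes> x \<in> carrier R" using r x by simp
    have "rprin R (r \<otimes> x) = (\<lambda>y. r \<otimes> y) ` rprin R x"
      using r x by (auto simp: rprin_def m_assoc image_iff)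
    then have "finite ?Z" using fin Y(2) by (auto simp: set_add_def set_mult_def)
    moreover have "right_ideal ?Z R" using right_ideal_sum Y(1) rx by simp
    moreover have up: "Y \<subseteq> ?Z" "rprin R (r \<otimes> x) \<subseteq> ?Z"
      using ring.set_add_upper[OF ring_opp, of Y "rprin R (r \<otimes> x)"] Y(1) rx by simp_all
    ultimately have "?Z = Y" using max by blast
    then show ?thesis using up rprin_self[OF rx] by blast
  qed
  then have "lprin R x \<subseteq> Y" by (auto simp: lprin_def)
  then show ?thesis using Y(2) finite_subset by blast
qed

lemma lann_jac: "lann R J = T"
  using lann_rann[OF left_ideal_T] rann_T by simp

lemma opp_balanced:
  assumes balanced
  shows "left_selfinjective.balanced (opp R)"
  unfolding left_selfinjective.balanced_def[OF opp_selfinjective]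
proof (intro ballI impI)
  fix x assume x: "x \<in> rann (opp R) (jacobson_radical (opp R))" and fin: "finite (lprin (opp R) x)"
  have xT: "x \<in> T" using x lann_jac by simp
  then have "x \<in> carrier R" by (simp add: rann_def)
  then have "finite (lprin R x)" using finite_lprin_of_finite_rprin fin by simp
  then show "card (rprin (opp R) x) = card (lprin (opp R) x)"
    using assms xT by (simp add: balanced_def)
qed

text \<open>Maximality among finite left ideals comes from the ascending chain condition, obtained
  in the opposite ring; the maximal one absorbs each finite cyclic left ideal.\<close>

lemma finite_fin_socle: "finite fin_socle"
proof -
  let ?P = "\<lambda>Y. left_ideal Y R \<and> finite Y"
  have P0: "?P {\<zero>}" by simp
  have PI: "\<And>Y. ?P Y \<Longrightarrow> right_ideal Y (opp R)" by simp
  have "\<exists>Y. ?P Y \<and> (\<forall>Z. ?P Z \<longrightarrow> Y \<subseteq> Z \<longrightarrow> Z = Y)"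
    by (rule left_selfinjective.right_ideal_maximal_image[OF opp_selfinjective, of ?P "{\<zero>}" "\<lambda>Y. Y", OF P0 PI])
  then obtain Y where Y: "left_ideal Y R" "finite Y" and max: "\<forall>Z. ?P Z \<longrightarrow> Y \<subseteq> Z \<longrightarrow> Z = Y"
    by (elim exE conjE)
  have "t \<in> Y" if t: "t \<in> fin_socle" for t
  proof -
    have tc: "t \<in> carrier R" "finite (lprin R t)" using t fin_socle_subset by (auto simp: fin_socle_def)
    let ?Z = "Y <+>\<^bsub>R\<^esub> lprin R t"
    have "finite ?Z" using tc(2) Y(2) by (auto simp: set_add_def set_mult_def)
    moreover have "left_ideal ?Z R" using left_ideal_sum Y(1) tc by simp
    moreover have up: "Y \<subseteq> ?Z" "lprin R t \<subseteq> ?Z" using set_add_upper[OF Y(1)] tc by simp_all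
    ultimately have "?Z = Y" using max by blast
    then show ?thesis using up lprin_self[OF tc(1)] by blast
  qed
  then have "fin_socle \<subseteq> Y" by (rule subsetI)
  then show ?thesis using Y(2) by (rule finite_subset)
qed

text \<open>Both annihilators of the finite socle are the smallest two-sided ideal of finite index that
  contains \<open>J\<close>.\<close>

lemma lann_fin_socle: "lann R fin_socle = rann R fin_socle"
proof
  let ?F = "fin_socle"
  have Fl: "left_ideal ?F R" and Fr: "right_ideal ?F R"
    by (rule left_ideal_fin_socle, rule right_ideal_fin_socle)
  have FT: "?F \<subseteq> T" and Fc: "?F \<subseteq> carrier R" by (rule fin_socle_subset)+
  let ?V = "lann R ?F" and ?W = "rann R ?F"
  have JV: "J \<subseteq> ?V" using FT jac_subset by (auto simp: lann_def rann_def subset_iff)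
  have JW: "J \<subseteq> ?W" using FT rann_T rann_antimono by blast
  have V: "right_ideal ?V R" using right_ideal_lann[OF Fl] .
  have W: "left_ideal ?W R" using left_ideal_rann[OF Fr] .
  have "lann R ?V \<subseteq> ?F"
  proof
    fix t assume t: "t \<in> lann R ?V"
    have tc: "t \<in> carrier R" using t by (simp add: lann_def)
    have tT: "t \<in> T" using t lann_antimono[OF JV] lann_jac by blast
    \<comment> \<open>There are only finitely many left multiplications on the finite set
      \<open>?F\<close>, and \<open>t \<otimes> a\<close> depends only on the one induced by
      \<open>a\<close>, so tR is finite.\<close>
    have "(\<lambda>a. \<lambda>s\<in>?F. a \<otimes> s) ` carrier R \<subseteq> ?F \<rightarrow>\<^sub>E ?F" using left_idealD(5)[OF Fl] by auto
    then have "finite ((\<lambda>a. \<lambda>s\<in>?F. a \<otimes> s) ` carrier R)"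
      by (rule finite_subset) (simp add: finite_fin_socle finite_PiE)
    moreover have "t \<otimes> a = t \<otimes> b"
      if ab: "a \<in> carrier R" "b \<in> carrier R" "(\<lambda>s\<in>?F. a \<otimes> s) = (\<lambda>s\<in>?F. b \<otimes> s)" for a b
    proof -
      have "a \<otimes> s = b \<otimes> s" if "s \<in> ?F" for s using fun_cong[OF ab(3), of s] that by simp
      then have "a \<ominus> b \<in> ?V" using ab Fc by (auto simp: lann_def l_minus_distr)
      then have "t \<otimes> (a \<ominus> b) = \<zero>" using t by (simp add: lann_def)
      then show ?thesis using ab tc by (simp add: r_minus_distr)
    qed
    ultimately have "finite (rprin R t)"
      unfolding rprin_def using image_card_le[of "\<lambda>a. \<lambda>s\<in>?F. a \<otimes> s" "carrier R" "\<lambda>a. t \<otimes> a"] by blast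
    then show "t \<in> ?F" using finite_lprin_of_finite_rprin tc tT by (simp add: fin_socle_def)
  qed
  then show "?W \<subseteq> ?V" using rann_antimono rann_lann[OF V] by blast
  have "rann R ?W \<subseteq> ?F"
  proof
    fix t assume t: "t \<in> rann R ?W"
    have tc: "t \<in> carrier R" using t by (simp add: rann_def)
    have tT: "t \<in> T" using t rann_antimono[OF JW] by blast
    have "(\<lambda>a. \<lambda>s\<in>?F. s \<otimes> a) ` carrier R \<subseteq> ?F \<rightarrow>\<^sub>E ?F" using fin_socle_right_closed by auto
    then have "finite ((\<lambda>a. \<lambda>s\<in>?F. s \<otimes> a) ` carrier R)"
      by (rule finite_subset) (simp add: finite_fin_socle finite_PiE)
    moreover have "a \<otimes> t = b \<otimes> t"
      if ab: "a \<in> carrier R" "b \<in> carrier R" "(\<lambda>s\<in>?F. s \<otimes> a) = (\<lambda>s\<in>?F. s \<otimes> b)" for a b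
    proof -
      have "s \<otimes> a = s \<otimes> b" if "s \<in> ?F" for s using fun_cong[OF ab(3), of s] that by simp
      then have "a \<ominus> b \<in> ?W" using ab Fc by (auto simp: rann_def r_minus_distr)
      then have "(a \<ominus> b) \<otimes> t = \<zero>" using t by (simp add: rann_def)
      then show ?thesis using ab tc by (simp add: l_minus_distr)
    qed
    ultimately have "finite (lprin R t)"
      unfolding lprin_def using image_card_le[of "\<lambda>a. \<lambda>s\<in>?F. s \<otimes> a" "carrier R" "\<lambda>a. a \<otimes> t"] by blast
    then show "t \<in> ?F" using tT by (simp add: fin_socle_def)
  qed
  then show "?V \<subseteq> ?W" using lann_antimono lann_rann[OF W] by blast
qed

text \<open>In the semisimple quotient left and right principal ideals are equipollent, and the
  embedding turns this into the inequality of yR against Ry. Hence no left ideal inside the finite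
  socle has a dual larger than itself. The finite socle has one at least as large: it is cyclic,
  equal to Rx, and ax depends only on the right multiplication by \<open>a\<close> on it, by
  \<open>lann_fin_socle\<close>. Equality for the whole forces equality for each summand Ry.\<close>

lemma balanced_of_embedding:
  assumes emb: "embeds_in R ((left_regular R)\<lparr>carrier := fin_socle\<rparr>) (left_quotient R J)"
  shows balanced
proof -
  let ?F = "fin_socle" and ?Q = "R Quot J"
  interpret h: ring_hom_ring R ?Q "(+>) J" by (rule quot_hom)
  interpret Q: semisimple_ring ?Q by (rule semisimple_quot[OF left_artin])
  have Fl: "left_ideal ?F R" by (rule left_ideal_fin_socle)
  note Fd = left_idealD[OF Fl]
  obtain f where f: "f \<in> mod_homs R ((left_regular R)\<lparr>carrier := ?F\<rparr>) (left_quotient R J)" and inj: "inj_on f ?F"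
    using emb by (auto simp: embeds_in_def)
  have fc: "f x \<in> carrier ?Q" if "x \<in> ?F" for x
    using f that by (auto simp: mod_homs_def left_quotient_def)
  have fadd: "f (x \<oplus> y) = f x \<oplus>\<^bsub>?Q\<^esub> f y" if "x \<in> ?F" "y \<in> ?F" for x y
    using f that by (auto simp: mod_homs_def left_quotient_def)
  have fmult: "f (a \<otimes> x) = (J +> a) \<otimes>\<^bsub>?Q\<^esub> f x" if "a \<in> carrier R" "x \<in> ?F" for a x
    using f that by (auto simp: mod_homs_def left_quotient_def)
  have f0: "f \<zero> = \<zero>\<^bsub>?Q\<^esub>"
    using fmult[of \<zero> \<zero>] Fd(3) fc[OF Fd(3)] h.hom_zero by simp
  have fz: "x = \<zero>" if "x \<in> ?F" "f x = \<zero>\<^bsub>?Q\<^esub>" for x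
    using inj that f0 Fd(3) by (auto simp: inj_on_def)
  have flprin: "lprin ?Q (f y) = f ` lprin R y" if y: "y \<in> ?F" for y
  proof -
    have "f ` lprin R y = (\<lambda>a. (J +> a) \<otimes>\<^bsub>?Q\<^esub> f y) ` carrier R"
      unfolding lprin_def image_image using fmult y by (intro image_cong) auto
    then show ?thesis by (simp add: lprin_def quot_carrier image_image)
  qed
  have le: "finite (rprin R y) \<and> card (rprin R y) \<le> card (lprin R y)"
    if y: "y \<in> T" "finite (lprin R y)" for y
  proof -
    have yF: "y \<in> ?F" using y by (simp add: fin_socle_def)
    have yc: "y \<in> carrier R" using yF Fd by blast
    have sub: "rprin R y \<subseteq> ?F" using fin_socle_right_closed yF by (auto simp: rprin_def)
    have lsub: "lprin R y \<subseteq> ?F" using lprin_least[OF Fl yF] .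
    \<comment> \<open>Nothing is known about \<open>f\<close> and right multiplication. But
      \<open>f\<close> is injective and left linear, so it transports the inclusion of left
      annihilators, which suffices in a semisimple ring.\<close>
    have "f z \<in> rprin ?Q (f y)" if z: "z \<in> rprin R y" for z
    proof (rule Q.rprin_of_lann_subset)
      show "f y \<in> carrier ?Q" "f z \<in> carrier ?Q" using fc yF z sub by auto
      obtain a where a: "a \<in> carrier R" "z = y \<otimes> a" using z by (auto simp: rprin_def)
      show "lann ?Q {f y} \<subseteq> lann ?Q {f z}"
      proof
        fix C assume C: "C \<in> lann ?Q {f y}"
        then have Cc: "C \<in> carrier ?Q" and C0: "C \<otimes>\<^bsub>?Q\<^esub> f y = \<zero>\<^bsub>?Q\<^esub>" by (auto simp: lann_def)
        obtain r where r: "r \<in> carrier R" "C = J +> r" using Cc quot_carrier by auto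
        have "f (r \<otimes> y) = \<zero>\<^bsub>?Q\<^esub>" using fmult[OF r(1) yF] C0 r(2) by simp
        then have "r \<otimes> y = \<zero>" using fz Fd(5) r(1) yF by blast
        then have "r \<otimes> z = \<zero>" using a r(1) yc by (simp add: m_assoc[symmetric])
        then have "C \<otimes>\<^bsub>?Q\<^esub> f z = \<zero>\<^bsub>?Q\<^esub>" using fmult[OF r(1), of z] z sub f0 r(2) by auto
        then show "C \<in> lann ?Q {f z}" using Cc by (simp add: lann_def)
      qed
    qed
    then have img: "f ` rprin R y \<subseteq> rprin ?Q (f y)" by blast
    have e: "lprin ?Q (f y) \<approx> rprin ?Q (f y)" using Q.lprin_eqpoll_rprin[OF fc[OF yF]] .
    have fin: "finite (rprin ?Q (f y))"
      using eqpoll_finite_iff[OF e] flprin[OF yF] y(2) by simp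
    have injr: "inj_on f (rprin R y)" and injl: "inj_on f (lprin R y)"
      using inj sub lsub inj_on_subset by blast+
    have "finite (f ` rprin R y)" using img fin finite_subset by blast
    then have "finite (rprin R y)" using injr finite_imageD by blast
    moreover have "card (rprin R y) \<le> card (rprin ?Q (f y))"
      using card_mono[OF fin img] card_image[OF injr] by simp
    moreover have "card (rprin ?Q (f y)) = card (lprin R y)"
      using eqpoll_card[OF e] flprin[OF yF] card_image[OF injl] by simp
    ultimately show ?thesis by simp
  qed
  have mle: "finite (mults R U) \<and> card (mults R U) \<le> card U"
    if "left_ideal U R" "U \<subseteq> ?F" for U
  proof (rule card_mults_rel[of "(\<le>)"])
    show "finite U" using that(2) finite_fin_socle finite_subset by blast
    show "U \<subseteq> T" using that(2) fin_socle_subset by blast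
  qed (use le that mult_le_mono in auto)
  have imF: "left_ideal (f ` ?F) ?Q"
  proof (rule h.S.left_idealI)
    show "f ` ?F \<subseteq> carrier ?Q" using fc by auto
    show "\<zero>\<^bsub>?Q\<^esub> \<in> f ` ?F" using f0 Fd(3) by (metis imageI)
    show "x \<oplus>\<^bsub>?Q\<^esub> y \<in> f ` ?F" if xy: "x \<in> f ` ?F" "y \<in> f ` ?F" for x y
      using xy fadd Fd(4) by (auto simp: image_iff intro!: bexI[of _ "_ \<oplus> _"])
    show "C \<otimes>\<^bsub>?Q\<^esub> x \<in> f ` ?F" if C: "C \<in> carrier ?Q" and x: "x \<in> f ` ?F" for C x
    proof -
      obtain r where r: "r \<in> carrier R" "C = J +> r" using C quot_carrier by auto
      obtain s where s: "s \<in> ?F" "x = f s" using x by blast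
      show ?thesis using fmult[OF r(1) s(1)] Fd(5)[OF r(1) s(1)] r s by (intro image_eqI[of _ _ "r \<otimes> s"]) auto
    qed
  qed
  \<comment> \<open>The image of the finite socle has an idempotent generator, whose preimage
    \<open>x\<close> generates the finite socle.\<close>
  obtain e where e: "e \<in> f ` ?F" "\<forall>z\<in>f ` ?F. z \<otimes>\<^bsub>?Q\<^esub> e = z" using Q.idempotent_generator[OF imF] by blast
  obtain x where x: "x \<in> ?F" "e = f x" using e(1) by blast
  have xc: "x \<in> carrier R" using x Fd by blast
  have Fx: "lprin R x = ?F"
  proof
    show "lprin R x \<subseteq> ?F" using lprin_least[OF Fl x(1)] .
    show "?F \<subseteq> lprin R x"
    proof
      fix t assume t: "t \<in> ?F"
      obtain r where r: "r \<in> carrier R" "f t = J +> r" using fc[OF t] quot_carrier by auto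
      have "f (r \<otimes> x) = f t" using fmult[OF r(1) x(1)] e(2) t r(2) x(2) by auto
      then have "r \<otimes> x = t" using inj t Fd(5)[OF r(1) x(1)] by (auto simp: inj_on_def)
      then show "t \<in> lprin R x" using r(1) by (auto simp: lprin_def)
    qed
  qed
  have Fc: "?F \<subseteq> carrier R" by (rule fin_socle_subset)
  have diffV: "a \<ominus> b \<in> lann R ?F \<longleftrightarrow> (\<forall>s\<in>?F. a \<otimes> s = b \<otimes> s)"
    and diffW: "a \<ominus> b \<in> rann R ?F \<longleftrightarrow> (\<forall>s\<in>?F. s \<otimes> a = s \<otimes> b)"
    if "a \<in> carrier R" "b \<in> carrier R" for a b
    using that Fc by (auto simp: lann_def rann_def l_minus_distr r_minus_distr subset_iff)
  have key: "card ?F \<le> card (mults R ?F)"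
  proof -
    have "finite (mults R ?F)" using mle[OF Fl] by blast
    moreover have "a \<otimes> x = b \<otimes> x"
      if ab: "a \<in> carrier R" "b \<in> carrier R" and eq: "(\<lambda>s\<in>?F. s \<otimes> a) = (\<lambda>s\<in>?F. s \<otimes> b)" for a b
    proof -
      have "\<forall>s\<in>?F. s \<otimes> a = s \<otimes> b" using eq restrict_mult_eq_iff by blast
      then have "a \<ominus> b \<in> lann R ?F" using diffW[OF ab] lann_fin_socle by simp
      then show ?thesis using diffV[OF ab] x(1) by blast
    qed
    ultimately have "card (lprin R x) \<le> card (mults R ?F)"
      unfolding lprin_def mults_def using image_card_le[of "\<lambda>a. \<lambda>s\<in>?F. s \<otimes> a" "carrier R" "\<lambda>a. a \<otimes> x"] by blast
    then show ?thesis using Fx by simp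
  qed
  show balanced
    unfolding balanced_def
  proof (intro ballI impI)
    fix y assume y: "y \<in> T" "finite (lprin R y)"
    have yF: "y \<in> ?F" using y by (simp add: fin_socle_def)
    have yc: "y \<in> carrier R" using yF Fd by blast
    obtain V where V: "left_ideal V R" "V \<subseteq> ?F" "lprin R y \<inter> V = {\<zero>}" "lprin R y <+>\<^bsub>R\<^esub> V = ?F"
      using complement_in_annihilator[OF left_artin Fl fin_socle_subset(1) finite_fin_socle _ lprin_least[OF Fl yF]]
        yc by auto
    have finV: "finite V" using V(2) finite_fin_socle finite_subset by blast
    then have pos: "card V > 0" using left_idealD(3)[OF V(1)] card_gt_0_iff by blast
    have "card (lprin R y) * card V = card ?F"
      using card_set_add[of "lprin R y" V] V yc by simp
    also have "\<dots> \<le> card (mults R (lprin R y)) * card (mults R V)"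
      using key eqpoll_card[OF mults_set_add[OF left_ideal_lprin[OF yc] V(1,3)]] V(4)
      by (simp add: card_cartesian_product)
    also have "card (mults R (lprin R y)) = card (rprin R y)" using eqpoll_card[OF mults_lprin[OF yc]] .
    also have "card (rprin R y) * card (mults R V) \<le> card (rprin R y) * card V"
      using mle[OF V(1,2)] by simp
    finally have "card (lprin R y) \<le> card (rprin R y)" using pos by simp
    then show "card (rprin R y) = card (lprin R y)" using le[OF y] by simp
  qed
qed

end

section \<open>Injectivity and the finitary socle\<close>

lemma linj_of_left_injective:
  fixes R :: "('a, 'r) ring_scheme" (structure)
  assumes "ring R" and inj: "left_injective TYPE('a + 'x) R (left_regular R)"
  shows "linj R"
proof -
  interpret ring R by fact
  \<comment> \<open>The regular module, copied into the left summand of the type over which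
    \<open>left_injective\<close> quantifies.\<close>
  define M :: "('a, 'a + 'x) module" where "M =
    \<lparr>carrier = Inl ` carrier R, monoid.mult = (\<lambda>x y. x), one = Inl \<one>, ring.zero = Inl \<zero>,
     ring.add = (\<lambda>x y. Inl (projl x \<oplus> projl y)), smult = (\<lambda>a x. Inl (a \<otimes> projl x))\<rparr>"
  have sel [simp]: "carrier M = Inl ` carrier R" "\<zero>\<^bsub>M\<^esub> = Inl \<zero>"
    "x \<oplus>\<^bsub>M\<^esub> y = Inl (projl x \<oplus> projl y)" "a \<odot>\<^bsub>M\<^esub> x = Inl (a \<otimes> projl x)" for x y a
    by (simp_all add: M_def)
  have ab: "abelian_group M"
  proof (rule abelian_groupI)
    fix x assume "x \<in> carrier M"
    then obtain r where "r \<in> carrier R" "x = Inl r" by auto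
    then show "\<exists>y\<in>carrier M. y \<oplus>\<^bsub>M\<^esub> x = \<zero>\<^bsub>M\<^esub>" by (intro bexI[of _ "Inl (\<ominus> r)"]) (auto simp: l_neg)
  qed (auto simp: a_ac)
  have M: "left_module R M"
    unfolding left_module_def left_module_axioms_def using ab ring_axioms
    by (auto simp: l_distr r_distr m_assoc)
  interpret M: left_module R M by (rule M)
  show ?thesis
    unfolding linj_def
  proof (intro allI impI)
    fix L f
    assume L: "left_ideal L R" and f: "f \<in> L \<rightarrow> carrier R"
      and fadd: "\<forall>x\<in>L. \<forall>y\<in>L. f (x \<oplus> y) = f x \<oplus> f y"
      and fmult: "\<forall>a\<in>carrier R. \<forall>x\<in>L. f (a \<otimes> x) = a \<otimes> f x"
    note Ld = left_idealD[OF L]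
    have "submodule (Inl ` L) R M"
    proof -
      have inv: "inv\<^bsub>add_monoid M\<^esub> (Inl x) = Inl (\<ominus> x)" if "x \<in> carrier R" for x
      proof -
        have "Inl (\<ominus> x) = \<ominus>\<^bsub>M\<^esub> (Inl x :: 'a + 'x)"
          by (rule M.minus_equality[symmetric]) (use that in \<open>auto simp: l_neg\<close>)
        then show ?thesis by (simp add: a_inv_def)
      qed
      then show ?thesis
        using Ld by (auto simp: submodule_def subgroup_def submodule_axioms_def)
    qed
    moreover have "f \<circ> projl \<in> mod_homs R (M\<lparr>carrier := Inl ` L\<rparr>) (left_regular R)"
      using f fadd fmult by (auto simp: mod_homs_def)
    ultimately obtain g where g: "g \<in> mod_homs R M (left_regular R)" "\<forall>x\<in>Inl ` L. g x = (f \<circ> projl) x"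
      using inj M unfolding left_injective_def by blast
    have "f x = x \<otimes> g (Inl \<one>)" if x: "x \<in> L" for x
    proof -
      have xc: "x \<in> carrier R" using x Ld by blast
      have "f x = g (Inl x)" using g(2) x by simp
      also have "\<dots> = g (x \<odot>\<^bsub>M\<^esub> Inl \<one>)" using xc by simp
      also have "\<dots> = x \<otimes> g (Inl \<one>)" by (rule M.hom_regular(5)[OF g(1) xc]) simp
      finally show ?thesis .
    qed
    moreover have "g (Inl \<one>) \<in> carrier R" by (rule M.hom_regular(1)[OF g(1)]) simp
    ultimately show "\<exists>c\<in>carrier R. \<forall>x\<in>L. f x = x \<otimes> c" by blast
  qed
qed

text \<open>Baer's criterion: Zorn's lemma for graphs of partial homomorphisms.\<close>

lemma left_injective_of_linj:
  fixes R :: "('a, 'r) ring_scheme" (structure) and U :: "'m itself"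
  assumes "ring R" and "linj R"
  shows "left_injective U R (left_regular R)"
  unfolding left_injective_def
proof (intro allI impI, elim conjE)
  interpret ring R by fact
  fix M :: "('a, 'm) module" and L f
  assume M: "left_module R M" and L: "submodule L R M"
    and f: "f \<in> mod_homs R (M\<lparr>carrier := L\<rparr>) (left_regular R)"
  interpret M: left_module R M by (rule M)
  interpret L: left_module R "M\<lparr>carrier := L\<rparr>" by (rule M.submodule_left_module[OF L])
  note F = L.hom_regular[OF f, simplified]
  note Ls = submoduleD[OF L]
  define ok where "ok = (\<lambda>G. (\<lambda>x. (x, f x)) ` L \<subseteq> G \<and> G \<subseteq> carrier M \<times> carrier R \<and>
    (\<forall>p\<in>G. \<forall>q\<in>G. (fst p \<oplus>\<^bsub>M\<^esub> fst q, snd p \<oplus> snd q) \<in> G) \<and>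
    (\<forall>a\<in>carrier R. \<forall>p\<in>G. (a \<odot>\<^bsub>M\<^esub> fst p, a \<otimes> snd p) \<in> G) \<and> (\<forall>y. (\<zero>\<^bsub>M\<^esub>, y) \<in> G \<longrightarrow> y = \<zero>))"
  have ok0: "ok ((\<lambda>x. (x, f x)) ` L)"
    unfolding ok_def using F Ls by (auto simp: image_iff)
  have "\<exists>G\<in>Collect ok. \<forall>H\<in>Collect ok. G \<subseteq> H \<longrightarrow> H = G"
  proof (rule subset_Zorn_nonempty)
    show "Collect ok \<noteq> {}" using ok0 by blast
    fix C assume C: "C \<noteq> {}" "subset.chain (Collect ok) C"
    have sub: "\<And>G. G \<in> C \<Longrightarrow> ok G" and lin: "\<And>G H. G \<in> C \<Longrightarrow> H \<in> C \<Longrightarrow> G \<subseteq> H \<or> H \<subseteq> G"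
      using C(2) by (auto simp: subset_chain_def)
    have "ok (\<Union>C)"
      unfolding ok_def
    proof (intro conjI ballI allI impI)
      show "(\<lambda>x. (x, f x)) ` L \<subseteq> \<Union>C" using C(1) sub unfolding ok_def by blast
      show "\<Union>C \<subseteq> carrier M \<times> carrier R" using sub unfolding ok_def by blast
      show "(fst p \<oplus>\<^bsub>M\<^esub> fst q, snd p \<oplus> snd q) \<in> \<Union>C" if pq: "p \<in> \<Union>C" "q \<in> \<Union>C" for p q
      proof -
        obtain G H where "G \<in> C" "H \<in> C" "p \<in> G" "q \<in> H" using pq by blast
        then obtain K where "K \<in> C" "p \<in> K" "q \<in> K" using lin[of G H] by blast
        then show ?thesis using sub[of K] unfolding ok_def by blast
      qed
      show "(a \<odot>\<^bsub>M\<^esub> fst p, a \<otimes> snd p) \<in> \<Union>C" if "a \<in> carrier R" "p \<in> \<Union>C" for a p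
        using that sub unfolding ok_def by blast
      show "y = \<zero>" if "(\<zero>\<^bsub>M\<^esub>, y) \<in> \<Union>C" for y using that sub unfolding ok_def by blast
    qed
    then show "\<Union>C \<in> Collect ok" by simp
  qed
  then obtain G where G: "ok G" and Gmax: "\<And>H. ok H \<Longrightarrow> G \<subseteq> H \<Longrightarrow> H = G" by auto
  have Gf: "(x, f x) \<in> G" if "x \<in> L" for x using G that unfolding ok_def by blast
  have Gc: "x \<in> carrier M" "y \<in> carrier R" if "(x, y) \<in> G" for x y using G that unfolding ok_def by blast+
  have Gadd: "(x \<oplus>\<^bsub>M\<^esub> x', y \<oplus> y') \<in> G" if "(x, y) \<in> G" "(x', y') \<in> G" for x y x' y'
    using G that unfolding ok_def by (metis fst_conv snd_conv)
  have Gmult: "(a \<odot>\<^bsub>M\<^esub> x, a \<otimes> y) \<in> G" if "a \<in> carrier R" "(x, y) \<in> G" for a x y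
    using G that unfolding ok_def by (metis fst_conv snd_conv)
  have Gz: "y = \<zero>" if "(\<zero>\<^bsub>M\<^esub>, y) \<in> G" for y using G that unfolding ok_def by blast
  have G0: "(\<zero>\<^bsub>M\<^esub>, \<zero>) \<in> G" using Gf[OF Ls(2)] F(2) by simp
  have total: "\<exists>y. (x, y) \<in> G" if x: "x \<in> carrier M" for x
  proof -
    \<comment> \<open>The scalars that carry \<open>x\<close> into the domain of \<open>G\<close>,
      with the values prescribed there. Baer's test yields an admissible value \<open>c\<close> for
      \<open>x\<close> itself.\<close>
    let ?H = "{(r, y). r \<in> carrier R \<and> (r \<odot>\<^bsub>M\<^esub> x, y) \<in> G}"
    obtain c where c: "c \<in> carrier R" "\<And>r y. (r, y) \<in> ?H \<Longrightarrow> y = r \<otimes> c"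
    proof (rule linj_graph[OF assms(2), of ?H])
      show "?H \<subseteq> carrier R \<times> carrier R" using Gc by auto
      show "(\<zero>, \<zero>) \<in> ?H" using G0 M.zero_smult[OF x] by simp
      show "(r \<oplus> r', y \<oplus> y') \<in> ?H" if "(r, y) \<in> ?H" "(r', y') \<in> ?H" for r y r' y'
        using that Gadd M.smult_l_distr[OF _ _ x] by auto
      show "(a \<otimes> r, a \<otimes> y) \<in> ?H" if "a \<in> carrier R" "(r, y) \<in> ?H" for a r y
        using that Gmult M.smult_assoc[OF _ _ x] by auto
      show "y = \<zero>" if "(\<zero>, y) \<in> ?H" for y using that Gz M.zero_smult[OF x] by simp
    qed blast
    let ?G = "(\<lambda>((d, y), r). (d \<oplus>\<^bsub>M\<^esub> r \<odot>\<^bsub>M\<^esub> x, y \<oplus> r \<otimes> c)) ` (G \<times> carrier R)"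
    have mem: "(d \<oplus>\<^bsub>M\<^esub> r \<odot>\<^bsub>M\<^esub> x, y \<oplus> r \<otimes> c) \<in> ?G" if "(d, y) \<in> G" "r \<in> carrier R" for d y r
      using that by (intro image_eqI[of _ _ "((d, y), r)"]) auto
    have memE: "\<exists>d y r. (d, y) \<in> G \<and> r \<in> carrier R \<and> p = (d \<oplus>\<^bsub>M\<^esub> r \<odot>\<^bsub>M\<^esub> x, y \<oplus> r \<otimes> c)" if "p \<in> ?G" for p
      using that by fast
    have sub: "G \<subseteq> ?G"
    proof
      fix p assume p: "p \<in> G"
      obtain d y where dy: "p = (d, y)" by (cases p)
      have "(d \<oplus>\<^bsub>M\<^esub> \<zero> \<odot>\<^bsub>M\<^esub> x, y \<oplus> \<zero> \<otimes> c) \<in> ?G" using mem p dy by blast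
      then show "p \<in> ?G" using Gc p dy c(1) M.zero_smult[OF x] by simp
    qed
    have "ok ?G"
      unfolding ok_def
    proof (intro conjI ballI allI impI)
      show "(\<lambda>x. (x, f x)) ` L \<subseteq> ?G" using Gf sub by blast
      show "?G \<subseteq> carrier M \<times> carrier R" using Gc M.smult_closed x c(1) by auto
      show "(fst p \<oplus>\<^bsub>M\<^esub> fst q, snd p \<oplus> snd q) \<in> ?G" if pq: "p \<in> ?G" "q \<in> ?G" for p q
      proof -
        obtain d y r where p: "(d, y) \<in> G" "r \<in> carrier R" "p = (d \<oplus>\<^bsub>M\<^esub> r \<odot>\<^bsub>M\<^esub> x, y \<oplus> r \<otimes> c)"
          using memE[OF pq(1)] by blast
        obtain d' y' r' where q: "(d', y') \<in> G" "r' \<in> carrier R" "q = (d' \<oplus>\<^bsub>M\<^esub> r' \<odot>\<^bsub>M\<^esub> x, y' \<oplus> r' \<otimes> c)"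
          using memE[OF pq(2)] by blast
        have "fst p \<oplus>\<^bsub>M\<^esub> fst q = (d \<oplus>\<^bsub>M\<^esub> d') \<oplus>\<^bsub>M\<^esub> (r \<oplus> r') \<odot>\<^bsub>M\<^esub> x"
          using p q Gc M.smult_closed x by (simp add: M.smult_l_distr M.a_ac)
        moreover have "snd p \<oplus> snd q = (y \<oplus> y') \<oplus> (r \<oplus> r') \<otimes> c"
          using p q Gc c(1) by (simp add: l_distr a_ac)
        ultimately show ?thesis using mem[OF Gadd[OF p(1) q(1)], of "r \<oplus> r'"] p(2) q(2) by simp
      qed
      show "(a \<odot>\<^bsub>M\<^esub> fst p, a \<otimes> snd p) \<in> ?G" if a: "a \<in> carrier R" and p: "p \<in> ?G" for a p
      proof -
        obtain d y r where p: "(d, y) \<in> G" "r \<in> carrier R" "p = (d \<oplus>\<^bsub>M\<^esub> r \<odot>\<^bsub>M\<^esub> x, y \<oplus> r \<otimes> c)"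
          using memE[OF p] by blast
        have "a \<odot>\<^bsub>M\<^esub> fst p = a \<odot>\<^bsub>M\<^esub> d \<oplus>\<^bsub>M\<^esub> (a \<otimes> r) \<odot>\<^bsub>M\<^esub> x"
          using p a Gc M.smult_closed x by (simp add: M.smult_r_distr M.smult_assoc)
        moreover have "a \<otimes> snd p = a \<otimes> y \<oplus> (a \<otimes> r) \<otimes> c" using p a Gc c(1) by (simp add: r_distr m_assoc)
        ultimately show ?thesis using mem[OF Gmult[OF a p(1)], of "a \<otimes> r"] p(2) a by simp
      qed
      show "z = \<zero>" if z: "(\<zero>\<^bsub>M\<^esub>, z) \<in> ?G" for z
      proof -
        obtain d y r where p: "(d, y) \<in> G" "r \<in> carrier R" "(\<zero>\<^bsub>M\<^esub>, z) = (d \<oplus>\<^bsub>M\<^esub> r \<odot>\<^bsub>M\<^esub> x, y \<oplus> r \<otimes> c)"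
          using memE[OF z] by blast
        have dy: "d \<in> carrier M" "y \<in> carrier R" using Gc p(1) by auto
        have rx: "r \<odot>\<^bsub>M\<^esub> x \<in> carrier M" using M.smult_closed p(2) x by simp
        have e: "r \<odot>\<^bsub>M\<^esub> x \<oplus>\<^bsub>M\<^esub> d = \<zero>\<^bsub>M\<^esub>" using p(3) M.a_comm[OF dy(1) rx] by simp
        have "(\<ominus> \<one>) \<odot>\<^bsub>M\<^esub> d = r \<odot>\<^bsub>M\<^esub> x"
          unfolding M.neg_one_smult[OF dy(1)] using M.minus_equality[OF e dy(1) rx] by simp
        moreover have "(\<ominus> \<one>) \<otimes> y = \<ominus> y" using dy by (simp add: l_minus)
        ultimately have "(r \<odot>\<^bsub>M\<^esub> x, \<ominus> y) \<in> G" using Gmult[of "\<ominus> \<one>" d y] p(1) by simp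
        then have "\<ominus> y = r \<otimes> c" using c(2) p(2) by blast
        then show ?thesis using p(3) dy(2) by (metis prod.inject r_neg)
      qed
    qed
    then have "?G = G" using Gmax sub by blast
    then have "(\<zero>\<^bsub>M\<^esub> \<oplus>\<^bsub>M\<^esub> \<one> \<odot>\<^bsub>M\<^esub> x, \<zero> \<oplus> \<one> \<otimes> c) \<in> G" using mem[OF G0 one_closed] by simp
    then show ?thesis using M.smult_one[OF x] x by auto
  qed
  have uniq: "y = y'" if "(x, y) \<in> G" "(x, y') \<in> G" for x y y'
  proof -
    have c: "x \<in> carrier M" "y \<in> carrier R" "y' \<in> carrier R" using that Gc by auto
    have "(x \<oplus>\<^bsub>M\<^esub> (\<ominus> \<one>) \<odot>\<^bsub>M\<^esub> x, y \<oplus> (\<ominus> \<one>) \<otimes> y') \<in> G" using Gadd[OF that(1) Gmult[OF _ that(2)]] by simp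
    then have "y \<oplus> (\<ominus> \<one>) \<otimes> y' = \<zero>" using Gz M.neg_one_smult[OF c(1)] c by (simp add: M.r_neg)
    then show ?thesis using c by (simp add: l_minus minus_eq[symmetric])
  qed
  define g where "g = (\<lambda>x. THE y. (x, y) \<in> G)"
  have g: "g x = y" if "(x, y) \<in> G" for x y unfolding g_def using that uniq by blast
  have gG: "(x, g x) \<in> G" if "x \<in> carrier M" for x using total[OF that] g by metis
  show "\<exists>g\<in>mod_homs R M (left_regular R). \<forall>x\<in>L. g x = f x"
  proof (intro bexI[of _ g] ballI)
    show "g x = f x" if "x \<in> L" for x using g Gf that by blast
    show "g \<in> mod_homs R M (left_regular R)"
      unfolding mod_homs_def using gG Gc(2) g Gadd Gmult by (auto)
  qed
qed

section \<open>The finitary left socle\<close>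

context ring
begin

lemma finsum_left_ideal:
  assumes "left_ideal L R" "finite F" "\<And>i. i \<in> F \<Longrightarrow> s i \<in> L"
  shows "(\<Oplus>i\<in>F. s i) \<in> L"
  using assms(2,3)
proof (induction F rule: finite_induct)
  case (insert i F)
  then show ?case using left_idealD(2,4)[OF assms(1)] by (subst finsum_insert) (auto simp: Pi_def)
qed (simp add: left_idealD(3)[OF assms(1)])

text \<open>The defining sums have at most one term for each minimal ideal, so a new term from
  \<open>S\<close> has to be merged with the one already taken from \<open>S\<close>, if there is
  one.\<close>

lemma finitary_left_socle_add:
  assumes v: "v \<in> finitary_left_socle R" and S: "minimal_left_ideal S R" "finite S" "t \<in> S"
  shows "t \<oplus> v \<in> finitary_left_socle R"
proof -
  obtain F s where F: "v = (\<Oplus>I\<in>F. s I)" "finite F"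
    "\<forall>I\<in>F. minimal_left_ideal I R \<and> finite I \<and> s I \<in> I"
    using v by (auto simp: finitary_left_socle_def)
  have sc: "s I \<in> carrier R" if "I \<in> F" for I
  proof -
    have "left_ideal I R" "s I \<in> I" using F(3) that by (auto simp: minimal_left_ideal_def)
    then show ?thesis by (rule left_idealD(2))
  qed
  have Sl: "left_ideal S R" using S(1) by (simp add: minimal_left_ideal_def)
  have tc: "t \<in> carrier R" using left_idealD(2)[OF Sl S(3)] .
  define s' where "s' = s(S := if S \<in> F then t \<oplus> s S else t)"
  have F0: "finite (F - {S})" "S \<notin> F - {S}" using F(2) by auto
  have e: "(\<Oplus>I\<in>F - {S}. s' I) = (\<Oplus>I\<in>F - {S}. s I)"
    using sc by (intro finsum_cong') (auto simp: s'_def)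
  have s'S: "s' S \<in> S" using F(3) S(3) left_idealD(4)[OF Sl] by (auto simp: s'_def)
  have s'c: "s' \<in> insert S F \<rightarrow> carrier R" using sc tc by (auto simp: s'_def)
  have rc: "(\<Oplus>I\<in>F - {S}. s I) \<in> carrier R" using sc by (intro finsum_closed) auto
  have "(\<Oplus>I\<in>insert S F. s' I) = (\<Oplus>I\<in>insert S (F - {S}). s' I)" by simp
  also have "\<dots> = s' S \<oplus> (\<Oplus>I\<in>F - {S}. s I)"
    using finsum_insert[OF F0, of s'] s'c e by (auto simp: Pi_def)
  also have "\<dots> = t \<oplus> v"
  proof (cases "S \<in> F")
    case True
    have "v = (\<Oplus>I\<in>insert S (F - {S}). s I)" using F(1) True by (simp add: insert_absorb)
    also have "\<dots> = s S \<oplus> (\<Oplus>I\<in>F - {S}. s I)" using finsum_insert[OF F0, of s] sc True by auto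
    finally show ?thesis using True sc[OF True] tc rc by (simp add: s'_def a_assoc)
  qed (use F(1) in \<open>simp add: s'_def\<close>)
  finally have "t \<oplus> v = (\<Oplus>I\<in>insert S F. s' I)" by simp
  moreover have "\<forall>I\<in>insert S F. minimal_left_ideal I R \<and> finite I \<and> s' I \<in> I"
    using F(3) S(1,2) s'S by (auto simp: s'_def)
  ultimately show ?thesis using F(2) unfolding finitary_left_socle_def by blast
qed

text \<open>For the harder inclusion a minimal left ideal is split off from Rt by a complement, and
  induction on the size treats the component in the complement.\<close>

lemma finitary_left_socle_eq:
  assumes art: "left_artinian R"
  shows "finitary_left_socle R = fin_socle"
proof
  show "finitary_left_socle R \<subseteq> fin_socle"
  proof
    fix t assume "t \<in> finitary_left_socle R"
    then obtain F s where F: "t = (\<Oplus>I\<in>F. s I)" "finite F"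
      "\<forall>I\<in>F. minimal_left_ideal I R \<and> finite I \<and> s I \<in> I"
      by (auto simp: finitary_left_socle_def)
    have "s I \<in> fin_socle" if "I \<in> F" for I
    proof -
      have I: "minimal_left_ideal I R" "finite I" "s I \<in> I" using F(3) that by auto
      have Il: "left_ideal I R" using I(1) by (simp add: minimal_left_ideal_def)
      have "finite (lprin R (s I))" using lprin_least[OF Il I(3)] I(2) finite_subset by blast
      then show ?thesis using minimal_left_ideal_annihilated[OF I(1)] I(3) by (auto simp: fin_socle_def)
    qed
    then show "t \<in> fin_socle" unfolding F(1) using finsum_left_ideal[OF left_ideal_fin_socle F(2)] by blast
  qed
  show "fin_socle \<subseteq> finitary_left_socle R"
  proof
    fix t assume "t \<in> fin_socle"
    then show "t \<in> finitary_left_socle R"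
    proof (induction "card (lprin R t)" arbitrary: t rule: less_induct)
      case less
      have tc: "t \<in> carrier R" using less.prems fin_socle_subset by blast
      show ?case
      proof (cases "t = \<zero>")
        case True
        have "\<zero> = (\<Oplus>I\<in>{}. (\<lambda>_. \<zero>) I)" by simp
        then show ?thesis using True unfolding finitary_left_socle_def by blast
      next
        case False
        let ?X = "lprin R t"
        have X: "left_ideal ?X R" "?X \<subseteq> fin_socle" "finite ?X"
          using lprin_least[OF left_ideal_fin_socle less.prems] tc less.prems by (auto simp: fin_socle_def)
        have XT: "?X \<subseteq> rann R J" using X(2) fin_socle_subset by blast
        have "?X \<noteq> {\<zero>}" using False lprin_self[OF tc] by blast
        then obtain S where S: "minimal_left_ideal S R" "S \<subseteq> ?X"
          using minimal_left_ideal_exists[OF art X(1)] by blast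
        have Sl: "left_ideal S R" "S \<noteq> {\<zero>}" using S(1) by (auto simp: minimal_left_ideal_def)
        obtain V where V: "left_ideal V R" "V \<subseteq> ?X" "S \<inter> V = {\<zero>}" "S <+>\<^bsub>R\<^esub> V = ?X"
          using complement_in_annihilator[OF art X(1) XT X(3) Sl(1) S(2)] .
        have "t \<in> S <+>\<^bsub>R\<^esub> V" using V(4) lprin_self[OF tc] by simp
        then obtain s v where sv: "s \<in> S" "v \<in> V" "t = s \<oplus> v" by (auto simp: set_add_mem)
        have "V \<noteq> ?X"
        proof
          assume "V = ?X"
          then have "S = {\<zero>}" using V(3) S(2) by blast
          then show False using Sl(2) by simp
        qed
        then have "V \<subset> ?X" using V(2) by blast
        then have "card V < card ?X" using X(3) psubset_card_mono by blast
        moreover have "card (lprin R v) \<le> card V"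
          using lprin_least[OF V(1) sv(2)] V(2) X(3) by (meson card_mono finite_subset)
        ultimately have "v \<in> finitary_left_socle R" using less.hyps[of v] sv(2) V(2) X(2) by auto
        moreover have "finite S" using S(2) X(3) finite_subset by blast
        ultimately show ?thesis unfolding sv(3) using finitary_left_socle_add S(1) sv(1) by blast
      qed
    qed
  qed
qed

end

section \<open>Double annihilators from length one\<close>

definition lcover :: "('a, 'r) ring_scheme \<Rightarrow> 'a set \<Rightarrow> 'a set \<Rightarrow> bool"
  where "lcover R L L' \<longleftrightarrow> left_ideal L R \<and> left_ideal L' R \<and> L \<subset> L' \<and>
    (\<forall>K. left_ideal K R \<and> L \<subseteq> K \<and> K \<subseteq> L' \<longrightarrow> K = L \<or> K = L')"

text \<open>The left ideal has a composition series of length \<open>k\<close>.\<close>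

inductive lsteps :: "('a, 'r) ring_scheme \<Rightarrow> nat \<Rightarrow> 'a set \<Rightarrow> bool" for R
  where lsteps_0: "lsteps R 0 {\<zero>\<^bsub>R\<^esub>}"
  | lsteps_Suc: "lsteps R k L \<Longrightarrow> lcover R L L' \<Longrightarrow> lsteps R (Suc k) L'"

definition lchain :: "('a, 'r) ring_scheme \<Rightarrow> nat \<Rightarrow> (nat \<Rightarrow> 'a set) \<Rightarrow> bool"
  where "lchain R m C \<longleftrightarrow> (\<forall>i\<le>m. left_ideal (C i) R) \<and> (\<forall>i<m. C i \<subset> C (Suc i))"

context ring
begin

lemma lsteps_left_ideal: "lsteps R k L \<Longrightarrow> left_ideal L R"
  by (induction rule: lsteps.induct) (auto simp: lcover_def)

lemma lchain_mono: "lchain R m C \<Longrightarrow> i \<le> j \<Longrightarrow> j \<le> m \<Longrightarrow> C i \<subseteq> C j"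
proof (induction j)
  case (Suc j)
  show ?case
  proof (cases "i = Suc j")
    case False
    then have "C i \<subseteq> C j" "C j \<subset> C (Suc j)" using Suc by (auto simp: lchain_def)
    then show ?thesis by blast
  qed simp
qed simp

lemma lchain_of_lsteps: "lsteps R k L \<Longrightarrow> \<exists>C. lchain R k C \<and> C k = L"
proof (induction rule: lsteps.induct)
  case lsteps_0
  show ?case by (intro exI[of _ "\<lambda>_. {\<zero>}"]) (simp add: lchain_def)
next
  case (lsteps_Suc k L L')
  then obtain C where C: "lchain R k C" "C k = L" by blast
  have L': "left_ideal L' R" "L \<subset> L'" using lsteps_Suc by (auto simp: lcover_def)
  show ?case
  proof (intro exI conjI)
    show "lchain R (Suc k) (C(Suc k := L'))"
      using C L' unfolding lchain_def by (auto simp: less_Suc_eq le_Suc_eq)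
  qed simp
qed

text \<open>Half of the Jordan--Dedekind theorem; the step uses the modular law.\<close>

lemma lchain_length_le:
  assumes "lsteps R k L" "lchain R m C" "C m \<subseteq> L"
  shows "m \<le> k"
  using assms
proof (induction arbitrary: m C rule: lsteps.induct)
  case lsteps_0
  show ?case
  proof (rule ccontr)
    assume "\<not> m \<le> 0"
    then have "left_ideal (C 0) R" "C 0 \<subset> C 1" "C 1 \<subseteq> C m"
      using lsteps_0 lchain_mono[OF lsteps_0(1), of 1 m] by (auto simp: lchain_def)
    then show False using lsteps_0(2) left_idealD(3)[of "C 0"] by blast
  qed
next
  case (lsteps_Suc k L L')
  note C = lsteps_Suc.prems(1)
  have L: "left_ideal L R" "left_ideal L' R" "L \<subset> L'"
    and cov: "\<And>K. left_ideal K R \<Longrightarrow> L \<subseteq> K \<Longrightarrow> K \<subseteq> L' \<Longrightarrow> K = L \<or> K = L'"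
    using lsteps_Suc(2) by (auto simp: lcover_def)
  have Cl: "left_ideal (C i) R" if "i \<le> m" for i using C that by (simp add: lchain_def)
  have CL': "C i \<subseteq> L'" if "i \<le> m" for i using lchain_mono[OF C that] lsteps_Suc.prems(2) by auto
  show ?case
  proof (cases "C m \<subseteq> L")
    case True
    then show ?thesis using lsteps_Suc.IH[OF C] by simp
  next
    case False
    define j where "j = (LEAST i. \<not> C i \<subseteq> L)"
    have "\<not> C j \<subseteq> L" unfolding j_def using False by (rule LeastI)
    moreover have "j \<le> m" unfolding j_def using False by (rule Least_le)
    ultimately have j: "\<not> C j \<subseteq> L" "j \<le> m" by blast+
    have below: "C i \<subseteq> L" if "i < j" for i using that not_less_Least unfolding j_def by blast
    have above: "\<not> C i \<subseteq> L" if "j \<le> i" "i \<le> m" for i using j(1) lchain_mono[OF C that] by blast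
    have strict: "C i \<inter> L \<subset> C (Suc i) \<inter> L" if i: "j \<le> i" "i < m" for i
    proof -
      have sub: "C i \<subset> C (Suc i)" using C i by (simp add: lchain_def)
      have ids: "left_ideal (C i) R" "left_ideal (C (Suc i)) R" using Cl i by auto
      have S: "left_ideal (C i <+>\<^bsub>R\<^esub> L) R" using left_ideal_sum ids(1) L(1) .
      have up: "C i \<subseteq> C i <+>\<^bsub>R\<^esub> L" "L \<subseteq> C i <+>\<^bsub>R\<^esub> L" using set_add_upper[OF ids(1) L(1)] .
      have "C i <+>\<^bsub>R\<^esub> L \<subseteq> L'" using set_add_least[OF L(2) CL'] i L(3) by auto
      then have e: "C i <+>\<^bsub>R\<^esub> L = L'" using cov[OF S up(2)] up(1) above[of i] i by auto
      have "C i \<inter> L \<noteq> C (Suc i) \<inter> L"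
      proof
        assume eq: "C i \<inter> L = C (Suc i) \<inter> L"
        have "C (Suc i) \<subseteq> C i"
        proof
          fix x assume x: "x \<in> C (Suc i)"
          then have "x \<in> C i <+>\<^bsub>R\<^esub> L" using CL'[of "Suc i"] i e by auto
          then obtain c l where cl: "c \<in> C i" "l \<in> L" "x = c \<oplus> l" by (auto simp: set_add_mem)
          have cc: "c \<in> carrier R" "l \<in> carrier R" using cl left_idealD(2) ids(1) L(1) by blast+
          have lx: "x \<ominus> c = l" unfolding cl(3) using add_minus_cancel_left[OF cc] .
          have "x \<ominus> c \<in> C (Suc i)" using left_idealD(7)[OF ids(2) x] cl(1) sub by blast
          then have "l \<in> C i" using lx cl(2) eq by blast
          then show "x \<in> C i" unfolding cl(3) using left_idealD(4)[OF ids(1)] cl(1) by blast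
        qed
        then show False using sub by blast
      qed
      then show ?thesis using sub by blast
    qed
    show ?thesis
    proof (cases m)
      case (Suc m')
      \<comment> \<open>Before index \<open>j\<close> the chain lies in \<open>L\<close>; from there
        on it is intersected with \<open>L\<close>. Index \<open>j\<close> is left out because
        \<open>C j \<inter> L\<close> may equal the preceding member, so the length drops by exactly
        one.\<close>
      define D where "D = (\<lambda>i. if i < j then C i else C (Suc i) \<inter> L)"
      have "lchain R m' D"
        unfolding lchain_def
      proof (intro conjI allI impI)
        fix i assume i: "i \<le> m'"
        show "left_ideal (D i) R" using Cl i Suc left_ideal_Int[OF Cl L(1)] by (auto simp: D_def)
      next
        fix i assume i: "i < m'"
        consider "Suc i < j" | "Suc i = j" | "j \<le> i" by linarith
        then show "D i \<subset> D (Suc i)"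
        proof cases
          case 1
          then show ?thesis using C i Suc by (simp add: D_def lchain_def)
        next
          case 2
          have "C i \<subset> C (Suc i)" using C i Suc unfolding lchain_def by simp
          then have "C i \<subset> C j" using 2 by simp
          then have "C i \<subseteq> C j \<inter> L" using below[of i] 2 by auto
          also have "\<dots> \<subset> C (Suc j) \<inter> L" using strict[of j] i Suc 2 by auto
          finally show ?thesis using 2 by (simp add: D_def)
        next
          case 3
          then show ?thesis using strict[of "Suc i"] i Suc by (simp add: D_def)
        qed
      qed
      moreover have "D m' \<subseteq> L" using below by (auto simp: D_def)
      ultimately have "m' \<le> k" by (rule lsteps_Suc.IH)
      then show ?thesis using Suc by simp
    qed simp
  qed
qed

end

text \<open>What the extension property for codes of length one provides.\<close>

locale annihilator_injective = ring +
  assumes left_artin: "left_artinian R" and right_artin: "right_artinian R"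
    and lann_inj: "\<lbrakk>a \<in> carrier R; b \<in> carrier R; lann R {a} = lann R {b}\<rbrakk> \<Longrightarrow> b \<in> rprin R a"
    and rann_inj: "\<lbrakk>a \<in> carrier R; b \<in> carrier R; rann R {a} = rann R {b}\<rbrakk> \<Longrightarrow> b \<in> lprin R a"
begin

lemma annihilator_injective_opp: "annihilator_injective (opp R)"
  unfolding annihilator_injective_def annihilator_injective_axioms_def
  using ring_opp left_artin right_artin lann_inj rann_inj by simp

text \<open>Choose \<open>z\<close> that generates \<open>L'\<close> over \<open>L\<close>. For
  \<open>a\<close> in \<open>rann R L\<close> with nonzero \<open>z \<otimes> a\<close>, the left
  annihilator of \<open>z \<otimes> a\<close> consists of the \<open>r\<close> moving
  \<open>z\<close> into \<open>L\<close>, whatever \<open>a\<close> is. By \<open>lann_inj\<close>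
  any two such products generate the same right ideal, so no right ideal fits strictly between the
  annihilators.\<close>

lemma lcover_rann:
  assumes "lcover R L L'"
  shows "rann R L' = rann R L \<or> lcover (opp R) (rann R L') (rann R L)"
proof (rule disjCI)
  assume "\<not> lcover (opp R) (rann R L') (rann R L)"
  have L: "left_ideal L R" "left_ideal L' R" "L \<subset> L'"
    and cov: "\<And>K. left_ideal K R \<Longrightarrow> L \<subseteq> K \<Longrightarrow> K \<subseteq> L' \<Longrightarrow> K = L \<or> K = L'"
    using assms by (auto simp: lcover_def)
  note Ld = left_idealD[OF L(1)] and L'd = left_idealD[OF L(2)]
  obtain z where z: "z \<in> L'" "z \<notin> L" using L(3) by blast
  have zc: "z \<in> carrier R" using z L'd by blast
  have gen: "L <+>\<^bsub>R\<^esub> lprin R y = L'" if y: "y \<in> L'" "y \<notin> L" for y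
  proof -
    have yc: "y \<in> carrier R" using y L'd by blast
    have "L \<subseteq> L <+>\<^bsub>R\<^esub> lprin R y" "y \<in> L <+>\<^bsub>R\<^esub> lprin R y"
      using set_add_upper[OF L(1), of "lprin R y"] lprin_self[OF yc] yc by auto
    moreover have "L <+>\<^bsub>R\<^esub> lprin R y \<subseteq> L'"
      using set_add_least[OF L(2) _ lprin_least[OF L(2) y(1)]] L(3) by blast
    moreover have "left_ideal (L <+>\<^bsub>R\<^esub> lprin R y) R" using left_ideal_sum[OF L(1)] yc by simp
    ultimately show ?thesis using cov y(2) by blast
  qed
  have inL': "a \<in> rann R L'" if a: "a \<in> rann R L" "z \<otimes> a = \<zero>" for a
  proof -
    have "a \<in> rann R L \<inter> rann R (lprin R z)" using a rann_lprin[OF zc] by (auto simp: rann_def)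
    then show ?thesis using rann_set_add[OF L(1), of "lprin R z"] gen[OF z] zc by simp
  qed
  have annz: "lann R {z \<otimes> a} = {r \<in> carrier R. r \<otimes> z \<in> L}" if a: "a \<in> rann R L" "z \<otimes> a \<noteq> \<zero>" for a
  proof -
    have ac: "a \<in> carrier R" and La: "\<And>x. x \<in> L \<Longrightarrow> x \<otimes> a = \<zero>" using a by (auto simp: rann_def)
    have "r \<otimes> z \<in> L" if r: "r \<in> carrier R" "r \<otimes> (z \<otimes> a) = \<zero>" for r
    proof (rule ccontr)
      assume "r \<otimes> z \<notin> L"
      then have "z \<in> L <+>\<^bsub>R\<^esub> lprin R (r \<otimes> z)" using gen[of "r \<otimes> z"] L'd(5) r(1) z(1) by blast
      then obtain l s where ls: "l \<in> L" "s \<in> carrier R" "z = l \<oplus> s \<otimes> (r \<otimes> z)"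
        by (auto simp: set_add_mem lprin_def)
      have lc: "l \<in> carrier R" using ls Ld by blast
      have "z \<otimes> a = (l \<oplus> s \<otimes> (r \<otimes> z)) \<otimes> a" using ls(3) by simp
      also have "\<dots> = l \<otimes> a \<oplus> s \<otimes> (r \<otimes> (z \<otimes> a))" using ls(2) lc r(1) zc ac by (simp add: l_distr m_assoc)
      also have "\<dots> = \<zero>" using La[OF ls(1)] r(2) ls(2) by simp
      finally show False using a(2) by simp
    qed
    moreover have "r \<otimes> (z \<otimes> a) = \<zero>" if "r \<in> carrier R" "r \<otimes> z \<in> L" for r
      using La[OF that(2)] that(1) zc ac by (simp add: m_assoc)
    ultimately show ?thesis by (auto simp: lann_def)
  qed
  have rL: "right_ideal (rann R L) R" "right_ideal (rann R L') R" using Ld(1) L'd(1) by simp_all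
  have sub: "rann R L' \<subseteq> rann R L" using L(3) rann_antimono by blast
  have "K = rann R L' \<or> K = rann R L" if K: "right_ideal K R" "rann R L' \<subseteq> K" "K \<subseteq> rann R L" for K
  proof (rule disjCI)
    assume "K \<noteq> rann R L"
    have "K \<subseteq> rann R L'"
    proof (rule ccontr)
      assume "\<not> K \<subseteq> rann R L'"
      then obtain a where a: "a \<in> K" "a \<notin> rann R L'" by blast
      have aL: "a \<in> rann R L" using a K(3) by blast
      have ac: "a \<in> carrier R" using aL by (simp add: rann_def)
      have za: "z \<otimes> a \<noteq> \<zero>" using inL'[OF aL] a(2) by blast
      have "rann R L \<subseteq> K"
      proof
        fix b assume b: "b \<in> rann R L"
        have bc: "b \<in> carrier R" using b by (simp add: rann_def)
        show "b \<in> K"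
        proof (cases "z \<otimes> b = \<zero>")
          case True
          then show ?thesis using inL'[OF b] K(2) by blast
        next
          case False
          have "lann R {z \<otimes> a} = lann R {z \<otimes> b}" using annz[OF aL za] annz[OF b False] by simp
          then have "z \<otimes> b \<in> rprin R (z \<otimes> a)" using lann_inj zc ac bc by simp
          then obtain c where c: "c \<in> carrier R" "z \<otimes> b = z \<otimes> a \<otimes> c" by (auto simp: rprin_def)
          have acK: "a \<otimes> c \<in> K" using right_idealD(5)[OF K(1)] a(1) c(1) by blast
          have "b \<ominus> a \<otimes> c \<in> rann R L" using right_idealD(7)[OF rL(1) b] acK K(3) by blast
          moreover have "z \<otimes> (b \<ominus> a \<otimes> c) = \<zero>" using c zc ac bc by (simp add: r_minus_distr m_assoc)
          ultimately have "b \<ominus> a \<otimes> c \<in> K" using inL' K(2) by blast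
          then have "(b \<ominus> a \<otimes> c) \<oplus> a \<otimes> c \<in> K" using right_idealD(4)[OF K(1)] acK by blast
          then show ?thesis using minus_add_cancel bc ac c(1) by simp
        qed
      qed
      then show False using K(3) \<open>K \<noteq> rann R L\<close> by blast
    qed
    then show "K = rann R L'" using K(2) by blast
  qed
  then have "rann R L' \<subset> rann R L \<Longrightarrow> lcover (opp R) (rann R L') (rann R L)"
    using rL by (simp add: lcover_def)
  then show "rann R L' = rann R L" using sub \<open>\<not> lcover _ _ _\<close> by blast
qed

text \<open>Under two applications of \<open>lcover_rann\<close>, one of them in the opposite ring,
  each cover of a composition series becomes a cover or an equality.\<close>

lemma lsteps_double_annihilator:
  assumes "lsteps R k L"
  shows "\<exists>k'\<le>k. lsteps R k' (lann R (rann R L))"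
  using assms
proof (induction rule: lsteps.induct)
  case lsteps_0
  have "rann R {\<zero>} = carrier R" by (auto simp: rann_def)
  moreover have "lann R (carrier R) = {\<zero>}"
  proof -
    have "y = \<zero>" if "y \<in> lann R (carrier R)" for y
    proof -
      have "y \<in> carrier R" "y \<otimes> \<one> = \<zero>" using that by (auto simp: lann_def simp del: r_one)
      then show ?thesis by simp
    qed
    then show ?thesis by (auto simp: lann_def)
  qed
  ultimately show ?case using lsteps.lsteps_0[of R] by auto
next
  case (lsteps_Suc k L L')
  then obtain k' where k': "k' \<le> k" "lsteps R k' (lann R (rann R L))" by blast
  consider "rann R L' = rann R L" | "lcover (opp R) (rann R L') (rann R L)"
    using lcover_rann[OF lsteps_Suc(2)] by blast
  then show ?case
  proof cases
    case 1
    then show ?thesis using k' by (intro exI[of _ k']) simp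
  next
    case 2
    have "lann R (rann R L) = lann R (rann R L') \<or> lcover R (lann R (rann R L)) (lann R (rann R L'))"
      using annihilator_injective.lcover_rann[OF annihilator_injective_opp 2] by simp
    then show ?thesis
    proof
      assume "lann R (rann R L) = lann R (rann R L')"
      then show ?thesis using k' by (intro exI[of _ k']) simp
    next
      assume "lcover R (lann R (rann R L)) (lann R (rann R L'))"
      then show ?thesis using k' lsteps.lsteps_Suc by (intro exI[of _ "Suc k'"]) blast
    qed
  qed
qed

text \<open>The double annihilator contains \<open>L\<close> and has no greater length, so a proper
  inclusion would give a chain that is too long.\<close>

lemma lsteps_lann_rann:
  assumes "lsteps R k L"
  shows "lann R (rann R L) = L"
proof (rule ccontr)
  assume ne: "lann R (rann R L) \<noteq> L"
  have L: "left_ideal L R" using lsteps_left_ideal[OF assms] .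
  have sub: "L \<subset> lann R (rann R L)" using ne lann_rann_subset[OF left_idealD(1)[OF L]] by blast
  obtain k' where k': "k' \<le> k" "lsteps R k' (lann R (rann R L))" using lsteps_double_annihilator[OF assms] by blast
  obtain C where C: "lchain R k C" "C k = L" using lchain_of_lsteps[OF assms] by blast
  have "lchain R (Suc k) (C(Suc k := lann R (rann R L)))"
    using C sub lsteps_left_ideal[OF k'(2)] unfolding lchain_def by (auto simp: less_Suc_eq le_Suc_eq)
  then have "Suc k \<le> k'" using lchain_length_le[OF k'(2)] by simp
  then show False using k'(1) by simp
qed

text \<open>Left ideals of finite length are already settled. A counterexample \<open>L\<close>
  therefore contains a strictly ascending sequence of left ideals of lengths 0, 1, 2 and so on,
  whose right annihilators descend strictly, against the chain condition on right ideals.\<close>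

lemma double_annihilator:
  assumes L: "left_ideal L R"
  shows "lann R (rann R L) = L"
proof (rule ccontr)
  assume ne: "lann R (rann R L) \<noteq> L"
  have "\<exists>M'. (lsteps R (Suc i) M' \<and> M' \<subseteq> L) \<and> M \<subset> M'" if M: "lsteps R i M \<and> M \<subseteq> L" for i M
  proof -
    have Mi: "left_ideal M R" using M lsteps_left_ideal by blast
    have "M \<noteq> L" using lsteps_lann_rann M ne by blast
    then have MsubL: "M \<subset> L" using M by blast
    have "\<exists>K. (left_ideal K R \<and> M \<subset> K \<and> K \<subseteq> L) \<and> (\<forall>K'. (left_ideal K' R \<and> M \<subset> K' \<and> K' \<subseteq> L) \<longrightarrow> K' \<subseteq> K \<longrightarrow> K' = K)"
      by (rule left_artinian_minimal_image[OF left_artin, of "\<lambda>K. left_ideal K R \<and> M \<subset> K \<and> K \<subseteq> L" L "\<lambda>K. K"])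
         (use L MsubL in auto)
    then obtain K where K: "left_ideal K R" "M \<subset> K" "K \<subseteq> L"
      and Kmin: "\<forall>K'. (left_ideal K' R \<and> M \<subset> K' \<and> K' \<subseteq> L) \<longrightarrow> K' \<subseteq> K \<longrightarrow> K' = K"
      by (elim exE conjE)
    have "K' = M \<or> K' = K" if "left_ideal K' R" "M \<subseteq> K'" "K' \<subseteq> K" for K'
      using Kmin[rule_format, of K'] that K(3) by auto
    then have "lcover R M K" unfolding lcover_def using K(1,2) Mi by simp
    then have "lsteps R (Suc i) K" using M lsteps.lsteps_Suc by blast
    then show ?thesis using K by blast
  qed
  moreover have "lsteps R 0 {\<zero>} \<and> {\<zero>} \<subseteq> L" using lsteps.lsteps_0[of R] left_idealD(3)[OF L] by simp
  ultimately obtain f where f: "\<And>n. lsteps R n (f n) \<and> f n \<subseteq> L" "\<And>n. f n \<subset> f (Suc n)"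
    using dependent_nat_choice[of "\<lambda>n M. lsteps R n M \<and> M \<subseteq> L" "\<lambda>n M M'. M \<subset> M'"] by metis
  have ids: "left_ideal (f n) R" for n using f(1) lsteps_left_ideal by blast
  have "\<forall>n. right_ideal (rann R (f n)) R \<and> rann R (f (Suc n)) \<subseteq> rann R (f n)"
    using left_idealD(1)[OF ids] f(2) rann_antimono by (simp add: psubset_imp_subset)
  then obtain m where m: "\<forall>k\<ge>m. rann R (f k) = rann R (f m)"
    using right_artin[unfolded right_artinian_def, rule_format, of "\<lambda>n. rann R (f n)"] by blast
  have "rann R (f (Suc m)) = rann R (f m)" using m by (meson le_SucI le_refl)
  then have "f (Suc m) = f m" using lsteps_lann_rann f(1) by metis
  then show False using f(2)[of m] by simp
qed

lemma linj: "linj R"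
proof (rule linj_of_double_annihilator[OF right_artin double_annihilator])
  show "rann R (lann R L) = L" if "right_ideal L R" for L
    using annihilator_injective.double_annihilator[OF annihilator_injective_opp, of L] that by simp
qed

end

section \<open>Cyclicity of the finite socle\<close>

text \<open>The system is triangular: the weight of a minimal member occurs only in the equation of
  that member, so it can be chosen last.\<close>

lemma moebius_type_weights:
  fixes t :: "'a set \<Rightarrow> int"
  assumes "finite \<L>"
  shows "\<exists>h. \<forall>W\<in>\<L>. (\<Sum>U | U \<in> \<L> \<and> W \<subseteq> U. h U) = t W"
  using assms
proof (induction \<L> rule: finite_psubset_induct)
  case (psubset \<L>)
  show ?case
  proof (cases "\<L> = {}")
    case False
    obtain W0 where W0: "W0 \<in> \<L>" "\<forall>W\<in>\<L>. W \<subseteq> W0 \<longrightarrow> W0 = W"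
      using finite_has_minimal[OF psubset.hyps(1) False] by (rule bexE)
    obtain h where h: "\<forall>W\<in>\<L> - {W0}. (\<Sum>U | U \<in> \<L> - {W0} \<and> W \<subseteq> U. h U) = t W"
      using psubset.IH[of "\<L> - {W0}"] W0(1) by blast
    define h' where "h' = h(W0 := t W0 - (\<Sum>U | U \<in> \<L> - {W0} \<and> W0 \<subseteq> U. h U))"
    have "(\<Sum>U | U \<in> \<L> \<and> W \<subseteq> U. h' U) = t W" if W: "W \<in> \<L>" for W
    proof (cases "W = W0")
      case True
      have e: "{U. U \<in> \<L> \<and> W0 \<subseteq> U} = insert W0 {U. U \<in> \<L> - {W0} \<and> W0 \<subseteq> U}" using W0(1) by auto
      have "(\<Sum>U | U \<in> \<L> \<and> W0 \<subseteq> U. h' U) = h' W0 + (\<Sum>U | U \<in> \<L> - {W0} \<and> W0 \<subseteq> U. h' U)"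
        unfolding e using psubset.hyps(1) by (subst sum.insert) auto
      also have "(\<Sum>U | U \<in> \<L> - {W0} \<and> W0 \<subseteq> U. h' U) = (\<Sum>U | U \<in> \<L> - {W0} \<and> W0 \<subseteq> U. h U)"
        by (intro sum.cong refl) (simp add: h'_def)
      finally show ?thesis using True by (simp add: h'_def)
    next
      case False
      then have "\<not> W \<subseteq> W0" using W0(2) W by blast
      then have e: "{U. U \<in> \<L> \<and> W \<subseteq> U} = {U. U \<in> \<L> - {W0} \<and> W \<subseteq> U}" by blast
      have "(\<Sum>U | U \<in> \<L> - {W0} \<and> W \<subseteq> U. h' U) = (\<Sum>U | U \<in> \<L> - {W0} \<and> W \<subseteq> U. h U)"
        by (intro sum.cong refl) (simp add: h'_def)
      then show ?thesis unfolding e using h W False by simp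
    qed
    then show ?thesis by blast
  qed simp
qed

lemma list_with_multiplicities:
  fixes k :: "'a \<Rightarrow> nat"
  assumes "finite A"
  shows "\<exists>xs. set xs = {a \<in> A. k a > 0} \<and>
    (\<forall>P. card {i. i < length xs \<and> P (xs ! i)} = (\<Sum>a | a \<in> A \<and> P a. k a))"
proof -
  obtain as where as: "set as = A" "distinct as" using finite_distinct_list[OF assms] by blast
  define xs where "xs = concat (map (\<lambda>a. replicate (k a) a) as)"
  show ?thesis
  proof (intro exI[of _ xs] conjI allI)
    show "set xs = {a \<in> A. k a > 0}" using as(1) by (auto simp: xs_def)
    fix P
    have "card {i. i < length xs \<and> P (xs ! i)} = length (filter P xs)" by (simp add: length_filter_conv_card)
    also have "\<dots> = sum_list (map (\<lambda>a. if P a then k a else 0) as)"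
      unfolding xs_def by (induction as) auto
    also have "\<dots> = (\<Sum>a\<in>A. if P a then k a else 0)"
      using as sum_list_distinct_conv_sum_set by metis
    also have "\<dots> = (\<Sum>a | a \<in> A \<and> P a. k a)" using assms by (simp add: sum.inter_filter)
    finally show "card {i. i < length xs \<and> P (xs ! i)} = (\<Sum>a | a \<in> A \<and> P a. k a)" .
  qed
qed

section \<open>Codes described by coordinate maps\<close>

context ring
begin

lemma inv_left_power:
  assumes "x \<in> {..<n} \<rightarrow>\<^sub>E carrier R"
  shows "inv\<^bsub>add_monoid (left_power R n)\<^esub> x = (\<lambda>i\<in>{..<n}. \<ominus> \<one> \<otimes> x i)"
proof -
  interpret V: left_module R "left_power R n" by (rule left_module_left_power)
  show ?thesis using V.neg_one_smult[of x] assms by (simp add: a_inv_def)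
qed

text \<open>The codes are the images of \<open>Y\<close> under the coordinate maps \<open>f i\<close> and \<open>g i\<close>; the condition \<open>zeros\<close> makes
  \<open>f y \<mapsto> g y\<close> well defined and weight preserving.\<close>

lemma macwilliams_coordinates:
  fixes n :: nat and f g :: "nat \<Rightarrow> 'a \<Rightarrow> 'a"
  assumes mac: "left_macwilliams R" and Y: "left_ideal Y R" and n: "n \<ge> 1"
    and f: "\<And>i y. i < n \<Longrightarrow> y \<in> Y \<Longrightarrow> f i y \<in> carrier R"
      "\<And>i y z. i < n \<Longrightarrow> y \<in> Y \<Longrightarrow> z \<in> Y \<Longrightarrow> f i (y \<oplus> z) = f i y \<oplus> f i z"
      "\<And>i a y. i < n \<Longrightarrow> a \<in> carrier R \<Longrightarrow> y \<in> Y \<Longrightarrow> f i (a \<otimes> y) = a \<otimes> f i y"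
    and g: "\<And>i y. i < n \<Longrightarrow> y \<in> Y \<Longrightarrow> g i y \<in> carrier R"
      "\<And>i y z. i < n \<Longrightarrow> y \<in> Y \<Longrightarrow> z \<in> Y \<Longrightarrow> g i (y \<oplus> z) = g i y \<oplus> g i z"
      "\<And>i a y. i < n \<Longrightarrow> a \<in> carrier R \<Longrightarrow> y \<in> Y \<Longrightarrow> g i (a \<otimes> y) = a \<otimes> g i y"
    and zeros: "\<And>y. y \<in> Y \<Longrightarrow> card {i. i < n \<and> f i y = \<zero>} = card {i. i < n \<and> g i y = \<zero>}"
  shows "\<exists>\<sigma> u. \<sigma> permutes {..<n} \<and> (\<forall>i<n. u i \<in> Units R \<and> (\<forall>y\<in>Y. g i y = f (\<sigma> i) y \<otimes> u i))"
proof -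
  note Yd = left_idealD[OF Y]
  have neg: "y \<oplus> \<ominus> \<one> \<otimes> z \<in> Y" if "y \<in> Y" "z \<in> Y" for y z using that Yd(4,5) by simp
  define code where "code = (\<lambda>f :: nat \<Rightarrow> 'a \<Rightarrow> 'a. \<lambda>y. \<lambda>i\<in>{..<n}. f i y)"
  have submod: "submodule (code f ` Y) R (left_power R n)"
    if f: "\<And>i y. i < n \<Longrightarrow> y \<in> Y \<Longrightarrow> f i y \<in> carrier R"
      "\<And>i y z. i < n \<Longrightarrow> y \<in> Y \<Longrightarrow> z \<in> Y \<Longrightarrow> f i (y \<oplus> z) = f i y \<oplus> f i z"
      "\<And>i a y. i < n \<Longrightarrow> a \<in> carrier R \<Longrightarrow> y \<in> Y \<Longrightarrow> f i (a \<otimes> y) = a \<otimes> f i y" for f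
  proof -
    have c: "code f y \<in> {..<n} \<rightarrow>\<^sub>E carrier R" if "y \<in> Y" for y using f(1) that by (auto simp: code_def)
    have add: "(\<lambda>i\<in>{..<n}. code f y i \<oplus> code f z i) = code f (y \<oplus> z)" if "y \<in> Y" "z \<in> Y" for y z
      using f(2) that by (auto simp: code_def intro!: restrict_ext)
    have mult: "(\<lambda>i\<in>{..<n}. a \<otimes> code f y i) = code f (a \<otimes> y)" if "a \<in> carrier R" "y \<in> Y" for a y
      using f(3) that by (auto simp: code_def intro!: restrict_ext)
    have zero: "(\<lambda>i\<in>{..<n}. \<zero>) = code f \<zero>"
      using f(1)[OF _ Yd(3)] f(3)[OF _ zero_closed Yd(3)] by (auto simp: code_def intro!: restrict_ext)
    have "subgroup (code f ` Y) (add_monoid (left_power R n))"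
      unfolding subgroup_def
    proof (intro conjI allI impI)
      show "code f ` Y \<subseteq> carrier (add_monoid (left_power R n))" using c by auto
      show "x \<otimes>\<^bsub>add_monoid (left_power R n)\<^esub> x' \<in> code f ` Y" if "x \<in> code f ` Y" "x' \<in> code f ` Y" for x x'
        using that add Yd(4) by auto
      show "\<one>\<^bsub>add_monoid (left_power R n)\<^esub> \<in> code f ` Y" using zero Yd(3) by auto
      show "inv\<^bsub>add_monoid (left_power R n)\<^esub> x \<in> code f ` Y" if "x \<in> code f ` Y" for x
        using that inv_left_power[OF c] mult[of "\<ominus> \<one>"] Yd(5)[of "\<ominus> \<one>"] by auto
    qed
    then show ?thesis
      using mult Yd(5) by (auto simp: submodule_def submodule_axioms_def)
  qed
  have zs: "{i. i < n \<and> (\<lambda>i\<in>{..<n}. f i y) i = \<zero>} = {i. i < n \<and> f i y = \<zero>}" for f :: "nat \<Rightarrow> 'a \<Rightarrow> 'a" and y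
    by auto
  \<comment> \<open>If all coordinates \<open>f i\<close> agree at \<open>y\<close> and
    \<open>z\<close>, their difference has \<open>n\<close> zeros on the side of \<open>f\<close>,
    hence also on the side of \<open>g\<close>.\<close>
  have dep: "g i y = g i z" if yz: "y \<in> Y" "z \<in> Y" "\<And>i. i < n \<Longrightarrow> f i y = f i z" and i: "i < n" for y z i
  proof -
    let ?d = "y \<oplus> \<ominus> \<one> \<otimes> z"
    have d: "?d \<in> Y" using neg yz by blast
    have mz: "\<ominus> \<one> \<otimes> z \<in> Y" using Yd(5) yz(2) by simp
    have "f j ?d = \<zero>" if "j < n" for j
      using f(1)[OF that yz(2)] f(2)[OF that yz(1) mz] f(3)[OF that _ yz(2), of "\<ominus> \<one>"] yz(3)[OF that]
      by (simp add: l_minus r_neg)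
    then have "{i. i < n \<and> f i ?d = \<zero>} = {..<n}" by auto
    then have "card {i. i < n \<and> g i ?d = \<zero>} = card {..<n}" using zeros[OF d] by simp
    then have "{i. i < n \<and> g i ?d = \<zero>} = {..<n}" by (intro card_subset_eq) auto
    then have "g i ?d = \<zero>" using i by blast
    then show ?thesis
      using g(1)[OF i yz(1)] g(1)[OF i yz(2)] g(2)[OF i yz(1) mz] g(3)[OF i _ yz(2), of "\<ominus> \<one>"]
      by (simp add: l_minus minus_eq[symmetric])
  qed
  define \<phi> where "\<phi> = (\<lambda>x. code g (SOME y. y \<in> Y \<and> code f y = x))"
  have \<phi>: "\<phi> (code f y) = code g y" if y: "y \<in> Y" for y
  proof -
    have "(SOME z. z \<in> Y \<and> code f z = code f y) \<in> Y \<and> code f (SOME z. z \<in> Y \<and> code f z = code f y) = code f y"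
      by (rule someI[of _ y]) (use y in simp)
    then obtain z where z: "z = (SOME z. z \<in> Y \<and> code f z = code f y)" "z \<in> Y" "code f z = code f y" by blast
    have "f i z = f i y" if "i < n" for i using fun_cong[OF z(3), of i] that by (simp add: code_def)
    then have "code g z = code g y" using dep[OF z(2) y] by (auto simp: code_def intro!: restrict_ext)
    then show ?thesis using z(1) by (simp add: \<phi>_def)
  qed
  have addc: "code f y \<oplus>\<^bsub>left_power R n\<^esub> code f z = code f (y \<oplus> z)"
    "code g y \<oplus>\<^bsub>left_power R n\<^esub> code g z = code g (y \<oplus> z)" if "y \<in> Y" "z \<in> Y" for y z
    using f(2) g(2) that by (auto simp: code_def intro!: restrict_ext)
  have multc: "a \<odot>\<^bsub>left_power R n\<^esub> code f y = code f (a \<otimes> y)"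
    "a \<odot>\<^bsub>left_power R n\<^esub> code g y = code g (a \<otimes> y)" if "a \<in> carrier R" "y \<in> Y" for a y
    using f(3) g(3) that by (auto simp: code_def intro!: restrict_ext)
  have "\<phi> \<in> mod_homs R ((left_power R n)\<lparr>carrier := code f ` Y\<rparr>) ((left_power R n)\<lparr>carrier := code g ` Y\<rparr>)"
    unfolding mod_homs_def
    using \<phi> addc multc Yd(4,5) by (auto simp del: left_power_sel simp add: Pi_def)
  moreover have "\<forall>x\<in>code f ` Y. hamming_weight R n (\<phi> x) = hamming_weight R n x"
  proof
    fix x assume "x \<in> code f ` Y"
    then obtain y where y: "y \<in> Y" "x = code f y" by blast
    have "hamming_weight R n (code f y) + card {i. i < n \<and> f i y = \<zero>} = n"
      "hamming_weight R n (code g y) + card {i. i < n \<and> g i y = \<zero>} = n"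
      using hamming_weight_zeros[of R n "code f y"] hamming_weight_zeros[of R n "code g y"] zs
      by (simp_all add: code_def)
    then show "hamming_weight R n (\<phi> x) = hamming_weight R n x" using \<phi>[OF y(1)] y(2) zeros[OF y(1)] by simp
  qed
  ultimately obtain \<sigma> u where \<sigma>: "\<sigma> permutes {..<n}" "u \<in> {..<n} \<rightarrow> Units R"
    "\<forall>x\<in>code f ` Y. \<phi> x = Phi_map R n \<sigma> u x"
    using mac[unfolded left_macwilliams_def, rule_format, of n "code f ` Y" "code g ` Y" \<phi>]
      submod[of f] submod[of g] f g n by auto
  have "g i y = f (\<sigma> i) y \<otimes> u i" if i: "i < n" and y: "y \<in> Y" for i y
  proof -
    have "code g y = Phi_map R n \<sigma> u (code f y)" using \<sigma>(3) \<phi>[OF y] y by auto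
    then have "code g y i = Phi_map R n \<sigma> u (code f y) i" by simp
    moreover have "\<sigma> i < n" using permutes_in_image[OF \<sigma>(1), of i] i by simp
    ultimately show ?thesis using i by (simp add: code_def Phi_map_def)
  qed
  then show ?thesis using \<sigma>(1,2) by (intro exI[of _ \<sigma>] exI[of _ u]) auto
qed

text \<open>Codes of length one with the coordinate maps y \<mapsto> ya and y \<mapsto> yb: equal
  annihilators mean equal weights, and the unit provided for y = 1 is the factor.\<close>

lemma macwilliams_rprin:
  assumes mac: "left_macwilliams R" and ab: "a \<in> carrier R" "b \<in> carrier R" and eq: "lann R {a} = lann R {b}"
  shows "b \<in> rprin R a"
proof -
  have z: "r \<otimes> a = \<zero> \<longleftrightarrow> r \<otimes> b = \<zero>" if "r \<in> carrier R" for r using eq that by (auto simp: lann_def)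
  have "\<exists>\<sigma> u. \<sigma> permutes {..<1::nat} \<and> (\<forall>i<1::nat. u i \<in> Units R \<and> (\<forall>y\<in>carrier R. y \<otimes> b = y \<otimes> a \<otimes> u i))"
    by (rule macwilliams_coordinates[OF mac left_ideal_carrier, of 1 "\<lambda>_ y. y \<otimes> a" "\<lambda>_ y. y \<otimes> b"])
       (use ab z in \<open>auto simp: l_distr m_assoc\<close>)
  then obtain u where u: "u (0::nat) \<in> Units R" "\<forall>y\<in>carrier R. y \<otimes> b = y \<otimes> a \<otimes> u 0" by blast
  then have "\<one> \<otimes> b = \<one> \<otimes> a \<otimes> u 0" by blast
  then show ?thesis using ab u(1) by (auto simp: rprin_def)
qed

end

lemma annihilator_injective_of_macwilliams:
  assumes "ring R" "left_artinian R" "right_artinian R" "left_macwilliams R" "right_macwilliams R"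
  shows "annihilator_injective R"
proof -
  interpret ring R by fact
  have "left_macwilliams (opp R)" using assms(5) left_macwilliams_opp by blast
  then show ?thesis
    unfolding annihilator_injective_def annihilator_injective_axioms_def
    using assms macwilliams_rprin ring.macwilliams_rprin[OF ring_opp] by simp
qed

section \<open>The finite socle under the MacWilliams property\<close>

context quasi_frobenius_ring
begin

text \<open>If the finite socle \<open>Y\<close> were not cyclic, then a Moebius-type function \<open>h\<close> on its submodules with
  \<open>h Y = 1\<close> would have vanishing sums over the submodules containing a given element.  Its positive and
  negative parts give two codes of the same weights, of which only the first has a coordinate that vanishes identically.\<close>

lemma fin_socle_cyclic:
  assumes mac: "left_macwilliams R"
  shows "\<exists>x\<in>fin_socle. lprin R x = fin_socle"
proof (rule ccontr)
  let ?Y = "fin_socle"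
  assume neg: "\<not> ?thesis"
  have Y: "left_ideal ?Y R" "finite ?Y" "?Y \<subseteq> T" by (rule left_ideal_fin_socle finite_fin_socle fin_socle_subset)+
  note Yd = left_idealD[OF Y(1)]
  define \<L> where "\<L> = {U. left_ideal U R \<and> U \<subseteq> ?Y}"
  have finL: "finite \<L>" using Y(2) by (auto simp: \<L>_def intro: finite_subset[of _ "Pow ?Y"])
  obtain h :: "'a set \<Rightarrow> int" where h: "\<forall>W\<in>\<L>. (\<Sum>U | U \<in> \<L> \<and> W \<subseteq> U. h U) = (if W = ?Y then 1 else 0)"
    using moebius_type_weights[OF finL, of "\<lambda>W. if W = ?Y then 1 else 0"] by (rule exE)
  have YL: "?Y \<in> \<L>" using Y(1) by (simp add: \<L>_def)
  have "{U. U \<in> \<L> \<and> ?Y \<subseteq> U} = {?Y}" using YL by (auto simp: \<L>_def)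
  then have hY: "h ?Y = 1" using h YL by force
  have hsum: "(\<Sum>U | U \<in> \<L> \<and> y \<in> U. h U) = 0" if y: "y \<in> ?Y" for y
  proof -
    have yc: "y \<in> carrier R" using y Yd by blast
    have "lprin R y \<in> \<L>" using lprin_least[OF Y(1) y] yc by (simp add: \<L>_def)
    moreover have "lprin R y \<noteq> ?Y" using neg y by blast
    ultimately have "(\<Sum>U | U \<in> \<L> \<and> lprin R y \<subseteq> U. h U) = 0" using h by simp
    moreover have "lprin R y \<subseteq> U \<longleftrightarrow> y \<in> U" if "U \<in> \<L>" for U
      using lprin_least[of U y] lprin_self[OF yc] that by (auto simp: \<L>_def)
    then have "{U. U \<in> \<L> \<and> lprin R y \<subseteq> U} = {U. U \<in> \<L> \<and> y \<in> U}" by blast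
    ultimately show ?thesis by simp
  qed
  \<comment> \<open>Each submodule is the kernel of a coordinate map: the projection onto a
    complement along \<open>U\<close> is a right multiplication by
    \<open>mults_pair\<close>.\<close>
  have proj: "\<exists>c\<in>carrier R. \<forall>y\<in>?Y. y \<otimes> c = \<zero> \<longleftrightarrow> y \<in> U" if U: "U \<in> \<L>" for U
  proof -
    have Ul: "left_ideal U R" "U \<subseteq> ?Y" using U by (auto simp: \<L>_def)
    obtain V where V: "left_ideal V R" "V \<subseteq> ?Y" "U \<inter> V = {\<zero>}" "U <+>\<^bsub>R\<^esub> V = ?Y"
      using complement_in_annihilator[OF left_artin Y(1,3,2) Ul] .
    obtain c where c: "c \<in> carrier R" "\<And>y. y \<in> U \<Longrightarrow> y \<otimes> c = y \<otimes> \<zero>" "\<And>y. y \<in> V \<Longrightarrow> y \<otimes> c = y \<otimes> \<one>"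
      using mults_pair[OF Ul(1) V(1,3) zero_closed one_closed] by blast
    have "y \<otimes> c = \<zero> \<longleftrightarrow> y \<in> U" if y: "y \<in> ?Y" for y
    proof -
      have "y \<in> U <+>\<^bsub>R\<^esub> V" using y V(4) by simp
      then obtain u v where uv: "u \<in> U" "v \<in> V" "y = u \<oplus> v" by (auto simp: set_add_mem)
      have cc: "u \<in> carrier R" "v \<in> carrier R" using uv left_idealD(2) Ul(1) V(1) by blast+
      have yc: "y \<otimes> c = v" using uv c cc by (simp add: l_distr)
      show ?thesis
      proof
        assume "y \<otimes> c = \<zero>"
        then have "v = \<zero>" using yc by simp
        then show "y \<in> U" using uv cc by simp
      next
        assume yU: "y \<in> U"
        have yuv: "y \<ominus> u = v" unfolding uv(3) using add_minus_cancel_left[OF cc] .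
        have "y \<ominus> u \<in> U" using left_idealD(7)[OF Ul(1) yU uv(1)] .
        then have "v \<in> U \<inter> V" using yuv uv(2) by simp
        then show "y \<otimes> c = \<zero>" using V(3) yc by blast
      qed
    qed
    then show ?thesis using c(1) by blast
  qed
  then obtain c where c: "\<And>U. U \<in> \<L> \<Longrightarrow> c U \<in> carrier R"
    "\<And>U y. U \<in> \<L> \<Longrightarrow> y \<in> ?Y \<Longrightarrow> y \<otimes> c U = \<zero> \<longleftrightarrow> y \<in> U" by metis
  \<comment> \<open>\<open>nat\<close> cuts off at zero, so \<open>us\<close> lists the submodules
    of positive weight and \<open>vs\<close> those of negative weight, repeated according to the
    absolute value.\<close>
  obtain us where us: "set us = {U \<in> \<L>. nat (h U) > 0}"
    "\<forall>P. card {i. i < length us \<and> P (us ! i)} = (\<Sum>U | U \<in> \<L> \<and> P U. nat (h U))"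
    using list_with_multiplicities[OF finL, of "\<lambda>U. nat (h U)"] by (elim exE conjE) (rule that)
  obtain vs where vs: "set vs = {U \<in> \<L>. nat (- h U) > 0}"
    "\<forall>P. card {i. i < length vs \<and> P (vs ! i)} = (\<Sum>U | U \<in> \<L> \<and> P U. nat (- h U))"
    using list_with_multiplicities[OF finL, of "\<lambda>U. nat (- h U)"] by (elim exE conjE) (rule that)
  have cnt: "card {i. i < length us \<and> y \<in> us ! i} = card {i. i < length vs \<and> y \<in> vs ! i}" if y: "y \<in> ?Y" for y
  proof -
    have d: "int (\<Sum>U | U \<in> \<L> \<and> y \<in> U. nat (h U)) - int (\<Sum>U | U \<in> \<L> \<and> y \<in> U. nat (- h U))
        = (\<Sum>U | U \<in> \<L> \<and> y \<in> U. h U)"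
      by (simp add: sum_subtractf[symmetric] int_nat_eq) (intro sum.cong refl, simp)
    show ?thesis
      using d unfolding us(2)[rule_format, of "\<lambda>U. y \<in> U"] vs(2)[rule_format, of "\<lambda>U. y \<in> U"] hsum[OF y]
      by linarith
  qed
  define n where "n = length us"
  have usL: "us ! i \<in> \<L>" if "i < length us" for i using us(1) nth_mem[OF that] by blast
  have vsL: "vs ! i \<in> \<L>" if "i < length vs" for i using vs(1) nth_mem[OF that] by blast
  have z: "\<zero> \<in> U" if "U \<in> \<L>" for U using that left_idealD(3) by (auto simp: \<L>_def)
  \<comment> \<open>Zero lies in every submodule, so \<open>cnt\<close> at zero compares the full
    lengths.\<close>
  have len: "length vs = n"
  proof -
    have "{i. i < length us \<and> \<zero> \<in> us ! i} = {..<length us}" using z usL by auto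
    moreover have "{i. i < length vs \<and> \<zero> \<in> vs ! i} = {..<length vs}" using z vsL by auto
    ultimately show ?thesis using cnt[OF Yd(3)] by (simp add: n_def)
  qed
  have "?Y \<in> set us" using us(1) YL hY by simp
  then obtain i0 where i0: "i0 < n" "us ! i0 = ?Y" by (auto simp: in_set_conv_nth n_def)
  have "\<exists>\<sigma> u. \<sigma> permutes {..<n} \<and>
      (\<forall>i<n. u i \<in> Units R \<and> (\<forall>y\<in>?Y. y \<otimes> c (vs ! i) = y \<otimes> c (us ! \<sigma> i) \<otimes> u i))"
  proof (rule macwilliams_coordinates[OF mac Y(1), of n "\<lambda>i y. y \<otimes> c (us ! i)" "\<lambda>i y. y \<otimes> c (vs ! i)"])
    show "n \<ge> 1" using i0 by simp
    have cu: "c (us ! i) \<in> carrier R" "c (vs ! i) \<in> carrier R" if "i < n" for i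
      using that c(1) usL vsL len by (auto simp: n_def)
    fix i y assume i: "i < n" and y: "y \<in> ?Y"
    have yc: "y \<in> carrier R" using y Yd by blast
    show "y \<otimes> c (us ! i) \<in> carrier R" "y \<otimes> c (vs ! i) \<in> carrier R" using cu[OF i] yc by auto
    show "(a \<otimes> y) \<otimes> c (us ! i) = a \<otimes> (y \<otimes> c (us ! i))" "(a \<otimes> y) \<otimes> c (vs ! i) = a \<otimes> (y \<otimes> c (vs ! i))"
      if "a \<in> carrier R" for a using that cu[OF i] yc by (auto simp: m_assoc)
    show "(y \<oplus> w) \<otimes> c (us ! i) = y \<otimes> c (us ! i) \<oplus> w \<otimes> c (us ! i)"
      "(y \<oplus> w) \<otimes> c (vs ! i) = y \<otimes> c (vs ! i) \<oplus> w \<otimes> c (vs ! i)" if "w \<in> ?Y" for w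
      using that Yd(2) cu[OF i] yc by (auto simp: l_distr)
  next
    fix y assume y: "y \<in> ?Y"
    have "{i. i < n \<and> y \<otimes> c (us ! i) = \<zero>} = {i. i < length us \<and> y \<in> us ! i}"
      using c(2)[OF usL y] by (auto simp: n_def)
    moreover have "{i. i < n \<and> y \<otimes> c (vs ! i) = \<zero>} = {i. i < length vs \<and> y \<in> vs ! i}"
      using c(2)[OF vsL y] len by auto
    ultimately show "card {i. i < n \<and> y \<otimes> c (us ! i) = \<zero>} = card {i. i < n \<and> y \<otimes> c (vs ! i) = \<zero>}"
      using cnt[OF y] by simp
  qed
  then obtain \<sigma> u where \<sigma>: "\<sigma> permutes {..<n}"
    and u: "\<forall>i<n. u i \<in> Units R \<and> (\<forall>y\<in>?Y. y \<otimes> c (vs ! i) = y \<otimes> c (us ! \<sigma> i) \<otimes> u i)" by blast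
  obtain j where j: "j < n" "\<sigma> j = i0"
    using permutes_image[OF \<sigma>] i0(1) by (metis imageE lessThan_iff)
  have "y \<otimes> c (vs ! j) = \<zero>" if y: "y \<in> ?Y" for y
  proof -
    have "y \<otimes> c (us ! i0) = \<zero>" using c(2)[OF YL y] i0(2) y by simp
    moreover have "u j \<in> carrier R" using u j(1) by auto
    ultimately show ?thesis using u j y by simp
  qed
  then have "?Y \<subseteq> vs ! j" using c(2)[OF vsL] j(1) len by blast
  then have "vs ! j = ?Y" using vsL[of j] j(1) len by (auto simp: \<L>_def)
  then have "?Y \<in> set vs" using nth_mem[of j vs] j(1) len by simp
  then show False using vs(1) hY by simp
qed

text \<open>The left annihilator of \<open>x\<close> contains \<open>J\<close> and has a complement
  modulo \<open>J\<close>. In the decomposition 1 = l + k, the product rk lies in \<open>J\<close>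
  exactly if \<open>r\<close> annihilates \<open>x\<close>, so rx \<mapsto> J + rk is well defined
  and injective.\<close>

lemma fin_socle_embeds:
  assumes x: "x \<in> fin_socle" and gen: "lprin R x = fin_socle"
  shows "embeds_in R ((left_regular R)\<lparr>carrier := fin_socle\<rparr>) (left_quotient R J)"
proof -
  interpret h: ring_hom_ring R "R Quot J" "(+>) J" by (rule quot_hom)
  have xT: "x \<in> T" and xc: "x \<in> carrier R" using x fin_socle_subset by blast+
  let ?L = "lann R {x}"
  have L: "left_ideal ?L R" using xc by simp
  have JL: "J \<subseteq> ?L" using xT jac_subset by (auto simp: rann_def lann_def)
  obtain l k where lk: "l \<in> ?L" "k \<in> carrier R" "\<one> = l \<oplus> k" "\<And>y. y \<in> ?L \<Longrightarrow> y \<otimes> k \<in> J"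
    using complement_mod_jac[OF left_artin L JL] by metis
  have lc: "l \<in> carrier R" using lk(1) by (simp add: lann_def)
  have iff: "J +> (r \<otimes> k) = J +> (s \<otimes> k) \<longleftrightarrow> r \<otimes> x = s \<otimes> x" if rs: "r \<in> carrier R" "s \<in> carrier R" for r s
  proof -
    have d: "r \<ominus> s \<in> carrier R" using rs by simp
    have "J +> (r \<otimes> k) = J +> (s \<otimes> k) \<longleftrightarrow> (r \<ominus> s) \<otimes> k \<in> J"
      by (subst quot_eq_iff) (use rs lk(2) in \<open>simp_all add: l_minus_distr\<close>)
    also have "\<dots> \<longleftrightarrow> r \<ominus> s \<in> ?L"
    proof
      assume "(r \<ominus> s) \<otimes> k \<in> J"
      moreover have "r \<ominus> s = (r \<ominus> s) \<otimes> l \<oplus> (r \<ominus> s) \<otimes> k"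
        using lk(2,3) lc d by (metis r_distr r_one)
      ultimately show "r \<ominus> s \<in> ?L"
        using left_idealD(4,5)[OF L] JL d lk(1) by (metis subsetD)
    qed (rule lk(4))
    also have "\<dots> \<longleftrightarrow> r \<otimes> x = s \<otimes> x" using d rs xc by (simp add: lann_def l_minus_distr)
    finally show ?thesis .
  qed
  define f where "f = (\<lambda>y. J +> ((SOME r. r \<in> carrier R \<and> r \<otimes> x = y) \<otimes> k))"
  have f: "f (r \<otimes> x) = J +> (r \<otimes> k)" if r: "r \<in> carrier R" for r
  proof -
    have "(SOME s. s \<in> carrier R \<and> s \<otimes> x = r \<otimes> x) \<in> carrier R \<and> (SOME s. s \<in> carrier R \<and> s \<otimes> x = r \<otimes> x) \<otimes> x = r \<otimes> x"
      by (rule someI[of _ r]) (use r in simp)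
    then show ?thesis unfolding f_def using iff r by blast
  qed
  have memE: "\<exists>r\<in>carrier R. y = r \<otimes> x" if "y \<in> fin_socle" for y
    using that unfolding gen[symmetric] by (auto simp: lprin_def)
  have inj: "inj_on f fin_socle"
  proof (rule inj_onI)
    fix y z assume y: "y \<in> fin_socle" and z: "z \<in> fin_socle" and e: "f y = f z"
    obtain r s where "r \<in> carrier R" "y = r \<otimes> x" "s \<in> carrier R" "z = s \<otimes> x" using memE y z by blast
    then show "y = z" using e f iff by simp
  qed
  have "f \<in> mod_homs R ((left_regular R)\<lparr>carrier := fin_socle\<rparr>) (left_quotient R J)"
    unfolding mod_homs_def
  proof (intro CollectI conjI ballI)
    show "f \<in> carrier ((left_regular R)\<lparr>carrier := fin_socle\<rparr>) \<rightarrow> carrier (left_quotient R J)"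
    proof
      fix y assume "y \<in> carrier ((left_regular R)\<lparr>carrier := fin_socle\<rparr>)"
      then obtain r where "r \<in> carrier R" "y = r \<otimes> x" using memE by auto
      then have "f y = J +> (r \<otimes> k)" "r \<otimes> k \<in> carrier R" using f lk(2) by (simp_all only: m_closed)
      then have "f y \<in> carrier (R Quot J)" using h.hom_closed by metis
      then show "f y \<in> carrier (left_quotient R J)" by (simp add: left_quotient_def)
    qed
    fix y assume "y \<in> carrier ((left_regular R)\<lparr>carrier := fin_socle\<rparr>)"
    then obtain r where r: "r \<in> carrier R" "y = r \<otimes> x" using memE by auto
    show "f (a \<odot>\<^bsub>(left_regular R)\<lparr>carrier := fin_socle\<rparr>\<^esub> y) = a \<odot>\<^bsub>left_quotient R J\<^esub> f y"
      if a: "a \<in> carrier R" for a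
    proof -
      have "f (a \<otimes> y) = J +> (a \<otimes> (r \<otimes> k))" using f[of "a \<otimes> r"] r a xc lk(2) by (simp add: m_assoc)
      then show ?thesis using f[OF r(1)] r a lk(2) h.hom_mult[of a "r \<otimes> k"]
        by (simp add: left_quotient_def left_regular_def)
    qed
    fix z assume "z \<in> carrier ((left_regular R)\<lparr>carrier := fin_socle\<rparr>)"
    then obtain s where s: "s \<in> carrier R" "z = s \<otimes> x" using memE by auto
    have "f (y \<oplus> z) = J +> (r \<otimes> k \<oplus> s \<otimes> k)"
      using f[of "r \<oplus> s"] r s xc lk(2) by (simp add: l_distr)
    then show "f (y \<oplus>\<^bsub>(left_regular R)\<lparr>carrier := fin_socle\<rparr>\<^esub> z) = f y \<oplus>\<^bsub>left_quotient R J\<^esub> f z"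
      using f[OF r(1)] f[OF s(1)] r s lk(2) h.hom_add[of "r \<otimes> k" "s \<otimes> k"]
      by (simp add: left_quotient_def left_regular_def)
  qed
  then show ?thesis using inj by (auto simp: embeds_in_def)
qed

end

theorem corollary4p9:
  fixes R :: "('a, 'r) ring_scheme"
  assumes "ring R" and "left_artinian R" and "right_artinian R"
  shows "finitarily_frobenius TYPE('a + 'x) R \<longleftrightarrow> left_macwilliams R \<and> right_macwilliams R"
proof
  interpret ring R by fact
  note socle = finitary_left_socle_eq[OF assms(2)]
  show "left_macwilliams R \<and> right_macwilliams R" if "finitarily_frobenius TYPE('a + 'x) R"
  proof -
    have "linj R" and emb: "embeds_in R ((left_regular R)\<lparr>carrier := fin_socle\<rparr>) (left_quotient R (jacobson_radical R))"
      using that linj_of_left_injective[OF assms(1)] socle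
      by (auto simp: finitarily_frobenius_def quasi_frobenius_def)
    then interpret quasi_frobenius_ring R
      using assms by unfold_locales
    have bal: balanced using balanced_of_embedding[OF emb] .
    have "left_macwilliams R" by (rule left_macwilliams[OF bal])
    \<comment> \<open>The opposite ring is self-injective and balanced as well, so the extension
      theorem applies to it and yields the property for right codes.\<close>
    moreover have "left_macwilliams (opp R)"
      by (rule left_selfinjective.left_macwilliams[OF opp_selfinjective opp_balanced[OF bal]])
    ultimately show ?thesis by (simp add: left_macwilliams_opp)
  qed
  show "finitarily_frobenius TYPE('a + 'x) R" if mac: "left_macwilliams R \<and> right_macwilliams R"
  proof -
    have linj: "linj R"
      using annihilator_injective.linj[OF annihilator_injective_of_macwilliams[OF assms]] mac by blast
    then interpret quasi_frobenius_ring R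
      using assms by unfold_locales
    obtain x where "x \<in> fin_socle" "lprin R x = fin_socle" using fin_socle_cyclic mac by blast
    then show ?thesis
      using fin_socle_embeds left_injective_of_linj[OF assms(1) linj] assms(1,2) socle
      by (simp add: finitarily_frobenius_def quasi_frobenius_def)
  qed
qed

end
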